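(* Let $\mathbb{k}$ be a field and let $M\in\mathrm{rep}(\mathbb{Z}^2)$. Then the cokernel and the kernel of the morphism $M[-1,-1]\to M$ given by multiplication by $\mathbf{x}\mathbf{y}$ each decompose in an essentially unique way as direct sums of spread curve representations.
   Context: $\mathrm{rep}(\mathbb{Z}^2)$ is the category of functors from $\mathbb{Z}^2$ (product order) to finite dimensional $\mathbb{k}$-vector spaces, identified with pointwise finite dimensional bigraded $\mathbb{k}[\mathbf{x},\mathbf{y}]$-modules ($\mathbf{x}:M_i\to M_{i+(1,0)}$, $\mathbf{y}:M_i\to M_{i+(0,1)}$ structure maps); $M[a]_i=M_{i+a}$. A spread curve is a non-empty subset $I\subseteq\mathbb{Z}^2$ (possibly infinite) that is poset-connected (any two elements are joined by a finite sequence in $I$ whose consecutive elements are comparable), poset-convex, and such that $p\in I$ implies $p+(1,1)\notin I$. The spread curve representation $\mathbb{k}_I$ is $\mathbb{k}$ on $I$, $0$ elsewhere, with identity structure maps within $I$. Essentially unique means unique up to reordering and isomorphism of summands. *)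

theory Defs
  imports "Jordan_Normal_Form.Missing_VectorSpace" "HOL-Algebra.AbelCoset" "HOL-Library.Product_Order"
begin

text \<open>
  Vector spaces are those of the AFP entry VectorSpace (module records over a HOL-Algebra field).
  The order and the addition on pairs of integers are the componentwise ones of
  Product_Order and Product_Plus.
\<close>

section \<open>Modules: quotients, direct sums, the ground field\<close>

text \<open>
  The quotient of a module by a submodule, with cosets as elements. As for ideals in QuotRing,
  scalar multiplication joins cosets, because the pointwise multiple \<open>r \<odot> X\<close>
  is not a coset for \<open>r = \<zero>\<close>. The fields \<open>mult\<close> and \<open>one\<close> of a module record carry
  no meaning, here and below.
\<close>

definition quot_module :: "('a, 'b, 'm) module_scheme \<Rightarrow> 'b set \<Rightarrow> ('a, 'b set) module" where
  "quot_module V H =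
    \<lparr>carrier = a_rcosets\<^bsub>V\<^esub> H, mult = (\<lambda>X Y. H), one = H,
     zero = H, add = set_add V, smult = (\<lambda>r X. \<Union>x\<in>X. H +>\<^bsub>V\<^esub> (r \<odot>\<^bsub>V\<^esub> x))\<rparr>"

definition sum_module :: "'i set \<Rightarrow> ('i \<Rightarrow> ('a, 'b, 'm) module_scheme) \<Rightarrow> ('a, 'i \<Rightarrow> 'b) module" where
  "sum_module A V =
    \<lparr>carrier = {v \<in> (\<Pi>\<^sub>E a\<in>A. carrier (V a)). finite {a \<in> A. v a \<noteq> \<zero>\<^bsub>V a\<^esub>}},
     mult = (\<lambda>v w. \<lambda>a\<in>A. \<zero>\<^bsub>V a\<^esub>), one = (\<lambda>a\<in>A. \<zero>\<^bsub>V a\<^esub>),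
     zero = (\<lambda>a\<in>A. \<zero>\<^bsub>V a\<^esub>), add = (\<lambda>v w. \<lambda>a\<in>A. v a \<oplus>\<^bsub>V a\<^esub> w a),
     smult = (\<lambda>r v. \<lambda>a\<in>A. r \<odot>\<^bsub>V a\<^esub> v a)\<rparr>"

definition self_module :: "('a, 'm) ring_scheme \<Rightarrow> ('a, 'a) module" where
  "self_module K =
    \<lparr>carrier = carrier K, mult = mult K, one = one K,
     zero = zero K, add = add K, smult = mult K\<rparr>"


section \<open>The category of pointwise finite-dimensional representations of \<open>\<int>\<^sup>2\<close>\<close>

record ('a, 'b) zz_rep =
  ob :: "int \<times> int \<Rightarrow> ('a, 'b) module"
  tr :: "int \<times> int \<Rightarrow> int \<times> int \<Rightarrow> 'b \<Rightarrow> 'b"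

text \<open>Only the maps \<open>tr M i j\<close> with \<open>i \<le> j\<close> matter, and only on \<open>carrier (ob M i)\<close>.\<close>

locale ZZ_rep =
  fixes K :: "('a, 'm) ring_scheme" and M :: "('a, 'b) zz_rep"
  assumes vectorspace: "vectorspace K (ob M i)"
    and fin_dim: "vectorspace.fin_dim K (ob M i)"
    and linear: "i \<le> j \<Longrightarrow> linear_map K (ob M i) (ob M j) (tr M i j)"
    and tr_id: "m \<in> carrier (ob M i) \<Longrightarrow> tr M i i m = m"
    and tr_comp: "i \<le> j \<Longrightarrow> j \<le> k \<Longrightarrow> m \<in> carrier (ob M i) \<Longrightarrow>
                    tr M j k (tr M i j m) = tr M i k m"

definition rep_morphism ::
  "('a, 'm) ring_scheme \<Rightarrow> ('a, 'b) zz_rep \<Rightarrow> ('a, 'c) zz_rep \<Rightarrow> (int \<times> int \<Rightarrow> 'b \<Rightarrow> 'c) \<Rightarrow> bool" where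
  "rep_morphism K M N f \<longleftrightarrow>
    (\<forall>i. linear_map K (ob M i) (ob N i) (f i)) \<and>
    (\<forall>i j. i \<le> j \<longrightarrow> (\<forall>m\<in>carrier (ob M i). f j (tr M i j m) = tr N i j (f i m)))"

definition rep_iso :: "('a, 'm) ring_scheme \<Rightarrow> ('a, 'b) zz_rep \<Rightarrow> ('a, 'c) zz_rep \<Rightarrow> bool" where
  "rep_iso K M N \<longleftrightarrow>
    (\<exists>f. rep_morphism K M N f \<and> (\<forall>i. bij_betw (f i) (carrier (ob M i)) (carrier (ob N i))))"

definition rep_kernel ::
  "('a, 'b) zz_rep \<Rightarrow> ('a, 'c) zz_rep \<Rightarrow> (int \<times> int \<Rightarrow> 'b \<Rightarrow> 'c) \<Rightarrow> ('a, 'b) zz_rep" where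
  "rep_kernel M N f =
    \<lparr>ob = (\<lambda>i. (ob M i)\<lparr>carrier := mod_hom.ker (ob M i) (ob N i) (f i)\<rparr>), tr = tr M\<rparr>"

definition rep_cokernel ::
  "('a, 'b) zz_rep \<Rightarrow> ('a, 'c) zz_rep \<Rightarrow> (int \<times> int \<Rightarrow> 'b \<Rightarrow> 'c) \<Rightarrow> ('a, 'c set) zz_rep" where
  "rep_cokernel M N f =
    \<lparr>ob = (\<lambda>i. quot_module (ob N i) (mod_hom.im (ob M i) (f i))),
     tr = (\<lambda>i j X. \<Union>x\<in>X. mod_hom.im (ob M j) (f j) +>\<^bsub>ob N j\<^esub> tr N i j x)\<rparr>"

definition rep_sum :: "'i set \<Rightarrow> ('i \<Rightarrow> ('a, 'b) zz_rep) \<Rightarrow> ('a, 'i \<Rightarrow> 'b) zz_rep" where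
  "rep_sum A F =
    \<lparr>ob = (\<lambda>i. sum_module A (\<lambda>a. ob (F a) i)),
     tr = (\<lambda>i j v. \<lambda>a\<in>A. tr (F a) i j (v a))\<rparr>"

definition rep_shift :: "('a, 'b) zz_rep \<Rightarrow> int \<times> int \<Rightarrow> ('a, 'b) zz_rep" where
  "rep_shift M a = \<lparr>ob = (\<lambda>i. ob M (i + a)), tr = (\<lambda>i j. tr M (i + a) (j + a))\<rparr>"

definition x_act :: "('a, 'b) zz_rep \<Rightarrow> int \<times> int \<Rightarrow> 'b \<Rightarrow> 'b" where
  "x_act M i = tr M i (i + (1, 0))"

definition y_act :: "('a, 'b) zz_rep \<Rightarrow> int \<times> int \<Rightarrow> 'b \<Rightarrow> 'b" where
  "y_act M i = tr M i (i + (0, 1))"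

text \<open>
  Multiplication by \<open>xy\<close> as a morphism from \<open>M[-1,-1]\<close> to \<open>M\<close>; its component at \<open>i\<close> starts at
  \<open>ob M (i + (-1, -1))\<close> and passes through \<open>ob M (i + (-1, 0))\<close>.
\<close>

definition mult_xy :: "('a, 'b) zz_rep \<Rightarrow> int \<times> int \<Rightarrow> 'b \<Rightarrow> 'b" where
  "mult_xy M i = x_act M (i + (-1, 0)) \<circ> y_act M (i + (-1, -1))"


section \<open>Spread curves\<close>

definition poset_connected :: "'p::order set \<Rightarrow> bool" where
  "poset_connected I \<longleftrightarrow>
    (\<forall>p\<in>I. \<forall>q\<in>I. (\<lambda>u v. u \<in> I \<and> v \<in> I \<and> (u \<le> v \<or> v \<le> u))\<^sup>*\<^sup>* p q)"

definition poset_convex :: "'p::order set \<Rightarrow> bool" where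
  "poset_convex I \<longleftrightarrow> (\<forall>p\<in>I. \<forall>q\<in>I. \<forall>r. p \<le> r \<and> r \<le> q \<longrightarrow> r \<in> I)"

definition spread_curve :: "(int \<times> int) set \<Rightarrow> bool" where
  "spread_curve I \<longleftrightarrow> I \<noteq> {} \<and> poset_connected I \<and> poset_convex I \<and> (\<forall>p\<in>I. p + (1, 1) \<notin> I)"

definition spread_rep :: "('a, 'm) ring_scheme \<Rightarrow> (int \<times> int) set \<Rightarrow> ('a, 'a) zz_rep" where
  "spread_rep K I =
    \<lparr>ob = (\<lambda>i. (self_module K)\<lparr>carrier := (if i \<in> I then carrier K else {\<zero>\<^bsub>K\<^esub>})\<rparr>),
     tr = (\<lambda>i j c. if i \<in> I \<and> j \<in> I then c else \<zero>\<^bsub>K\<^esub>)\<rparr>"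

definition spread_curve_decomposition ::
  "('a, 'm) ring_scheme \<Rightarrow> ('a, 'b) zz_rep \<Rightarrow> 'i set \<Rightarrow> ('i \<Rightarrow> (int \<times> int) set) \<Rightarrow> bool" where
  "spread_curve_decomposition K M A I \<longleftrightarrow>
    (\<forall>a\<in>A. spread_curve (I a)) \<and> rep_iso K M (rep_sum A (\<lambda>a. spread_rep K (I a)))"

text \<open>Equality of two families of spread curve representations up to reordering and isomorphism.\<close>

definition same_summands ::
  "('a, 'm) ring_scheme \<Rightarrow> 'i set \<Rightarrow> ('i \<Rightarrow> (int \<times> int) set) \<Rightarrow> 'j set \<Rightarrow> ('j \<Rightarrow> (int \<times> int) set) \<Rightarrow> bool" where
  "same_summands K A I B J \<longleftrightarrow>
    (\<exists>s. bij_betw s A B \<and> (\<forall>a\<in>A. rep_iso K (spread_rep K (I a)) (spread_rep K (J (s a)))))"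

text \<open>
  A decomposition of a pointwise finite-dimensional representation has only finitely many summands
  whose support contains a given point of \<open>\<int>\<^sup>2\<close>, hence countably many in all. Existence of
  a decomposition can therefore be stated with indices in \<open>nat\<close>; for uniqueness the two index types
  are arbitrary.
\<close>

end

(*
A representation on which the diagonal maps vanish looks, at every point, like the crossing of two
complexes: im x \<subseteq> ker y towards the north-west and im y \<subseteq> ker x towards the
south-east. Starting from 0 and the whole space, closing up under images along x and preimages along y
yields a chain of subspaces of each space. Take a vector m and a hyperplane C with m \<notin> C that are
separated by two consecutive members of this chain. If the gap lies below im x, then m and C are pulled
back along x; if it lies above ker y, they are pushed forward along y; otherwise the walk stops. In each
case the new pair is again separated by a gap, so the walk never gets stuck. A pair that lies in a gap of
this chain and of the mirrored one walks in both directions, and the points visited form a staircase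
whose representation splits off. Doing this along an enumeration that visits every point infinitely
often exhausts the representation, because all spaces are finite-dimensional.

For uniqueness, the summands with support I in two decompositions are compared at a point of I: a
composite k_I \<rightarrow> k_J \<rightarrow> k_I vanishes for J \<noteq> I, so the change of basis restricts to an
injective map between the parts with support I.
*)

theory Submission
  imports Defs "HOL-Library.Nat_Bijection" "HOL-Library.Countable"
begin

section \<open>Subspaces of finite-dimensional spaces\<close>

text \<open>A direct summand needs a line and a complement at every point, both compatible with all
  arrows. This is why the walk carries a pair: the hyperplanes \<open>C\<close> add up to a
  subrepresentation, inside which the construction is repeated. The two members of the pair behave
  dually. Going back along x the hyperplane is forced and the vector is chosen; going forward along
  y the vector is forced and the hyperplane is chosen. The gap ensures that the choice keeps the
  vector outside the hyperplane. The chain is totally ordered because y after x is zero, which puts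
  every image below every preimage. Supports can be infinite and there can be infinitely many
  summands, so no global dimension count is possible. Finite dimension is used at one point at a
  time: the decreasing sequence of remainders reaches zero at each point after a number of stages
  that depends on the point. Uniqueness does not go through endomorphism rings. For each support, a
  single point of it suffices to compare multiplicities: an independent family is played off against
  a generating one.\<close>

context vectorspace
begin

lemma subspaceI:
  assumes "W \<subseteq> carrier V" "\<zero>\<^bsub>V\<^esub> \<in> W"
    and "\<And>v w. v \<in> W \<Longrightarrow> w \<in> W \<Longrightarrow> v \<oplus>\<^bsub>V\<^esub> w \<in> W"
    and "\<And>c v. c \<in> carrier K \<Longrightarrow> v \<in> W \<Longrightarrow> c \<odot>\<^bsub>V\<^esub> v \<in> W"
  shows "subspace K W V"
proof -
  have "module K V" "vectorspace K V" ..
  then show ?thesis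
    using assms unfolding subspace_def submodule_def by blast
qed

lemma subspace_props:
  assumes "subspace K W V"
  shows "W \<subseteq> carrier V" "\<zero>\<^bsub>V\<^esub> \<in> W"
    and "v \<in> W \<Longrightarrow> w \<in> W \<Longrightarrow> v \<oplus>\<^bsub>V\<^esub> w \<in> W"
    and "c \<in> carrier K \<Longrightarrow> v \<in> W \<Longrightarrow> c \<odot>\<^bsub>V\<^esub> v \<in> W"
    and "v \<in> W \<Longrightarrow> \<ominus>\<^bsub>V\<^esub> v \<in> W"
    and "v \<in> W \<Longrightarrow> w \<in> W \<Longrightarrow> v \<ominus>\<^bsub>V\<^esub> w \<in> W"
proof -
  interpret submodule K W V
    using assms by (simp add: subspace_def)
  show sub: "W \<subseteq> carrier V" and "\<zero>\<^bsub>V\<^esub> \<in> W"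
    using subset by auto
  show add: "v \<in> W \<Longrightarrow> w \<in> W \<Longrightarrow> v \<oplus>\<^bsub>V\<^esub> w \<in> W" for v w
    by simp
  show smult: "c \<in> carrier K \<Longrightarrow> v \<in> W \<Longrightarrow> c \<odot>\<^bsub>V\<^esub> v \<in> W" for c v
    by simp
  show neg: "v \<in> W \<Longrightarrow> \<ominus>\<^bsub>V\<^esub> v \<in> W" for v
    using smult[of "\<ominus>\<^bsub>K\<^esub> \<one>\<^bsub>K\<^esub>" v] sub smult_minus_1[of v]
    by (metis R.a_inv_closed R.one_closed subsetD)
  show "v \<in> W \<Longrightarrow> w \<in> W \<Longrightarrow> v \<ominus>\<^bsub>V\<^esub> w \<in> W" for v w
    using add neg by (simp add: a_minus_def)
qed

lemma zero_subspace: "subspace K {\<zero>\<^bsub>V\<^esub>} V"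
  by (rule subspaceI) auto

lemma carrier_subspace: "subspace K (carrier V) V"
  by (rule subspaceI) auto

lemma subspace_add_cancel:
  assumes "subspace K S V" "v \<in> S" "w \<in> carrier V" "v \<oplus>\<^bsub>V\<^esub> w \<in> S"
  shows "w \<in> S"
proof -
  have "(\<ominus>\<^bsub>V\<^esub> v) \<oplus>\<^bsub>V\<^esub> (v \<oplus>\<^bsub>V\<^esub> w) \<in> S"
    using assms subspace_props[OF assms(1)] by blast
  moreover have "(\<ominus>\<^bsub>V\<^esub> v) \<oplus>\<^bsub>V\<^esub> (v \<oplus>\<^bsub>V\<^esub> w) = w"
    using assms subspace_props(1)[OF assms(1)] M.r_neg1 by auto
  ultimately show ?thesis by simp
qed

lemma subspace_smult_cancel:
  assumes "subspace K S V" "c \<in> carrier K" "c \<noteq> \<zero>\<^bsub>K\<^esub>" "v \<in> carrier V" "c \<odot>\<^bsub>V\<^esub> v \<in> S"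
  shows "v \<in> S"
  using mult_inverse[OF assms(2,4) refl assms(3)] inverse_exists[OF assms(2,3)]
    subspace_props(4)[OF assms(1) _ assms(5)] by metis

text \<open>A dimension that stays inside the ambient space, so that no induced module structures
  have to be handled. It is the measure that turns finite dimension into termination and into least
  and greatest members of chains.\<close>

definition rank :: "'c set \<Rightarrow> nat" where
  "rank S = (GREATEST n. \<exists>B\<subseteq>S. lin_indpt B \<and> card B = n)"

lemma lin_indpt_empty: "lin_indpt {}"
  unfolding lin_dep_def by auto

lemma maximal_lin_indpt:
  assumes fd: fin_dim and S: "S \<subseteq> carrier V"
  obtains B where "B \<subseteq> S" "lin_indpt B" "card B = rank S" "finite B"
proof -
  have "\<exists>B\<subseteq>S. lin_indpt B \<and> card B = rank S"
    unfolding rank_def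
  proof (rule GreatestI_nat[where b = dim])
    show "\<exists>B\<subseteq>S. lin_indpt B \<and> card B = 0"
      using lin_indpt_empty by (intro exI[of _ "{}"]) auto
  qed (use li_le_dim[OF fd] S in blast)
  then show ?thesis
    using that li_le_dim(1)[OF fd] S by blast
qed

lemma card_le_rank:
  assumes fd: fin_dim and S: "S \<subseteq> carrier V" and B: "B \<subseteq> S" "lin_indpt B"
  shows "card B \<le> rank S"
  unfolding rank_def
  by (rule Greatest_le_nat[where b = dim]) (use B li_le_dim[OF fd] S in blast)+

lemma lin_indpt_insert:
  assumes "B \<subseteq> carrier V" "lin_indpt B" "v \<in> carrier V" "v \<notin> span B"
  shows "lin_indpt (insert v B)" "v \<notin> B"
proof -
  show "v \<notin> B"
    using assms in_own_span by blast
  then show "lin_indpt (insert v B)"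
    using lin_dep_iff_in_span[OF assms(1,2,3)] assms(4) by simp
qed

text \<open>An independent subset of \<open>S\<close> of maximal size spans nothing outside
  \<open>S\<close>, so any vector of \<open>T\<close> outside \<open>S\<close> extends it.\<close>

lemma rank_less:
  assumes fd: fin_dim and S: "subspace K S V" and T: "T \<subseteq> carrier V" and ST: "S \<subset> T"
  shows "rank S < rank T"
proof -
  note SV = subspace_props(1)[OF S]
  obtain B where B: "B \<subseteq> S" "lin_indpt B" "card B = rank S" "finite B"
    using maximal_lin_indpt[OF fd SV] .
  obtain v where v: "v \<in> T" "v \<notin> S"
    using ST by blast
  have "span B \<subseteq> S"
    using span_is_subset[OF B(1)] S by (simp add: subspace_def)
  then have ins: "lin_indpt (insert v B)" "v \<notin> B"
    using lin_indpt_insert[of B v] B v SV T by auto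
  have "card (insert v B) \<le> rank T"
    using ins v B ST by (intro card_le_rank[OF fd T]) auto
  then show ?thesis
    using ins(2) B(3,4) by simp
qed

text \<open>A largest independent subset \<open>B\<close> of \<open>S\<close> must generate
  \<open>S\<close>: otherwise \<open>span B\<close> would be a proper subspace of \<open>S\<close>
  whose rank is still at least \<open>card B = rank S\<close>.\<close>

lemma subspace_fin_dim:
  assumes fd: fin_dim and S: "subspace K S V"
  shows "vectorspace.fin_dim K (vs S)"
proof -
  note SV = subspace_props(1)[OF S]
  obtain B where B: "B \<subseteq> S" "lin_indpt B" "card B = rank S" "finite B"
    using maximal_lin_indpt[OF fd SV] .
  have sub: "submodule K S V"
    using S by (simp add: subspace_def)
  have BV: "B \<subseteq> carrier V"
    using B(1) SV by blast
  have "span B = S"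
  proof (rule ccontr)
    assume "span B \<noteq> S"
    then have "span B \<subset> S"
      using span_is_subset[OF B(1) sub] by blast
    then have "rank (span B) < rank S"
      using rank_less[OF fd span_is_subspace[OF BV] SV] by simp
    moreover have "card B \<le> rank (span B)"
      using card_le_rank[OF fd _ in_own_span[OF BV] B(2)] span_is_subset2[OF BV] by simp
    ultimately show False
      using B(3) by simp
  qed
  then have "LinearCombinations.module.span K (vs S) B = S"
    using span_li_not_depend(1)[OF B(1) sub] by simp
  then show ?thesis
    using B(1,4) vectorspace.fin_dim_def[OF subspace_is_vs[OF S]] by auto
qed

definition line_split :: "'c set \<Rightarrow> 'c \<Rightarrow> 'c set \<Rightarrow> bool" where
  "line_split W m C \<longleftrightarrow> subspace K C V \<and> C \<subseteq> W \<and> m \<in> W \<and>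
     (\<forall>v\<in>W. \<exists>c\<in>carrier K. \<exists>w\<in>C. v = c \<odot>\<^bsub>V\<^esub> m \<oplus>\<^bsub>V\<^esub> w)"

lemma line_split_trivial:
  assumes "subspace K W V"
  shows "line_split W \<zero>\<^bsub>V\<^esub> W"
proof -
  have "v = \<zero>\<^bsub>K\<^esub> \<odot>\<^bsub>V\<^esub> \<zero>\<^bsub>V\<^esub> \<oplus>\<^bsub>V\<^esub> v" if "v \<in> W" for v
    using that subspace_props(1)[OF assms] by auto
  then show ?thesis
    unfolding line_split_def using assms subspace_props(2)[OF assms] R.zero_closed by blast
qed

text \<open>Take \<open>C\<close> of largest rank among the subspaces between \<open>S\<close> and
  \<open>W\<close> that avoid \<open>m\<close>. Adding a vector \<open>v\<close> outside
  \<open>C\<close> must capture \<open>m\<close>, with a nonzero coefficient at \<open>v\<close>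
  because \<open>m \<notin> C\<close>, and the equation can be solved for \<open>v\<close>.\<close>

lemma hyperplane_exists:
  assumes fd: fin_dim and W: "subspace K W V" and S: "subspace K S V" "S \<subseteq> W"
    and m: "m \<in> W" "m \<notin> S"
  obtains C where "line_split W m C" "S \<subseteq> C" "m \<notin> C"
proof -
  let ?P = "\<lambda>C. subspace K C V \<and> S \<subseteq> C \<and> C \<subseteq> W \<and> m \<notin> C"
  note WV = subspace_props(1)[OF W]
  have "rank C \<le> rank W" if "?P C" for C
    using rank_less[OF fd _ WV, of C] that m by (cases "C = W") (auto simp: psubset_eq)
  then have bd: "\<forall>C. ?P C \<longrightarrow> rank C < Suc (rank W)"
    by (simp add: less_Suc_eq_le)
  obtain C where C: "?P C" and max: "\<And>D. ?P D \<Longrightarrow> rank D \<le> rank C"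
    using ex_has_greatest_nat[of ?P S rank, OF _ bd] S m by blast
  note Cs = subspace_props[OF conjunct1[OF C]]
  have "\<exists>c\<in>carrier K. \<exists>w\<in>C. v = c \<odot>\<^bsub>V\<^esub> m \<oplus>\<^bsub>V\<^esub> w" if v: "v \<in> W" for v
  proof (cases "v \<in> C")
    case True
    have "v = \<zero>\<^bsub>K\<^esub> \<odot>\<^bsub>V\<^esub> m \<oplus>\<^bsub>V\<^esub> v"
      using v m WV by (simp add: subsetD)
    with True show ?thesis
      by blast
  next
    case False
    define D where "D = {a \<odot>\<^bsub>V\<^esub> v \<oplus>\<^bsub>V\<^esub> w |a w. a \<in> carrier K \<and> w \<in> C}"
    have vV: "v \<in> carrier V" and CV: "C \<subseteq> carrier V"
      using v WV Cs by auto
    have D: "subspace K D V"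
    proof (rule subspaceI)
      show "D \<subseteq> carrier V"
        using vV CV unfolding D_def by auto
      have "\<zero>\<^bsub>V\<^esub> = \<zero>\<^bsub>K\<^esub> \<odot>\<^bsub>V\<^esub> v \<oplus>\<^bsub>V\<^esub> \<zero>\<^bsub>V\<^esub>"
        using vV by simp
      then show "\<zero>\<^bsub>V\<^esub> \<in> D"
        unfolding D_def using Cs(2) by blast
    next
      fix x y assume "x \<in> D" "y \<in> D"
      then obtain a w b u where *: "a \<in> carrier K" "b \<in> carrier K" "w \<in> C" "u \<in> C"
        and x: "x = a \<odot>\<^bsub>V\<^esub> v \<oplus>\<^bsub>V\<^esub> w" and y: "y = b \<odot>\<^bsub>V\<^esub> v \<oplus>\<^bsub>V\<^esub> u"
        unfolding D_def by blast
      have "x \<oplus>\<^bsub>V\<^esub> y = (a \<oplus>\<^bsub>K\<^esub> b) \<odot>\<^bsub>V\<^esub> v \<oplus>\<^bsub>V\<^esub> (w \<oplus>\<^bsub>V\<^esub> u)"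
        using * vV CV unfolding x y
        by (simp add: smult_l_distr M.add.m_ac subsetD)
      then show "x \<oplus>\<^bsub>V\<^esub> y \<in> D"
        unfolding D_def using * Cs(3) by blast
    next
      fix c x assume c: "c \<in> carrier K" and "x \<in> D"
      then obtain a w where *: "a \<in> carrier K" "w \<in> C" and x: "x = a \<odot>\<^bsub>V\<^esub> v \<oplus>\<^bsub>V\<^esub> w"
        unfolding D_def by blast
      have "c \<odot>\<^bsub>V\<^esub> x = (c \<otimes>\<^bsub>K\<^esub> a) \<odot>\<^bsub>V\<^esub> v \<oplus>\<^bsub>V\<^esub> c \<odot>\<^bsub>V\<^esub> w"
        using * vV CV c unfolding x
        by (simp add: smult_r_distr smult_assoc1 subsetD)
      then show "c \<odot>\<^bsub>V\<^esub> x \<in> D"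
        unfolding D_def using * c Cs(4) by blast
    qed
    have CD: "C \<subseteq> D"
    proof
      fix w assume "w \<in> C"
      then have "w = \<zero>\<^bsub>K\<^esub> \<odot>\<^bsub>V\<^esub> v \<oplus>\<^bsub>V\<^esub> w"
        using vV CV by auto
      then show "w \<in> D"
        unfolding D_def using \<open>w \<in> C\<close> by blast
    qed
    have "v = \<one>\<^bsub>K\<^esub> \<odot>\<^bsub>V\<^esub> v \<oplus>\<^bsub>V\<^esub> \<zero>\<^bsub>V\<^esub>"
      using vV by simp
    then have "v \<in> D"
      unfolding D_def using Cs(2) by blast
    then have "rank C < rank D"
      using rank_less[OF fd] CD D C False subspace_props(1)[OF D] by blast
    then have "\<not> ?P D"
      using max[of D] by auto
    moreover have "D \<subseteq> W"
      unfolding D_def using v C subspace_props(3,4)[OF W] by auto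
    ultimately have "m \<in> D"
      using D CD C by blast
    then obtain a w where aw: "a \<in> carrier K" "w \<in> C" "m = a \<odot>\<^bsub>V\<^esub> v \<oplus>\<^bsub>V\<^esub> w"
      unfolding D_def by blast
    have "a \<noteq> \<zero>\<^bsub>K\<^esub>"
    proof
      assume "a = \<zero>\<^bsub>K\<^esub>"
      then have "m = w"
        using aw vV CV by auto
      then show False
        using aw C by blast
    qed
    then have ia: "inv\<^bsub>K\<^esub> a \<in> carrier K" "inv\<^bsub>K\<^esub> a \<otimes>\<^bsub>K\<^esub> a = \<one>\<^bsub>K\<^esub>"
      using aw(1) by (auto simp: field_Units)
    have wV: "w \<in> carrier V"
      using aw CV by blast
    let ?u = "inv\<^bsub>K\<^esub> a \<odot>\<^bsub>V\<^esub> w"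
    have "inv\<^bsub>K\<^esub> a \<odot>\<^bsub>V\<^esub> m \<oplus>\<^bsub>V\<^esub> (\<ominus>\<^bsub>V\<^esub> ?u) = (v \<oplus>\<^bsub>V\<^esub> ?u) \<oplus>\<^bsub>V\<^esub> (\<ominus>\<^bsub>V\<^esub> ?u)"
      unfolding aw(3) using ia aw(1) vV wV
      by (simp add: smult_r_distr smult_assoc1[symmetric])
    also have "\<dots> = v"
      using ia vV wV by (simp add: M.add.m_assoc M.r_neg)
    finally show ?thesis
      using ia(1) aw(2) Cs(4,5) by (metis (no_types, lifting))
  qed
  then show ?thesis
    using that[of C] C m unfolding line_split_def by blast
qed

lemma linear_image_subspace:
  assumes f: "linear_map K V V' f" and S: "subspace K S V"
  shows "subspace K (f ` S) V'"
proof -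
  interpret f: linear_map K V V' f by fact
  note Ss = subspace_props[OF S]
  show ?thesis
  proof (rule f.W.subspaceI)
    show "\<zero>\<^bsub>V'\<^esub> \<in> f ` S"
      using Ss(2) f.T0_is_0 by (metis imageI)
    show "v \<oplus>\<^bsub>V'\<^esub> w \<in> f ` S" if vw: "v \<in> f ` S" "w \<in> f ` S" for v w
    proof -
      obtain v' w' where *: "v' \<in> S" "w' \<in> S" "v = f v'" "w = f w'"
        using vw by blast
      then show ?thesis
        using f.f_add[of v' w'] Ss by (metis imageI subsetD)
    qed
    show "c \<odot>\<^bsub>V'\<^esub> v \<in> f ` S" if cv: "c \<in> carrier K" "v \<in> f ` S" for c v
    proof -
      obtain v' where *: "v' \<in> S" "v = f v'"
        using cv by blast
      then show ?thesis
        using cv f.f_smult[of c v'] Ss by (metis imageI subsetD)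
    qed
  qed (use Ss(1) in auto)
qed

lemma linear_preimage_subspace:
  assumes f: "linear_map K V V' f" and W: "subspace K W V" and S: "subspace K S V'"
  shows "subspace K {v \<in> W. f v \<in> S} V"
proof -
  interpret f: linear_map K V V' f by fact
  show ?thesis
    using subspace_props[OF W] f.W.subspace_props[OF S]
    by (intro subspaceI) (auto simp: subset_iff)
qed

end

lemma (in abelian_group) minus_cancels:
  assumes "x \<in> carrier G" "y \<in> carrier G"
  shows "y \<oplus> (x \<ominus> y) = x" "(y \<oplus> x) \<ominus> y = x" "(x \<oplus> y) \<ominus> y = x"
proof -
  show "y \<oplus> (x \<ominus> y) = x"
    using assms a_minus_def l_neg a_assoc a_comm by (metis a_inv_closed minus_closed r_zero)
  show *: "(x \<oplus> y) \<ominus> y = x"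
    using assms by (simp add: a_minus_def a_assoc r_neg)
  then show "(y \<oplus> x) \<ominus> y = x"
    using assms by (simp add: a_comm)
qed

section \<open>Extremal members of totally ordered families of subspaces\<close>

context vectorspace
begin

text \<open>In a totally ordered family a member of smallest rank is the least one: a member not
  containing it would lie strictly inside it and have smaller rank.\<close>

lemma least_subspace:
  assumes fd: fin_dim and ne: "P T"
    and sub: "\<And>S. P S \<Longrightarrow> subspace K S V" and tot: "\<And>S T. P S \<Longrightarrow> P T \<Longrightarrow> S \<subseteq> T \<or> T \<subseteq> S"
  obtains S where "P S" "\<And>T. P T \<Longrightarrow> S \<subseteq> T"
proof -
  obtain S where S: "P S" "\<And>T. P T \<Longrightarrow> rank S \<le> rank T"
    using ex_has_least_nat[of P T rank] ne by blast
  have "S \<subseteq> T" if T: "P T" for T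
    using tot[OF S(1) T] rank_less[OF fd sub[OF T], of S] S(2)[OF T]
      subspace_props(1)[OF sub[OF S(1)]] by (auto simp: psubset_eq)
  with S show ?thesis
    using that by blast
qed

lemma greatest_subspace:
  assumes fd: fin_dim and ne: "P T"
    and sub: "\<And>S. P S \<Longrightarrow> subspace K S V" and tot: "\<And>S T. P S \<Longrightarrow> P T \<Longrightarrow> S \<subseteq> T \<or> T \<subseteq> S"
  obtains S where "P S" "\<And>T. P T \<Longrightarrow> T \<subseteq> S"
proof -
  have "rank S \<le> rank (carrier V)" if "P S" for S
    using rank_less[OF fd sub[OF that], of "carrier V"] subspace_props(1)[OF sub[OF that]]
    by (cases "S = carrier V") (auto simp: psubset_eq)
  then have "\<forall>S. P S \<longrightarrow> rank S < Suc (rank (carrier V))"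
    by (simp add: less_Suc_eq_le)
  then obtain S where S: "P S" "\<And>T. P T \<Longrightarrow> rank T \<le> rank S"
    using ex_has_greatest_nat[of P T rank] ne by blast
  have "T \<subseteq> S" if T: "P T" for T
    using tot[OF S(1) T] rank_less[OF fd sub[OF S(1)], of T] S(2)[OF T]
      subspace_props(1)[OF sub[OF T]] by (auto simp: psubset_eq)
  with S show ?thesis
    using that by blast
qed

end

section \<open>Representations with vanishing diagonal maps\<close>

locale crossing =
  fixes K :: "('k, 'm) ring_scheme" and V :: "int \<Rightarrow> int \<Rightarrow> ('k, 'v) module"
    and X Y :: "int \<Rightarrow> int \<Rightarrow> 'v \<Rightarrow> 'v"
  assumes vectorspace: "vectorspace K (V a b)"
    and fin_dim: "vectorspace.fin_dim K (V a b)"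
    and X_linear: "linear_map K (V a b) (V (a + 1) b) (X a b)"
    and Y_linear: "linear_map K (V a b) (V a (b + 1)) (Y a b)"
    and XY: "v \<in> carrier (V a b) \<Longrightarrow> X a (b + 1) (Y a b v) = \<zero>\<^bsub>V (a + 1) (b + 1)\<^esub>"
    and YX: "v \<in> carrier (V a b) \<Longrightarrow> Y (a + 1) b (X a b v) = \<zero>\<^bsub>V (a + 1) (b + 1)\<^esub>"
begin

text \<open>The hypotheses are symmetric in the two axes, so everything shown for walks to the
  north-west also holds, with swapped arguments, for walks to the south-east.\<close>

lemma transposed: "crossing K (\<lambda>a b. V b a) (\<lambda>a b. Y b a) (\<lambda>a b. X b a)"
  by (rule crossing.intro) (fact vectorspace fin_dim X_linear Y_linear XY YX)+

definition subrep :: "(int \<Rightarrow> int \<Rightarrow> 'v set) \<Rightarrow> bool" where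
  "subrep W \<longleftrightarrow> (\<forall>a b. subspace K (W a b) (V a b) \<and>
     X a b ` W a b \<subseteq> W (a + 1) b \<and> Y a b ` W a b \<subseteq> W a (b + 1))"

text \<open>A filtration by words, as known from string algebras: each member arises from zero or
  \<open>W\<close> by applying \<open>X\<close> and the inverse relation of \<open>Y\<close>. It is
  taken relative to \<open>W\<close>, since strings are split off one after another and later ones
  live in what is left.\<close>

inductive chain :: "(int \<Rightarrow> int \<Rightarrow> 'v set) \<Rightarrow> int \<Rightarrow> int \<Rightarrow> 'v set \<Rightarrow> bool"
  for W where
  bot: "chain W a b {\<zero>\<^bsub>V a b\<^esub>}"
| top: "chain W a b (W a b)"
| image: "chain W a b U \<Longrightarrow> chain W (a + 1) b (X a b ` U)"
| preimage: "chain W a (b + 1) U \<Longrightarrow> chain W a b {v \<in> W a b. Y a b v \<in> U}"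

definition gap :: "(int \<Rightarrow> int \<Rightarrow> 'v set) \<Rightarrow> int \<Rightarrow> int \<Rightarrow> 'v set \<Rightarrow> 'v set \<Rightarrow> bool" where
  "gap W a b U U' \<longleftrightarrow> chain W a b U \<and> chain W a b U' \<and> U \<subset> U' \<and>
     (\<forall>T. chain W a b T \<longrightarrow> T \<subseteq> U \<or> U' \<subseteq> T)"

definition in_gap ::
  "(int \<Rightarrow> int \<Rightarrow> 'v set) \<Rightarrow> int \<Rightarrow> int \<Rightarrow> 'v \<Rightarrow> 'v set \<Rightarrow> 'v set \<Rightarrow> 'v set \<Rightarrow> bool" where
  "in_gap W a b m C U U' \<longleftrightarrow> gap W a b U U' \<and> m \<in> U' \<and> U \<subseteq> C \<and> m \<notin> C \<and>
     vectorspace.line_split K (V a b) (W a b) m C"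

context
  fixes W
  assumes W: "subrep W"
begin

lemma W_subspace: "subspace K (W a b) (V a b)"
  using W by (simp add: subrep_def)

lemma W_carrier: "v \<in> W a b \<Longrightarrow> v \<in> carrier (V a b)"
  using vectorspace.subspace_props(1)[OF vectorspace W_subspace] by blast

lemma W_X: "v \<in> W a b \<Longrightarrow> X a b v \<in> W (a + 1) b"
  and W_Y: "v \<in> W a b \<Longrightarrow> Y a b v \<in> W a (b + 1)"
  using W unfolding subrep_def by blast+

lemma X_zero: "X a b \<zero>\<^bsub>V a b\<^esub> = \<zero>\<^bsub>V (a + 1) b\<^esub>"
  using mod_hom.f0_is_0 X_linear unfolding linear_map_def by blast

lemma chain_subspace: "chain W a b U \<Longrightarrow> subspace K U (V a b) \<and> U \<subseteq> W a b"
proof (induction rule: chain.induct)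
  case (bot a b)
  then show ?case
    using vectorspace.zero_subspace[OF vectorspace] vectorspace.subspace_props(2)[OF vectorspace W_subspace]
    by blast
next
  case (top a b)
  then show ?case
    using W_subspace by blast
next
  case (image a b U)
  then show ?case
    using vectorspace.linear_image_subspace[OF vectorspace X_linear] W_X by blast
next
  case (preimage a b U)
  then show ?case
    using vectorspace.linear_preimage_subspace[OF vectorspace Y_linear W_subspace] by blast
qed

lemma chain_zero: "chain W a b U \<Longrightarrow> \<zero>\<^bsub>V a b\<^esub> \<in> U"
  using chain_subspace vectorspace.subspace_props(2)[OF vectorspace] by blast

text \<open>Since \<open>Y\<close> after \<open>X\<close> vanishes, an image under \<open>X\<close>
  lies in the kernel of \<open>Y\<close>, and every preimage under \<open>Y\<close> contains that
  kernel.\<close>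

lemma image_le_preimage:
  assumes "chain W a b U" "chain W (a + 1) (b + 1) T"
  shows "X a b ` U \<subseteq> {v \<in> W (a + 1) b. Y (a + 1) b v \<in> T}"
proof -
  have "Y (a + 1) b (X a b v) \<in> T" "X a b v \<in> W (a + 1) b" if "v \<in> U" for v
    using that chain_subspace[OF assms(1)] YX[OF W_carrier, of v a b] W_X[of v a b]
      chain_zero[OF assms(2)] by (auto simp: subset_iff)
  then show ?thesis
    by blast
qed

text \<open>Two images, or two preimages, inherit the comparison from one step earlier by
  monotonicity. The mixed case needs no induction: the image is always the smaller one.\<close>

lemma chain_total: "chain W a b U \<Longrightarrow> chain W a b T \<Longrightarrow> U \<subseteq> T \<or> T \<subseteq> U"
proof (induction arbitrary: T rule: chain.induct)
  case (bot a b)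
  then show ?case
    using chain_zero by blast
next
  case (top a b)
  then show ?case
    using chain_subspace by blast
next
  case (image a b U)
  from image.prems show ?case
  proof cases
    case bot
    then show ?thesis using chain_zero[OF chain.image[OF image.hyps]] by blast
  next
    case top
    then show ?thesis using chain_subspace[OF chain.image[OF image.hyps]] by blast
  next
    case (image a' U')
    then show ?thesis using image.IH[of U'] by (auto simp: image_mono)
  next
    case (preimage U')
    then show ?thesis using image_le_preimage[OF image.hyps preimage(2)] by blast
  qed
next
  case (preimage a b U)
  from preimage.prems show ?case
  proof cases
    case bot
    then show ?thesis using chain_zero[OF chain.preimage[OF preimage.hyps]] by blast
  next
    case top
    then show ?thesis using chain_subspace[OF chain.preimage[OF preimage.hyps]] by blast
  next
    case (image a' U')
    then show ?thesis
      using image_le_preimage[of a' b U' U] preimage.hyps by auto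
  next
    case (preimage U')
    then show ?thesis using preimage.IH[of U'] by blast
  qed
qed

lemma least_chain:
  assumes "chain W a b T" "P T"
  obtains S where "chain W a b S" "P S" "\<And>T. chain W a b T \<Longrightarrow> P T \<Longrightarrow> S \<subseteq> T"
proof (rule vectorspace.least_subspace[OF vectorspace fin_dim, of "\<lambda>T. chain W a b T \<and> P T" T a b])
  fix S assume "chain W a b S \<and> P S" "\<And>T. chain W a b T \<and> P T \<Longrightarrow> S \<subseteq> T"
  then show thesis
    by (intro that) auto
qed (use assms in blast, use chain_subspace in blast, use chain_total in blast)

lemma greatest_chain:
  assumes "chain W a b T" "P T"
  obtains S where "chain W a b S" "P S" "\<And>T. chain W a b T \<Longrightarrow> P T \<Longrightarrow> T \<subseteq> S"
proof (rule vectorspace.greatest_subspace[OF vectorspace fin_dim, of "\<lambda>T. chain W a b T \<and> P T" T a b])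
  fix S assume "chain W a b S \<and> P S" "\<And>T. chain W a b T \<and> P T \<Longrightarrow> T \<subseteq> S"
  then show thesis
    by (intro that) auto
qed (use assms in blast, use chain_subspace in blast, use chain_total in blast)

text \<open>A cut of the chain into a lower class \<open>P\<close> and an upper class
  \<open>Q\<close>; its two edges are adjacent. By \<open>disj\<close> no member belongs to both
  classes, since it would lie between \<open>S'\<close> and \<open>S\<close>.\<close>

lemma gap_between:
  assumes S: "chain W a b S" "P S" "\<And>T. chain W a b T \<Longrightarrow> P T \<Longrightarrow> T \<subseteq> S"
    and S': "chain W a b S'" "Q S'" "\<And>T. chain W a b T \<Longrightarrow> Q T \<Longrightarrow> S' \<subseteq> T"
    and PQ: "\<And>T. chain W a b T \<Longrightarrow> P T \<or> Q T"
    and disj: "\<not> S' \<subseteq> S"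
  shows "gap W a b S S'"
  unfolding gap_def using assms chain_total[of a b S S'] by blast

text \<open>The image of a chain member at \<open>(a, b)\<close> is a chain member at
  \<open>(a + 1, b)\<close>, so it lies inside \<open>U\<close> or contains \<open>U'\<close>; this
  cuts the chain at \<open>(a, b)\<close>. The new hyperplane is the preimage of \<open>C\<close>,
  while \<open>m'\<close> may be any preimage of \<open>m\<close> in the upper edge of the
  cut.\<close>

lemma step_x:
  assumes s: "in_gap W (a + 1) b m C U U'" and le: "U' \<subseteq> X a b ` W a b"
  obtains m' S S' where "in_gap W a b m' {v \<in> W a b. X a b v \<in> C} S S'" "X a b m' = m"
proof -
  interpret f: linear_map K "V a b" "V (a + 1) b" "X a b"
    by (rule X_linear)
  have U: "chain W (a + 1) b U" "chain W (a + 1) b U'" "U \<subset> U'"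
    and UU: "\<And>T. chain W (a + 1) b T \<Longrightarrow> T \<subseteq> U \<or> U' \<subseteq> T"
    and m: "m \<in> U'" "U \<subseteq> C" "m \<notin> C" and sp: "f.W.line_split (W (a + 1) b) m C"
    using s unfolding in_gap_def gap_def by blast+
  have C: "subspace K C (V (a + 1) b)"
    using sp by (simp add: f.W.line_split_def)
  let ?P = "\<lambda>T. X a b ` T \<subseteq> U" and ?Q = "\<lambda>T. U' \<subseteq> X a b ` T"
  have "?P {\<zero>\<^bsub>V a b\<^esub>}"
    using chain_zero[OF U(1)] X_zero by auto
  then obtain S where S: "chain W a b S" "?P S" "\<And>T. chain W a b T \<Longrightarrow> ?P T \<Longrightarrow> T \<subseteq> S"
    by (rule greatest_chain[OF chain.bot, of ?P]) simp
  obtain S' where S': "chain W a b S'" "?Q S'" "\<And>T. chain W a b T \<Longrightarrow> ?Q T \<Longrightarrow> S' \<subseteq> T"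
    using le by (rule least_chain[OF chain.top, of ?Q]) simp
  have gap: "gap W a b S S'"
  proof (rule gap_between[where P = ?P and Q = ?Q, OF S S'])
    show "X a b ` T \<subseteq> U \<or> U' \<subseteq> X a b ` T" if "chain W a b T" for T
      by (rule UU[OF chain.image[OF that]])
    show "\<not> S' \<subseteq> S"
      using S(2) S'(2) U(3) by blast
  qed
  obtain m' where m': "m' \<in> S'" "X a b m' = m"
    using m(1) S'(2) by blast
  let ?C = "{v \<in> W a b. X a b v \<in> C}"
  have subC: "subspace K ?C (V a b)"
    by (rule vectorspace.linear_preimage_subspace[OF vectorspace X_linear W_subspace C])
  have m'W: "m' \<in> W a b" "m' \<in> carrier (V a b)"
    using m'(1) chain_subspace[OF S'(1)] W_carrier by blast+
  have "\<exists>c\<in>carrier K. \<exists>w\<in>?C. v = c \<odot>\<^bsub>V a b\<^esub> m' \<oplus>\<^bsub>V a b\<^esub> w" if v: "v \<in> W a b" for v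
  proof -
    obtain c w where cw: "c \<in> carrier K" "w \<in> C" "X a b v = c \<odot>\<^bsub>V (a + 1) b\<^esub> m \<oplus>\<^bsub>V (a + 1) b\<^esub> w"
      using sp W_X[OF v] unfolding f.W.line_split_def by blast
    have mc: "m \<in> carrier (V (a + 1) b)" "w \<in> carrier (V (a + 1) b)" "v \<in> carrier (V a b)"
      using m'W(2) m'(2) cw(2) f.W.subspace_props(1)[OF C] v W_carrier by auto
    let ?u = "v \<ominus>\<^bsub>V a b\<^esub> c \<odot>\<^bsub>V a b\<^esub> m'"
    have "X a b ?u = X a b v \<ominus>\<^bsub>V (a + 1) b\<^esub> c \<odot>\<^bsub>V (a + 1) b\<^esub> m"
      using mc m'W(2) cw(1) m'(2) by simp
    also have "\<dots> = w"
      unfolding cw(3) using cw(1) mc by (intro f.W.module.M.minus_cancels(2)) auto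
    finally have "?u \<in> ?C"
      using cw(1,2) v m'W f.V.subspace_props(4,6)[OF W_subspace] by auto
    moreover have "v = c \<odot>\<^bsub>V a b\<^esub> m' \<oplus>\<^bsub>V a b\<^esub> ?u"
      using mc m'W(2) cw(1) by (intro f.V.module.M.minus_cancels(1)[symmetric]) auto
    ultimately show ?thesis
      using cw(1) by blast
  qed
  then have "f.V.line_split (W a b) m' ?C"
    unfolding f.V.line_split_def using subC m'W(1) by blast
  moreover have "S \<subseteq> ?C" "m' \<notin> ?C"
    using S(2) chain_subspace[OF S(1)] m m'(2) by auto
  ultimately have "in_gap W a b m' ?C S S'"
    unfolding in_gap_def using gap m'(1) by blast
  then show ?thesis
    using that m'(2) by blast
qed

text \<open>Dual to \<open>step_x\<close>: preimages of chain members are chain members, so the gap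
  at \<open>(a, b)\<close> cuts the chain at \<open>(a, b + 1)\<close>. Now the vector is determined
  and the hyperplane has to be found; \<open>le\<close> makes the bottom of the chain fall into the
  lower class.\<close>

lemma step_y:
  assumes s: "in_gap W a b m C U U'" and le: "{v \<in> W a b. Y a b v = \<zero>\<^bsub>V a (b + 1)\<^esub>} \<subseteq> U"
  obtains C' S S' where "in_gap W a (b + 1) (Y a b m) C' S S'" "Y a b ` C \<subseteq> C'"
proof -
  interpret f: linear_map K "V a b" "V a (b + 1)" "Y a b"
    by (rule Y_linear)
  have U: "chain W a b U" "chain W a b U'" "U \<subset> U'"
    and UU: "\<And>T. chain W a b T \<Longrightarrow> T \<subseteq> U \<or> U' \<subseteq> T"
    and m: "m \<in> U'" "U \<subseteq> C" "m \<notin> C" and sp: "f.V.line_split (W a b) m C"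
    using s unfolding in_gap_def gap_def by blast+
  have C: "subspace K C (V a b)" "C \<subseteq> W a b"
    using sp by (simp_all add: f.V.line_split_def)
  have mW: "m \<in> W a b"
    using m(1) chain_subspace[OF U(2)] by blast
  let ?pre = "\<lambda>T. {v \<in> W a b. Y a b v \<in> T}"
  let ?P = "\<lambda>T. ?pre T \<subseteq> U" and ?Q = "\<lambda>T. U' \<subseteq> ?pre T"
  have "?P {\<zero>\<^bsub>V a (b + 1)\<^esub>}"
    using le by auto
  then obtain S where S: "chain W a (b + 1) S" "?P S" "\<And>T. chain W a (b + 1) T \<Longrightarrow> ?P T \<Longrightarrow> T \<subseteq> S"
    by (rule greatest_chain[OF chain.bot, of ?P]) simp
  have "?Q (W a (b + 1))"
    using chain_subspace[OF U(2)] W_Y by blast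
  then obtain S' where S': "chain W a (b + 1) S'" "?Q S'" "\<And>T. chain W a (b + 1) T \<Longrightarrow> ?Q T \<Longrightarrow> S' \<subseteq> T"
    by (rule least_chain[OF chain.top, of ?Q]) simp
  have gap: "gap W a (b + 1) S S'"
  proof (rule gap_between[where P = ?P and Q = ?Q, OF S S'])
    show "?pre T \<subseteq> U \<or> U' \<subseteq> ?pre T" if "chain W a (b + 1) T" for T
      by (rule UU[OF chain.preimage[OF that]])
    show "\<not> S' \<subseteq> S"
      using S(2) S'(2) U(3) by blast
  qed
  \<comment> \<open>The new hyperplane must contain \<open>S\<close> to respect the gap and the
    image of \<open>C\<close> to respect the arrow. Their sum misses the image of \<open>m\<close>:
    otherwise \<open>m\<close> would differ from an element of \<open>C\<close> by something in the
    preimage of \<open>S\<close>, hence in \<open>U\<close>, hence in \<open>C\<close>.\<close>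
  let ?D = "f.W.module.submodule_sum S (Y a b ` C)"
  have sub: "subspace K S (V a (b + 1))" "S \<subseteq> W a (b + 1)" "subspace K (Y a b ` C) (V a (b + 1))"
    using chain_subspace[OF S(1)] vectorspace.linear_image_subspace[OF vectorspace Y_linear C(1)] by blast+
  have D: "subspace K ?D (V a (b + 1))"
    using f.W.sum_is_subspace sub by blast
  have SD: "S \<subseteq> ?D" "Y a b ` C \<subseteq> ?D"
    using f.W.in_sum_vs sub f.W.vsum_comm by blast+
  have DW: "?D \<subseteq> W a (b + 1)"
    using f.W.vsum_is_minimal[OF sub(1,3) W_subspace] sub(2) W_Y C(2) by blast
  have "Y a b m \<notin> ?D"
  proof
    assume "Y a b m \<in> ?D"
    then obtain u c where uc: "u \<in> S" "c \<in> C" "Y a b m = u \<oplus>\<^bsub>V a (b + 1)\<^esub> Y a b c"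
      unfolding f.W.module.submodule_sum_def by auto
    have car: "m \<in> carrier (V a b)" "c \<in> carrier (V a b)" "u \<in> carrier (V a (b + 1))"
      using mW uc C sub(2) W_carrier by blast+
    have "Y a b (m \<ominus>\<^bsub>V a b\<^esub> c) = u"
      using car uc(3) f.W.module.M.minus_cancels(3) by simp
    moreover have "m \<ominus>\<^bsub>V a b\<^esub> c \<in> W a b"
      using mW uc(2) C(2) f.V.subspace_props(6)[OF W_subspace] by blast
    ultimately have "m \<ominus>\<^bsub>V a b\<^esub> c \<in> C"
      using uc(1) S(2) m(2) by blast
    then have "c \<oplus>\<^bsub>V a b\<^esub> (m \<ominus>\<^bsub>V a b\<^esub> c) \<in> C"
      using uc(2) f.V.subspace_props(3)[OF C(1)] by blast
    moreover have "c \<oplus>\<^bsub>V a b\<^esub> (m \<ominus>\<^bsub>V a b\<^esub> c) = m"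
      using car by (intro f.V.module.M.minus_cancels(1)) auto
    ultimately show False
      using m(3) by simp
  qed
  then obtain C' where C': "f.W.line_split (W a (b + 1)) (Y a b m) C'" "?D \<subseteq> C'" "Y a b m \<notin> C'"
    using f.W.hyperplane_exists[OF fin_dim W_subspace D DW W_Y[OF mW]] by blast
  then have "in_gap W a (b + 1) (Y a b m) C' S S'"
    unfolding in_gap_def using gap S'(2) m(1) SD by blast
  then show ?thesis
    using that C'(2) SD by blast
qed

end

end

section \<open>Staircases\<close>

text \<open>A path of unit steps to the right or down, described through the level
  \<open>a - b\<close>, which changes by one in each step of the walk. The first clause, used in
  both directions, leaves at most one point per level; the second leaves no level out.\<close>

definition staircase :: "(int \<times> int) set \<Rightarrow> bool" where
  "staircase I \<longleftrightarrow>
    (\<forall>a b a' b'. (a, b) \<in> I \<longrightarrow> (a', b') \<in> I \<longrightarrow> a - b \<le> a' - b' \<longrightarrow> a \<le> a' \<and> b' \<le> b) \<and>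
    (\<forall>a b a' b' s. (a, b) \<in> I \<longrightarrow> (a', b') \<in> I \<longrightarrow> a - b \<le> s \<longrightarrow> s \<le> a' - b' \<longrightarrow>
       (\<exists>c d. (c, d) \<in> I \<and> c - d = s))"

lemma staircase_mono:
  assumes "staircase I" "(a, b) \<in> I" "(a', b') \<in> I" "a - b \<le> a' - b'"
  shows "a \<le> a'" "b' \<le> b"
  using assms unfolding staircase_def by blast+

lemma staircase_level:
  assumes "staircase I" "(a, b) \<in> I" "(a', b') \<in> I" "a - b \<le> s" "s \<le> a' - b'"
  obtains c d where "(c, d) \<in> I" "c - d = s"
  using assms unfolding staircase_def by blast

lemma staircase_Suc:
  assumes I: "staircase I" "(a, b) \<in> I" "(a', b') \<in> I" and less: "a - b < a' - b'"
  shows "(a + 1, b) \<in> I \<or> (a, b - 1) \<in> I"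
proof -
  obtain c d where cd: "(c, d) \<in> I" "c - d = a - b + 1"
    using staircase_level[OF I, of "a - b + 1"] less by auto
  have "a \<le> c" "d \<le> b"
    using staircase_mono[OF I(1,2) cd(1)] cd(2) by auto
  then have "(c, d) = (a + 1, b) \<or> (c, d) = (a, b - 1)"
    using cd(2) by auto
  then show ?thesis
    using cd(1) by auto
qed

lemma staircase_transpose:
  assumes "staircase I"
  shows "staircase {(a, b). (b, a) \<in> I}"
  unfolding staircase_def mem_Collect_eq prod.case
proof (intro conjI allI impI)
  fix a b a' b' :: int
  assume *: "(b, a) \<in> I" "(b', a') \<in> I" "a - b \<le> a' - b'"
  show "a \<le> a'" "b' \<le> b"
    using staircase_mono[OF assms *(2,1)] *(3) by auto
next
  fix a b a' b' s :: int
  assume *: "(b, a) \<in> I" "(b', a') \<in> I" "a - b \<le> s" "s \<le> a' - b'"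
  obtain c d where "(c, d) \<in> I" "c - d = - s"
    using staircase_level[OF assms *(2,1), of "- s"] *(3,4) by auto
  then show "\<exists>c d. (d, c) \<in> I \<and> c - d = s"
    by (intro exI[of _ d] exI[of _ c]) auto
qed

text \<open>A step down would leave row \<open>b\<close>, and the second coordinate does not
  increase again on the way to \<open>(a + int n, b)\<close>.\<close>

lemma staircase_right:
  assumes I: "staircase I" "(a, b) \<in> I" "(a + int n, b) \<in> I" and k: "k \<le> n"
  shows "(a + int k, b) \<in> I"
  using k
proof (induction k)
  case (Suc k)
  then have in_I: "(a + int k, b) \<in> I"
    by simp
  then have "(a + int k + 1, b) \<in> I \<or> (a + int k, b - 1) \<in> I"
    using staircase_Suc[OF I(1) in_I I(3)] Suc.prems by simp
  moreover have "(a + int k, b - 1) \<notin> I"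
    using staircase_mono(2)[OF I(1) _ I(3), of "a + int k" "b - 1"] Suc.prems by auto
  ultimately show ?case
    by (simp add: algebra_simps)
qed (use I in simp)

lemma staircase_down:
  assumes I: "staircase I" "(a, b) \<in> I" "(a, b - int n) \<in> I" and k: "k \<le> n"
  shows "(a, b - int k) \<in> I"
  using k
proof (induction k)
  case (Suc k)
  then have in_I: "(a, b - int k) \<in> I"
    by simp
  then have "(a + 1, b - int k) \<in> I \<or> (a, b - int k - 1) \<in> I"
    using staircase_Suc[OF I(1) in_I I(3)] Suc.prems by simp
  moreover have "(a + 1, b - int k) \<notin> I"
    using staircase_mono(1)[OF I(1) _ I(3), of "a + 1" "b - int k"] Suc.prems by auto
  ultimately show ?case
    by (simp add: algebra_simps)
qed (use I in simp)

text \<open>Along a staircase the coordinates move in opposite directions, in the product order they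
  move in the same one.\<close>

lemma staircase_le_cases:
  assumes I: "staircase I" "(a, b) \<in> I" "(a', b') \<in> I" and le: "(a, b) \<le> (a', b')"
  shows "a = a' \<or> b = b'"
  using staircase_mono[OF I] staircase_mono[OF I(1,3,2)] le by fastforce

lemma staircase_path:
  assumes I: "staircase I" "(a, b) \<in> I" "(a', b') \<in> I" and n: "a' - b' = a - b + int n"
  shows "(\<lambda>u v. u \<in> I \<and> v \<in> I \<and> (u \<le> v \<or> v \<le> u))\<^sup>*\<^sup>* (a, b) (a', b')"
  using I(2) n
proof (induction n arbitrary: a b)
  case 0
  then have "a = a'" "b = b'"
    using staircase_mono[OF I(1) 0(1) I(3)] staircase_mono[OF I(1,3) 0(1)] by auto
  then show ?case
    by simp
next
  case (Suc n)
  from staircase_Suc[OF I(1) Suc.prems(1) I(3)] Suc.prems(2)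
  have "(a + 1, b) \<in> I \<or> (a, b - 1) \<in> I"
    by simp
  then show ?case
  proof
    assume "(a + 1, b) \<in> I"
    then show ?thesis
      using Suc.prems by (intro converse_rtranclp_into_rtranclp[OF _ Suc.IH]) auto
  next
    assume "(a, b - 1) \<in> I"
    then show ?thesis
      using Suc.prems by (intro converse_rtranclp_into_rtranclp[OF _ Suc.IH]) auto
  qed
qed

text \<open>Comparable points share a row or a column, and the stretch between them belongs to the
  staircase; this is convexity. Consecutive levels are joined by unit steps, which gives
  connectedness. Points that differ by \<open>(1, 1)\<close> would share a level.\<close>

lemma staircase_spread_curve:
  assumes I: "staircase I" and ne: "I \<noteq> {}"
  shows "spread_curve I"
  unfolding spread_curve_def
proof (intro conjI ballI)
  let ?r = "\<lambda>u v. u \<in> I \<and> v \<in> I \<and> (u \<le> v \<or> v \<le> u)"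
  have path: "?r\<^sup>*\<^sup>* (a, b) (a', b')" if "(a, b) \<in> I" "(a', b') \<in> I" "a - b \<le> a' - b'" for a b a' b'
    using staircase_path[OF I that(1,2), of "nat (a' - b' - (a - b))"] that(3) by simp
  have sym: "?r\<^sup>*\<^sup>* v u" if "?r\<^sup>*\<^sup>* u v" for u v
    using that by (induction rule: rtranclp_induct) (auto intro: converse_rtranclp_into_rtranclp)
  show "poset_connected I"
    unfolding poset_connected_def
  proof (intro ballI)
    fix p q assume "p \<in> I" "q \<in> I"
    then show "?r\<^sup>*\<^sup>* p q"
      using path[of "fst p" "snd p" "fst q" "snd q"] sym[OF path[of "fst q" "snd q" "fst p" "snd p"]]
      by (cases "fst p - snd p \<le> fst q - snd q") auto
  qed
  show "poset_convex I"
    unfolding poset_convex_def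
  proof (intro ballI allI impI)
    fix p q r assume pq: "p \<in> I" "q \<in> I" and r: "p \<le> r \<and> r \<le> q"
    obtain a b a' b' c d where eqs: "p = (a, b)" "q = (a', b')" "r = (c, d)"
      by (metis surj_pair)
    have le: "a \<le> c" "c \<le> a'" "b \<le> d" "d \<le> b'"
      using r unfolding eqs by auto
    then have "a = a' \<or> b = b'"
      using staircase_le_cases[OF I] pq unfolding eqs by (meson Pair_mono order_trans)
    then show "r \<in> I"
    proof
      assume "a = a'"
      then show ?thesis
        using staircase_down[OF I, of a b' "nat (b' - b)" "nat (b' - d)"] pq le unfolding eqs by auto
    next
      assume "b = b'"
      then show ?thesis
        using staircase_right[OF I, of a b "nat (a' - a)" "nat (c - a)"] pq le unfolding eqs by auto
    qed
  qed
  show "p + (1, 1) \<notin> I" if "p \<in> I" for p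
  proof
    assume "p + (1, 1) \<in> I"
    then have "fst p = fst p + 1"
      using staircase_mono(1)[OF I, of "fst p + 1" "snd p + 1" "fst p" "snd p"] that
      by (cases p) auto
    then show False by simp
  qed
qed (fact ne)

section \<open>Half strings\<close>

context crossing
begin

context
  fixes W
  assumes W: "subrep W"
begin

definition pointed :: "int \<Rightarrow> int \<Rightarrow> 'v \<Rightarrow> 'v set \<Rightarrow> bool" where
  "pointed a b m C \<longleftrightarrow> (\<exists>U U'. in_gap W a b m C U U')"

lemma pointed_props:
  assumes "pointed a b m C"
  shows "vectorspace.line_split K (V a b) (W a b) m C" "m \<notin> C"
    and "m \<in> W a b" "C \<subseteq> W a b" "\<zero>\<^bsub>V a b\<^esub> \<in> C"
proof -
  show *: "vectorspace.line_split K (V a b) (W a b) m C" "m \<notin> C"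
    using assms unfolding pointed_def in_gap_def by blast+
  then show "m \<in> W a b" "C \<subseteq> W a b" "\<zero>\<^bsub>V a b\<^esub> \<in> C"
    using vectorspace.subspace_props(2)[OF vectorspace]
    unfolding vectorspace.line_split_def[OF vectorspace] by blast+
qed

definition stops :: "int \<Rightarrow> int \<Rightarrow> 'v \<Rightarrow> 'v set \<Rightarrow> bool" where
  "stops a b m C \<longleftrightarrow> X (a - 1) b ` W (a - 1) b \<subseteq> C \<and> Y a b m = \<zero>\<^bsub>V a (b + 1)\<^esub>"

text \<open>Besides the arrow that is walked, each case settles arrows that the string leaves aside:
  along an outgoing one \<open>m\<close> must die, along an incoming one everything must land in the
  hyperplane. In \<open>stops\<close> both open arrows are of this kind.\<close>

definition steps ::
  "int \<Rightarrow> int \<Rightarrow> 'v \<Rightarrow> 'v set \<Rightarrow> int \<Rightarrow> int \<Rightarrow> 'v \<Rightarrow> 'v set \<Rightarrow> bool" where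
  "steps a b m C a' b' m' C' \<longleftrightarrow>
    a' = a - 1 \<and> b' = b \<and> X (a - 1) b m' = m \<and> X (a - 1) b ` C' \<subseteq> C \<and>
      Y (a - 1) (b - 1) ` W (a - 1) (b - 1) \<subseteq> C' \<and> Y a b m = \<zero>\<^bsub>V a (b + 1)\<^esub> \<or>
    a' = a \<and> b' = b + 1 \<and> Y a b m = m' \<and> Y a b ` C \<subseteq> C' \<and> X (a - 1) b ` W (a - 1) b \<subseteq> C"

lemma pointed_step:
  assumes "pointed a b m C"
  shows "stops a b m C \<or> (\<exists>a' b' m' C'. pointed a' b' m' C' \<and> steps a b m C a' b' m' C')"
proof -
  obtain U U' where s: "in_gap W a b m C U U'"
    using assms unfolding pointed_def by blast
  then have U: "chain W a b U" "chain W a b U'" "m \<in> U'" "U \<subseteq> C"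
    and UU: "\<And>T. chain W a b T \<Longrightarrow> T \<subseteq> U \<or> U' \<subseteq> T"
    unfolding in_gap_def gap_def by blast+
  \<comment> \<open>Both are chain members, so the gap lies entirely below or entirely above each of
    them.\<close>
  let ?I = "X (a - 1) b ` W (a - 1) b" and ?Z = "{v \<in> W a b. Y a b v \<in> {\<zero>\<^bsub>V a (b + 1)\<^esub>}}"
  have chain: "chain W a b ?I" "chain W a b ?Z"
    using chain.image[OF chain.top, of W "a - 1" b] chain.preimage[OF chain.bot, of W a b] by simp_all
  have IZ: "?I \<subseteq> ?Z"
    using image_le_preimage[OF W chain.top chain.bot, of "a - 1" b] by simp
  consider (x) "U' \<subseteq> ?I" | (y) "?I \<subseteq> U" "?Z \<subseteq> U" | (stop) "?I \<subseteq> U" "U' \<subseteq> ?Z"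
    using UU[OF chain(1)] UU[OF chain(2)] by blast
  then show ?thesis
  proof cases
    case x
    let ?C = "{v \<in> W (a - 1) b. X (a - 1) b v \<in> C}"
    obtain m' S S' where m': "in_gap W (a - 1) b m' ?C S S'" "X (a - 1) b m' = m"
      using step_x[OF W, of "a - 1" b m C U U'] s x by auto
    \<comment> \<open>This concerns the arrow entering the new point from below: \<open>X\<close>
      after \<open>Y\<close> is zero, so its image lies in the preimage of any subspace.\<close>
    have "X (a - 1) b (Y (a - 1) (b - 1) v) \<in> C" if "v \<in> W (a - 1) (b - 1)" for v
      using XY[OF W_carrier[OF W that]] pointed_props(5)[OF assms] by simp
    then have "Y (a - 1) (b - 1) ` W (a - 1) (b - 1) \<subseteq> ?C"
      using W_Y[OF W, of _ "a - 1" "b - 1"] by auto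
    moreover have "Y a b m = \<zero>\<^bsub>V a (b + 1)\<^esub>"
      using x IZ U(3) by blast
    ultimately have "steps a b m C (a - 1) b m' ?C"
      unfolding steps_def using m'(2) by blast
    then show ?thesis
      using m'(1) unfolding pointed_def by blast
  next
    case y
    then obtain C' S S' where "in_gap W a (b + 1) (Y a b m) C' S S'" "Y a b ` C \<subseteq> C'"
      using step_y[OF W s y(2)[unfolded singleton_iff]] by metis
    then have "pointed a (b + 1) (Y a b m) C' \<and> steps a b m C a (b + 1) (Y a b m) C'"
      unfolding pointed_def steps_def using y(1) U(4) by blast
    then show ?thesis
      by blast
  next
    case stop
    then show ?thesis
      using U(3,4) unfolding stops_def by blast
  qed
qed

text \<open>The part of a string on levels up to \<open>p - q\<close>. Exactly the horizontal arrow
  out of \<open>(p, q)\<close> and the vertical arrow into it are exempt, because they are the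
  business of the mirrored half. The values off \<open>I\<close> make a point without string
  contribute nothing and leave \<open>W\<close> unchanged.\<close>

definition half_string ::
  "int \<Rightarrow> int \<Rightarrow> 'v \<Rightarrow> 'v set \<Rightarrow> (int \<times> int) set \<Rightarrow> (int \<Rightarrow> int \<Rightarrow> 'v) \<Rightarrow> (int \<Rightarrow> int \<Rightarrow> 'v set) \<Rightarrow> bool" where
  "half_string p q m0 C0 I m C \<longleftrightarrow>
    (p, q) \<in> I \<and> m p q = m0 \<and> C p q = C0 \<and> staircase I \<and> (\<forall>a b. (a, b) \<in> I \<longrightarrow> a - b \<le> p - q) \<and>
    (\<forall>a b. (a, b) \<in> I \<longrightarrow> vectorspace.line_split K (V a b) (W a b) (m a b) (C a b) \<and> m a b \<notin> C a b) \<and>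
    (\<forall>a b. (a, b) \<notin> I \<longrightarrow> m a b = \<zero>\<^bsub>V a b\<^esub> \<and> C a b = W a b) \<and>
    (\<forall>a b. (a, b) \<noteq> (p, q) \<longrightarrow> ((a, b) \<in> I \<longrightarrow> X a b (m a b) = m (a + 1) b) \<and>
       X a b ` C a b \<subseteq> C (a + 1) b) \<and>
    (\<forall>a b. (a, b + 1) \<noteq> (p, q) \<longrightarrow> ((a, b) \<in> I \<longrightarrow> Y a b (m a b) = m a (b + 1)) \<and>
       Y a b ` C a b \<subseteq> C a (b + 1))"

lemma half_string_exists:
  assumes p: "pointed p q m0 C0"
  obtains I m C where "half_string p q m0 C0 I m C"
proof -
  \<comment> \<open>A walk may end or go on forever. With \<open>None\<close> as the state after a
    stop, both kinds are infinite sequences and dependent choice applies.\<close>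
  define good where "good s \<longleftrightarrow> (\<forall>a b m C. s = Some (a, b, m, C) \<longrightarrow> pointed a b m C)" for s
  define link where "link s s' \<longleftrightarrow> (case s of None \<Rightarrow> s' = None
    | Some (a, b, m, C) \<Rightarrow> (case s' of None \<Rightarrow> stops a b m C
        | Some (a', b', m', C') \<Rightarrow> steps a b m C a' b' m' C'))" for s s'
  have "\<exists>f. \<forall>n. (good (f n) \<and> (n = 0 \<longrightarrow> f n = Some (p, q, m0, C0))) \<and> link (f n) (f (Suc n))"
  proof (rule dependent_nat_choice)
    show "\<exists>s. good s \<and> ((0::nat) = 0 \<longrightarrow> s = Some (p, q, m0, C0))"
      using p by (intro exI[of _ "Some (p, q, m0, C0)"]) (simp add: good_def)
    show "\<exists>s'. (good s' \<and> (Suc n = 0 \<longrightarrow> s' = Some (p, q, m0, C0))) \<and> link s s'"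
      if s: "good s \<and> (n = 0 \<longrightarrow> s = Some (p, q, m0, C0))" for s n
    proof (cases s)
      case None
      then show ?thesis
        by (intro exI[of _ None]) (simp add: good_def link_def)
    next
      case (Some u)
      obtain a b m C where u: "u = (a, b, m, C)"
        by (cases u) auto
      then have "pointed a b m C"
        using s Some by (auto simp: good_def)
      from pointed_step[OF this] show ?thesis
      proof
        assume "stops a b m C"
        then show ?thesis
          using Some u by (intro exI[of _ None]) (simp add: good_def link_def)
      next
        assume "\<exists>a' b' m' C'. pointed a' b' m' C' \<and> steps a b m C a' b' m' C'"
        then obtain a' b' m' C' where "pointed a' b' m' C'" "steps a b m C a' b' m' C'"
          by blast
        then show ?thesis
          using Some u by (intro exI[of _ "Some (a', b', m', C')"]) (simp add: good_def link_def)
      qed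
    qed
  qed
  then obtain f where *: "\<And>n. (good (f n) \<and> (n = 0 \<longrightarrow> f n = Some (p, q, m0, C0))) \<and> link (f n) (f (Suc n))"
    by auto
  have good: "good (f n)" and link: "link (f n) (f (Suc n))" and f0: "f 0 = Some (p, q, m0, C0)" for n
    using *[of n] *[of 0] by simp_all
  define alive where "alive n \<longleftrightarrow> f n \<noteq> None" for n
  define A where "A n = fst (the (f n))" for n
  define B where "B n = fst (snd (the (f n)))" for n
  define M where "M n = fst (snd (snd (the (f n))))" for n
  define G where "G n = snd (snd (snd (the (f n))))" for n
  have f: "f n = Some (A n, B n, M n, G n)" if "alive n" for n
    using that unfolding alive_def A_def B_def M_def G_def by auto
  have start: "alive 0" "A 0 = p" "B 0 = q" "M 0 = m0" "G 0 = C0"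
    using f0 unfolding alive_def A_def B_def M_def G_def by auto
  have pt: "pointed (A n) (B n) (M n) (G n)" if "alive n" for n
    using good[of n] f[OF that] by (auto simp: good_def)
  have alive_Suc: "alive n" if "alive (Suc n)" for n
    using link[of n] that unfolding link_def alive_def by (cases "f n") auto
  have step: "steps (A n) (B n) (M n) (G n) (A (Suc n)) (B (Suc n)) (M (Suc n)) (G (Suc n))"
    if "alive (Suc n)" for n
    using link[of n] f[OF that] f[OF alive_Suc[OF that]] by (simp add: link_def)
  have stop: "stops (A n) (B n) (M n) (G n)" if "alive n" "\<not> alive (Suc n)" for n
    using link[of n] f[OF that(1)] that(2) unfolding link_def alive_def by (cases "f (Suc n)") auto
  have step_cases: "A (Suc n) = A n - 1 \<and> B (Suc n) = B n \<or> A (Suc n) = A n \<and> B (Suc n) = B n + 1"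
    if "alive (Suc n)" for n
    using step[OF that] by (auto simp: steps_def)
  have alive_le: "alive n" if "alive k" "n \<le> k" for n k
    using that(2,1) by (induction rule: inc_induct) (auto intro: alive_Suc)
  have level: "A n - B n = p - q - int n" if "alive n" for n
    using that
  proof (induction n)
    case (Suc n)
    then show ?case
      using alive_Suc step_cases[OF Suc.prems] by auto
  qed (simp add: start)
  have mono: "A k \<le> A n \<and> B n \<le> B k" if "n \<le> k" "alive k" for n k
    using that
  proof (induction rule: dec_induct)
    case (step k)
    then show ?case
      using alive_Suc[of k] step_cases[of k] by auto
  qed simp
  define I where "I = {(a, b). \<exists>n. alive n \<and> a = A n \<and> b = B n}"
  \<comment> \<open>Every step lowers \<open>a - b\<close> by one, so the time of a visit can be
    read off from the point.\<close>
  define ix where "ix a b = nat (p - q - (a - b))" for a b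
  define m where "m a b = (if (a, b) \<in> I then M (ix a b) else \<zero>\<^bsub>V a b\<^esub>)" for a b
  define C where "C a b = (if (a, b) \<in> I then G (ix a b) else W a b)" for a b
  have I: "(A n, B n) \<in> I" if "alive n" for n
    using that unfolding I_def by blast
  have IE: "\<exists>n. alive n \<and> a = A n \<and> b = B n" if "(a, b) \<in> I" for a b
    using that unfolding I_def by blast
  have ix: "ix (A n) (B n) = n" if "alive n" for n
    using level[OF that] unfolding ix_def by simp
  have mC: "m (A n) (B n) = M n" "C (A n) (B n) = G n" if "alive n" for n
    using I[OF that] ix[OF that] by (simp_all add: m_def C_def)
  have index: "alive n \<and> A n = a \<and> B n = b" if ab: "(a, b) \<in> I" "a - b = p - q - int n" for a b n
  proof -
    obtain k where k: "alive k" "a = A k" "b = B k"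
      using IE[OF ab(1)] by blast
    then have "k = n"
      using level[OF k(1)] ab(2) by simp
    then show ?thesis
      using k by simp
  qed
  have C_sub: "C a b \<subseteq> W a b" for a b
  proof (cases "(a, b) \<in> I")
    case True
    then obtain n where "alive n" "a = A n" "b = B n"
      using IE by blast
    then show ?thesis
      using mC(2) pointed_props(4)[OF pt] by simp
  qed (simp add: C_def)
  have stair: "staircase I"
    unfolding staircase_def
  proof (intro conjI allI impI)
    fix a b a' b' assume ab: "(a, b) \<in> I" "(a', b') \<in> I" "a - b \<le> a' - b'"
    obtain n k where nk: "alive n" "a = A n" "b = B n" "alive k" "a' = A k" "b' = B k"
      using IE[OF ab(1)] IE[OF ab(2)] by blast
    then have "k \<le> n"
      using level[OF nk(1)] level[OF nk(4)] ab(3) by simp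
    then show "a \<le> a'" "b' \<le> b"
      using mono nk by auto
  next
    fix a b a' b' s assume ab: "(a, b) \<in> I" "(a', b') \<in> I" "a - b \<le> s" "s \<le> a' - b'"
    obtain n k where nk: "alive n" "a = A n" "b = B n" "alive k" "a' = A k" "b' = B k"
      using IE[OF ab(1)] IE[OF ab(2)] by blast
    let ?l = "nat (p - q - s)"
    have "s \<le> p - q"
      using level[OF nk(4)] nk ab(4) by simp
    moreover have "?l \<le> n"
      using level[OF nk(1)] nk ab(3) by simp
    ultimately show "\<exists>c d. (c, d) \<in> I \<and> c - d = s"
      using alive_le[OF nk(1)] level[of ?l] I[of ?l] by (intro exI[of _ "A ?l"] exI[of _ "B ?l"]) auto
  qed
  have edge_X: "((a, b) \<in> I \<longrightarrow> X a b (m a b) = m (a + 1) b) \<and> X a b ` C a b \<subseteq> C (a + 1) b"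
    if ne: "(a, b) \<noteq> (p, q)" for a b
  proof (intro conjI impI)
    assume "(a, b) \<in> I"
    then obtain n where n: "alive n" "a = A n" "b = B n"
      using IE by blast
    then obtain k where k: "n = Suc k"
      using ne start by (cases n) auto
    have ak: "alive k"
      using alive_Suc n(1) k by simp
    show "X a b (m a b) = m (a + 1) b"
    proof (cases "A n = A k - 1")
      case True
      then show ?thesis
        using step[of k] n k mC(1)[OF n(1)] mC(1)[OF ak] by (auto simp: steps_def)
    next
      \<comment> \<open>The point was reached by a step up, so its vector is a
        \<open>Y\<close>-image and dies under \<open>X\<close>. Its right neighbour is off the
        string, because the only visited point on that level is the one below.\<close>
      case False
      then have ab: "A n = A k" "B n = B k + 1" "M n = Y (A k) (B k) (M k)"
        using step[of k] n(1) k by (auto simp: steps_def)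
      have "(a + 1, b) \<notin> I"
        using index[of "a + 1" b k] level[OF n(1)] n k ab(1) by auto
      then show ?thesis
        using n ab mC(1)[OF n(1)] XY[OF W_carrier[OF W pointed_props(3)[OF pt[OF ak]]]]
        by (simp add: m_def)
    qed
  next
    show "X a b ` C a b \<subseteq> C (a + 1) b"
    proof (cases "(a + 1, b) \<in> I")
      case False
      then show ?thesis
        using C_sub[of a b] W_X[OF W] by (auto simp: C_def)
    next
      case True
      then obtain n where n: "alive n" "a + 1 = A n" "b = B n"
        using IE by blast
      then have a: "a = A n - 1" "C (a + 1) b = G n"
        using mC(2)[OF n(1)] by auto
      show ?thesis
      proof (cases "alive (Suc n) \<and> A (Suc n) = A n - 1")
        case True
        then have "C (A n - 1) (B n) = G (Suc n)" "X (A n - 1) (B n) ` G (Suc n) \<subseteq> G n"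
          using step[of n] mC(2)[of "Suc n"] by (auto simp: steps_def)
        then show ?thesis
          unfolding a(2) unfolding a(1) n(3) by simp
      next
        \<comment> \<open>From the target the walk went up or stopped; in both cases the whole image
          of \<open>W\<close> under this arrow lies in the hyperplane.\<close>
        case False
        then have "X (A n - 1) (B n) ` W (A n - 1) (B n) \<subseteq> G n"
          using step[of n] stop[OF n(1)] by (auto simp: steps_def stops_def)
        then have "X a b ` W a b \<subseteq> G n"
          unfolding a(1) n(3) .
        then show ?thesis
          using C_sub[of a b] a by auto
      qed
    qed
  qed
  have edge_Y: "((a, b) \<in> I \<longrightarrow> Y a b (m a b) = m a (b + 1)) \<and> Y a b ` C a b \<subseteq> C a (b + 1)"
    if ne: "(a, b + 1) \<noteq> (p, q)" for a b
  proof (intro conjI impI)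
    assume "(a, b) \<in> I"
    then obtain n where n: "alive n" "a = A n" "b = B n"
      using IE by blast
    show "Y a b (m a b) = m a (b + 1)"
    proof (cases "alive (Suc n) \<and> A (Suc n) = A n")
      case True
      then show ?thesis
        using step[of n] n mC(1)[of "Suc n"] mC(1)[OF n(1)] by (auto simp: steps_def)
    next
      \<comment> \<open>The walk leaves to the left or stops here, so the vector dies
        upwards.\<close>
      case False
      then have "Y a b (m a b) = \<zero>\<^bsub>V a (b + 1)\<^esub>"
        using step[of n] stop[OF n(1)] n mC(1)[OF n(1)] by (auto simp: steps_def stops_def)
      moreover have "(a, b + 1) \<notin> I"
        using index[of a "b + 1" "Suc n"] level[OF n(1)] n False by auto
      ultimately show ?thesis
        by (simp add: m_def)
    qed
  next
    show "Y a b ` C a b \<subseteq> C a (b + 1)"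
    proof (cases "(a, b + 1) \<in> I")
      case False
      then show ?thesis
        using C_sub[of a b] W_Y[OF W] by (auto simp: C_def)
    next
      case True
      then obtain n where n: "alive n" "a = A n" "b + 1 = B n"
        using IE by blast
      then obtain k where k: "n = Suc k"
        using ne start by (cases n) auto
      have b: "b = B n - 1" "C a (b + 1) = G n"
        using mC(2)[OF n(1)] n by auto
      have ak: "alive k"
        using alive_Suc n(1) k by simp
      show ?thesis
      proof (cases "A n = A k")
        case True
        then have "B n - 1 = B k" "Y (A k) (B k) ` G k \<subseteq> G n"
          using step[of k] n(1) k by (auto simp: steps_def)
        then show ?thesis
          unfolding b(2) unfolding b(1) n(2) using True mC(2)[OF ak] by simp
      next
        \<comment> \<open>The target was reached by a step to the left, which recorded that this
          arrow maps all of \<open>W\<close> into the hyperplane.\<close>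
        case False
        then have "Y (A n) (B n - 1) ` W (A n) (B n - 1) \<subseteq> G n"
          using step[of k] n(1) k by (auto simp: steps_def)
        then have "Y a b ` W a b \<subseteq> G n"
          unfolding b(1) n(2) .
        then show ?thesis
          using C_sub[of a b] b by auto
      qed
    qed
  qed
  have "half_string p q m0 C0 I m C"
    unfolding half_string_def
  proof (intro conjI)
    show "(p, q) \<in> I" "m p q = m0" "C p q = C0"
      using I[of 0] mC[of 0] start by auto
    show "\<forall>a b. (a, b) \<in> I \<longrightarrow> a - b \<le> p - q"
      using level unfolding I_def by auto
    show "\<forall>a b. (a, b) \<in> I \<longrightarrow> vectorspace.line_split K (V a b) (W a b) (m a b) (C a b) \<and> m a b \<notin> C a b"
      using pointed_props(1,2)[OF pt] mC unfolding I_def by auto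
    show "\<forall>a b. (a, b) \<notin> I \<longrightarrow> m a b = \<zero>\<^bsub>V a b\<^esub> \<and> C a b = W a b"
      by (simp add: m_def C_def)
    show "staircase I"
      by (fact stair)
    show "\<forall>a b. (a, b) \<noteq> (p, q) \<longrightarrow> ((a, b) \<in> I \<longrightarrow> X a b (m a b) = m (a + 1) b) \<and>
        X a b ` C a b \<subseteq> C (a + 1) b"
      by (intro allI impI) (rule edge_X)
    show "\<forall>a b. (a, b + 1) \<noteq> (p, q) \<longrightarrow> ((a, b) \<in> I \<longrightarrow> Y a b (m a b) = m a (b + 1)) \<and>
        Y a b ` C a b \<subseteq> C a (b + 1)"
      by (intro allI impI) (rule edge_Y)
  qed
  then show ?thesis
    using that by blast
qed

end

end

section \<open>Splitting off strings\<close>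

context crossing
begin

lemma half_stringD:
  assumes W: "subrep W" and h: "half_string W p q m0 C0 I m C"
  shows "(p, q) \<in> I" "m p q = m0" "C p q = C0" "staircase I"
    and "(a, b) \<in> I \<Longrightarrow> a - b \<le> p - q"
    and "(a, b) \<in> I \<Longrightarrow> vectorspace.line_split K (V a b) (W a b) (m a b) (C a b)"
    and "(a, b) \<in> I \<Longrightarrow> m a b \<notin> C a b"
    and "(a, b) \<notin> I \<Longrightarrow> m a b = \<zero>\<^bsub>V a b\<^esub> \<and> C a b = W a b"
    and "(a, b) \<noteq> (p, q) \<Longrightarrow>
      ((a, b) \<in> I \<longrightarrow> X a b (m a b) = m (a + 1) b) \<and> X a b ` C a b \<subseteq> C (a + 1) b"
    and "(a, b + 1) \<noteq> (p, q) \<Longrightarrow>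
      ((a, b) \<in> I \<longrightarrow> Y a b (m a b) = m a (b + 1)) \<and> Y a b ` C a b \<subseteq> C a (b + 1)"
proof -
  note h' = h[unfolded half_string_def[OF W]]
  show "(p, q) \<in> I" "m p q = m0" "C p q = C0" "staircase I"
    using h' by simp_all
  show "(a, b) \<in> I \<Longrightarrow> a - b \<le> p - q"
    using h' by (elim conjE) simp
  show "(a, b) \<in> I \<Longrightarrow> vectorspace.line_split K (V a b) (W a b) (m a b) (C a b)"
    and "(a, b) \<in> I \<Longrightarrow> m a b \<notin> C a b"
    using h' by simp_all
  show "(a, b) \<notin> I \<Longrightarrow> m a b = \<zero>\<^bsub>V a b\<^esub> \<and> C a b = W a b"
    using h' by (elim conjE) simp
  show "(a, b) \<noteq> (p, q) \<Longrightarrow>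
      ((a, b) \<in> I \<longrightarrow> X a b (m a b) = m (a + 1) b) \<and> X a b ` C a b \<subseteq> C (a + 1) b"
    using conjunct1[OF conjunct2[OF conjunct2[OF conjunct2[OF conjunct2[OF conjunct2[OF conjunct2[OF conjunct2[OF h']]]]]]]]
    by blast
  show "(a, b + 1) \<noteq> (p, q) \<Longrightarrow>
      ((a, b) \<in> I \<longrightarrow> Y a b (m a b) = m a (b + 1)) \<and> Y a b ` C a b \<subseteq> C a (b + 1)"
    using conjunct2[OF conjunct2[OF conjunct2[OF conjunct2[OF conjunct2[OF conjunct2[OF conjunct2[OF conjunct2[OF h']]]]]]]]
    by blast
qed

text \<open>On \<open>I\<close> the vectors \<open>m\<close> behave like the generators of the
  spread representation of \<open>I\<close>; the equations also cover arrows leaving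
  \<open>I\<close>, where the target value is zero. Off \<open>I\<close> the splitting forces
  \<open>W' = W\<close>.\<close>

definition splits ::
  "(int \<Rightarrow> int \<Rightarrow> 'v set) \<Rightarrow> (int \<times> int) set \<Rightarrow> (int \<Rightarrow> int \<Rightarrow> 'v) \<Rightarrow> (int \<Rightarrow> int \<Rightarrow> 'v set) \<Rightarrow> bool" where
  "splits W I m W' \<longleftrightarrow> staircase I \<and> subrep W' \<and>
    (\<forall>a b. vectorspace.line_split K (V a b) (W a b) (m a b) (W' a b)) \<and>
    (\<forall>a b. (a, b) \<in> I \<longrightarrow> m a b \<notin> W' a b \<and> X a b (m a b) = m (a + 1) b \<and> Y a b (m a b) = m a (b + 1)) \<and>
    (\<forall>a b. (a, b) \<notin> I \<longrightarrow> m a b = \<zero>\<^bsub>V a b\<^esub>)"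

lemma splits_trivial:
  assumes "subrep W"
  shows "splits W {} (\<lambda>a b. \<zero>\<^bsub>V a b\<^esub>) W"
  unfolding splits_def staircase_def
  using vectorspace.line_split_trivial[OF vectorspace W_subspace[OF assms]] assms by blast

text \<open>One pair must sit in a gap of both chains at once. With the lowest gap of the first
  chain, the hyperplane has only to contain zero on that side and is free to be adapted to the
  mirrored chain.\<close>

lemma string_through:
  assumes W: "subrep W" and ne: "W p q \<noteq> {\<zero>\<^bsub>V p q\<^esub>}"
  obtains I m W' where "splits W I m W'" "(p, q) \<in> I"
proof -
  let ?T = "\<lambda>a b. W b a"
  interpret t: crossing K "\<lambda>a b. V b a" "\<lambda>a b. Y b a" "\<lambda>a b. X b a"
    by (rule transposed)
  interpret vs: vectorspace K "V p q"
    by (rule vectorspace)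
  have T: "t.subrep ?T"
    using W by (simp add: subrep_def t.subrep_def)
  obtain L where L: "chain W p q L" "L \<noteq> {\<zero>\<^bsub>V p q\<^esub>}"
    "\<And>T. chain W p q T \<Longrightarrow> T \<noteq> {\<zero>\<^bsub>V p q\<^esub>} \<Longrightarrow> L \<subseteq> T"
    using ne by (rule least_chain[OF W chain.top, of "\<lambda>T. T \<noteq> {\<zero>\<^bsub>V p q\<^esub>}"]) simp
  have gapL: "gap W p q {\<zero>\<^bsub>V p q\<^esub>} L"
    unfolding gap_def using L chain.bot[of W p q] chain_zero[OF W L(1)] by blast
  \<comment> \<open>Cut the mirrored chain where it first meets \<open>L\<close> nontrivially. A
    nonzero vector of \<open>L\<close> in the upper edge then avoids the lower edge, which meets
    \<open>L\<close> only in zero.\<close>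
  let ?P = "\<lambda>T. L \<inter> T \<subseteq> {\<zero>\<^bsub>V p q\<^esub>}"
  have "?P {\<zero>\<^bsub>V p q\<^esub>}"
    by blast
  then obtain S where S: "t.chain ?T q p S" "?P S" "\<And>T. t.chain ?T q p T \<Longrightarrow> ?P T \<Longrightarrow> T \<subseteq> S"
    by (rule t.greatest_chain[OF T t.chain.bot, of ?P]) simp
  have "\<not> ?P (W p q)"
    using L(2) chain_subspace[OF W L(1)] chain_zero[OF W L(1)] by blast
  then obtain S' where S': "t.chain ?T q p S'" "\<not> ?P S'"
      "\<And>T. t.chain ?T q p T \<Longrightarrow> \<not> ?P T \<Longrightarrow> S' \<subseteq> T"
    by (rule t.least_chain[OF T t.chain.top, of "\<lambda>T. \<not> ?P T"]) simp
  have gapR: "t.gap ?T q p S S'"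
    by (rule t.gap_between[OF T, where P = ?P and Q = "\<lambda>T. \<not> ?P T"]) (use S S' in blast)+
  obtain m0 where m0: "m0 \<in> L" "m0 \<in> S'" "m0 \<noteq> \<zero>\<^bsub>V p q\<^esub>" "m0 \<notin> S"
    using S'(2) S(2) by blast
  have sub: "subspace K S (V p q)" "S \<subseteq> W p q" "m0 \<in> W p q"
    using t.chain_subspace[OF T S(1)] t.chain_subspace[OF T S'(1)] m0(2) by blast+
  obtain C0 where C0: "vs.line_split (W p q) m0 C0" "S \<subseteq> C0" "m0 \<notin> C0"
    by (rule vs.hyperplane_exists[OF fin_dim W_subspace[OF W] sub m0(4)])
  have "\<zero>\<^bsub>V p q\<^esub> \<in> C0"
    using C0(1) vs.subspace_props(2) unfolding vs.line_split_def by blast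
  then have "pointed W p q m0 C0"
    unfolding pointed_def[OF W] in_gap_def using gapL C0 m0 by blast
  then obtain I1 m1 C1 where h1: "half_string W p q m0 C0 I1 m1 C1"
    using half_string_exists[OF W] by blast
  have "t.pointed ?T q p m0 C0"
    unfolding t.pointed_def[OF T] t.in_gap_def using gapR C0 m0 by blast
  then obtain I2 m2 C2 where h2: "t.half_string ?T q p m0 C0 I2 m2 C2"
    using t.half_string_exists[OF T] by blast
  note H1 = half_stringD[OF W h1] and H2 = t.half_stringD[OF T h2]
  define J where "J = {(a, b). (b, a) \<in> I2}"
  define l where "l = p - q"
  have p1: "(p, q) \<in> I1" "m1 p q = m0" "C1 p q = C0" "staircase I1"
    by (fact H1)+
  have le1: "a - b \<le> l" if "(a, b) \<in> I1" for a b
    using H1(5)[OF that] by (simp add: l_def)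
  note sp1 = H1(6,7) and out1 = H1(8) and X1 = H1(9) and Y1 = H1(10)
  have p2: "(p, q) \<in> J" "m2 q p = m0" "C2 q p = C0" "staircase J"
    using H2(1-3) staircase_transpose[OF H2(4)] by (simp_all add: J_def)
  have le2: "l \<le> a - b" if "(a, b) \<in> J" for a b
    using H2(5)[of b a] that by (simp add: l_def J_def)
  have sp2: "vectorspace.line_split K (V a b) (W a b) (m2 b a) (C2 b a)" "m2 b a \<notin> C2 b a"
    if "(a, b) \<in> J" for a b
    using H2(6,7)[of b a] that by (simp_all add: J_def)
  have out2: "m2 b a = \<zero>\<^bsub>V a b\<^esub> \<and> C2 b a = W a b" if "(a, b) \<notin> J" for a b
    using H2(8)[of b a] that by (simp add: J_def)
  have X2: "((a, b) \<in> J \<longrightarrow> X a b (m2 b a) = m2 b (a + 1)) \<and> X a b ` C2 b a \<subseteq> C2 b (a + 1)"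
    if "(a + 1, b) \<noteq> (p, q)" for a b
    using H2(10)[of b a] that by (auto simp: J_def)
  have Y2: "((a, b) \<in> J \<longrightarrow> Y a b (m2 b a) = m2 (b + 1) a) \<and> Y a b ` C2 b a \<subseteq> C2 (b + 1) a"
    if "(a, b) \<noteq> (p, q)" for a b
    using H2(9)[of b a] that by (auto simp: J_def)
  define I where "I = I1 \<union> J"
  define m where "m a b = (if a - b \<le> l then m1 a b else m2 b a)" for a b
  define C where "C a b = (if a - b \<le> l then C1 a b else C2 b a)" for a b
  have at1: "(a, b) = (p, q)" if "(a, b) \<in> I1" "a - b = l" for a b
    using staircase_mono[OF p1(4) that(1) p1(1)] staircase_mono[OF p1(4,1) that(1)] that(2) by (simp add: l_def)
  have at2: "(a, b) = (p, q)" if "(a, b) \<in> J" "a - b = l" for a b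
    using staircase_mono[OF p2(4) that(1) p2(1)] staircase_mono[OF p2(4,1) that(1)] that(2) by (simp add: l_def)
  \<comment> \<open>The halves are glued at level \<open>l\<close>. There both have
    \<open>(p, q)\<close> as their only point, with the same pair, and the default values elsewhere,
    so on this level either description may be used.\<close>
  have left: "((a, b) \<in> I \<longleftrightarrow> (a, b) \<in> I1) \<and> m a b = m1 a b \<and> C a b = C1 a b" if "a - b \<le> l" for a b
    using that le2[of a b] at2[of a b] p1(1) unfolding I_def m_def C_def by fastforce
  have right: "((a, b) \<in> I \<longleftrightarrow> (a, b) \<in> J) \<and> m a b = m2 b a \<and> C a b = C2 b a" if ab: "l \<le> a - b" for a b
  proof (cases "(a, b) = (p, q)")
    case True
    then show ?thesis
      using p1 p2 unfolding I_def m_def C_def l_def by simp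
  next
    case False
    then show ?thesis
    proof (cases "a - b = l")
      case True
      then have "(a, b) \<notin> I1" "(a, b) \<notin> J"
        using at1 at2 False by blast+
      then show ?thesis
        using out1 out2 unfolding I_def m_def C_def by simp
    next
      case neq: False
      then show ?thesis
        using le1[of a b] ab unfolding I_def m_def C_def by auto
    qed
  qed
  have stair: "staircase I"
    unfolding staircase_def
  proof (intro conjI allI impI)
    fix a b a' b' assume ab: "(a, b) \<in> I" "(a', b') \<in> I" "a - b \<le> a' - b'"
    consider "l \<le> a - b" | "a' - b' \<le> l" | "a - b \<le> l" "l \<le> a' - b'"
      by linarith
    then have "a \<le> a' \<and> b' \<le> b"
    proof cases
      case 1
      then show ?thesis
        using staircase_mono[OF p2(4) _ _ ab(3)] right ab by auto
    next
      case 2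
      then show ?thesis
        using staircase_mono[OF p1(4) _ _ ab(3)] left ab by auto
    next
      case 3
      then show ?thesis
        using staircase_mono[OF p1(4) _ p1(1), of a b] staircase_mono[OF p2(4,1), of a' b']
          left[of a b] right[of a' b'] ab by (auto simp: l_def)
    qed
    then show "a \<le> a'" "b' \<le> b"
      by auto
  next
    fix a b a' b' s assume ab: "(a, b) \<in> I" "(a', b') \<in> I" "a - b \<le> s" "s \<le> a' - b'"
    show "\<exists>c d. (c, d) \<in> I \<and> c - d = s"
    proof (cases "s \<le> l")
      case True
      then have "(a, b) \<in> I1"
        using left ab by auto
      then show ?thesis
        using staircase_level[OF p1(4) _ p1(1) ab(3)] True unfolding I_def l_def by (metis UnI1)
    next
      case False
      then have "(a', b') \<in> J"
        using right ab by auto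
      then show ?thesis
        using staircase_level[OF p2(4,1) _ _ ab(4)] False unfolding I_def l_def
        by (metis UnI2 linorder_le_cases)
    qed
  qed
  have split: "vectorspace.line_split K (V a b) (W a b) (m a b) (C a b)"
    and in_I: "(a, b) \<in> I \<Longrightarrow> m a b \<notin> C a b"
    and out: "(a, b) \<notin> I \<Longrightarrow> m a b = \<zero>\<^bsub>V a b\<^esub> \<and> C a b = W a b" for a b
  proof -
    show in_I: "m a b \<notin> C a b" if "(a, b) \<in> I"
      using left[of a b] right[of a b] sp1(2)[of a b] sp2(2)[of a b] that by (cases "a - b \<le> l") auto
    show out: "m a b = \<zero>\<^bsub>V a b\<^esub> \<and> C a b = W a b" if "(a, b) \<notin> I"
      using left[of a b] right[of a b] out1[of a b] out2[of a b] that by (cases "a - b \<le> l") auto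
    show "vectorspace.line_split K (V a b) (W a b) (m a b) (C a b)"
    proof (cases "(a, b) \<in> I")
      case True
      then show ?thesis
        using left[of a b] right[of a b] sp1(1)[of a b] sp2(1)[of a b] by (cases "a - b \<le> l") auto
    next
      case False
      then show ?thesis
        using out vectorspace.line_split_trivial[OF vectorspace W_subspace[OF W]] by simp
    qed
  qed
  \<comment> \<open>An \<open>X\<close> arrow raises the level by one and a \<open>Y\<close> arrow
    lowers it by one, so both ends lie on the same side of \<open>l\<close>. On that side the exempt
    arrows of the half string do not occur.\<close>
  have edge_X: "((a, b) \<in> I \<longrightarrow> X a b (m a b) = m (a + 1) b) \<and> X a b ` C a b \<subseteq> C (a + 1) b" for a b
  proof (cases "a - b < l")
    case True
    then show ?thesis
      using left[of a b] left[of "a + 1" b] X1[of a b] unfolding l_def by auto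
  next
    case False
    then show ?thesis
      using right[of a b] right[of "a + 1" b] X2[of a b] unfolding l_def by auto
  qed
  have edge_Y: "((a, b) \<in> I \<longrightarrow> Y a b (m a b) = m a (b + 1)) \<and> Y a b ` C a b \<subseteq> C a (b + 1)" for a b
  proof (cases "a - b \<le> l")
    case True
    then show ?thesis
      using left[of a b] left[of a "b + 1"] Y1[of a b] unfolding l_def by auto
  next
    case False
    then show ?thesis
      using right[of a b] right[of a "b + 1"] Y2[of a b] unfolding l_def by auto
  qed
  have "subrep C"
    unfolding subrep_def using split edge_X edge_Y
    unfolding vectorspace.line_split_def[OF vectorspace] by blast
  then have "splits W I m C"
    unfolding splits_def using stair split in_I out edge_X edge_Y by blast
  moreover have "(p, q) \<in> I"
    using p1(1) by (simp add: I_def)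
  ultimately show ?thesis
    using that by blast
qed

lemma carrier_subrep: "subrep (\<lambda>a b. carrier (V a b))"
proof -
  have "X a b v \<in> carrier (V (a + 1) b)" if "v \<in> carrier (V a b)" for a b v
    using that X_linear[of a b] unfolding linear_map_def by (auto intro: mod_hom.f_im)
  moreover have "Y a b v \<in> carrier (V a (b + 1))" if "v \<in> carrier (V a b)" for a b v
    using that Y_linear[of a b] unfolding linear_map_def by (auto intro: mod_hom.f_im)
  ultimately show ?thesis
    unfolding subrep_def using vectorspace.carrier_subspace[OF vectorspace] by blast
qed

lemma filtration_exists:
  obtains W I m where
    "W 0 = (\<lambda>a b. carrier (V a b))"
    "\<And>n. subrep (W n)"
    "\<And>n. splits (W n) (I n) (m n) (W (Suc n))"
    "\<And>a b. \<exists>n. W n a b = {\<zero>\<^bsub>V a b\<^esub>}"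
proof -
  \<comment> \<open>The second component of the decoded pair is a free counter, so each point recurs
    beyond any given stage.\<close>
  define e :: "nat \<Rightarrow> int \<times> int" where "e n = from_nat (fst (prod_decode n))" for n
  have e: "\<exists>n\<ge>k. e n = u" for k u
    by (intro exI[of _ "prod_encode (to_nat u, k)"]) (simp add: e_def le_prod_encode_2)
  define R where "R n W W' \<longleftrightarrow> (\<exists>I m. splits W I m W' \<and>
    (W (fst (e n)) (snd (e n)) \<noteq> {\<zero>\<^bsub>V (fst (e n)) (snd (e n))\<^esub>} \<longrightarrow> e n \<in> I))" for n W W'
  have "\<exists>f. \<forall>n. (subrep (f n) \<and> (n = 0 \<longrightarrow> f n = (\<lambda>a b. carrier (V a b)))) \<and> R n (f n) (f (Suc n))"
  proof (rule dependent_nat_choice)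
    show "\<exists>W. subrep W \<and> ((0::nat) = 0 \<longrightarrow> W = (\<lambda>a b. carrier (V a b)))"
      using carrier_subrep by auto
  next
    fix W and n :: nat assume "subrep W \<and> (n = 0 \<longrightarrow> W = (\<lambda>a b. carrier (V a b)))"
    then have W: "subrep W"
      by simp
    have "\<exists>W'. R n W W'"
    proof (cases "W (fst (e n)) (snd (e n)) = {\<zero>\<^bsub>V (fst (e n)) (snd (e n))\<^esub>}")
      case True
      then show ?thesis
        using splits_trivial[OF W] unfolding R_def by blast
    next
      case False
      from string_through[OF W this] show ?thesis
        unfolding R_def by (metis prod.collapse)
    qed
    then obtain W' where W': "R n W W'"
      by blast
    then have "subrep W'"
      unfolding R_def splits_def by blast
    with W' show "\<exists>W'. (subrep W' \<and> (Suc n = 0 \<longrightarrow> W' = (\<lambda>a b. carrier (V a b)))) \<and> R n W W'"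
      by auto
  qed
  then obtain W where *: "\<And>n. (subrep (W n) \<and> (n = 0 \<longrightarrow> W n = (\<lambda>a b. carrier (V a b)))) \<and> R n (W n) (W (Suc n))"
    by auto
  have sub: "subrep (W n)" and R: "R n (W n) (W (Suc n))" and W0: "W 0 = (\<lambda>a b. carrier (V a b))" for n
    using *[of n] *[of 0] by simp_all
  have "\<exists>u. splits (W n) (fst u) (snd u) (W (Suc n)) \<and>
    (W n (fst (e n)) (snd (e n)) \<noteq> {\<zero>\<^bsub>V (fst (e n)) (snd (e n))\<^esub>} \<longrightarrow> e n \<in> fst u)" for n
  proof -
    obtain I m where "splits (W n) I m (W (Suc n))"
      "W n (fst (e n)) (snd (e n)) \<noteq> {\<zero>\<^bsub>V (fst (e n)) (snd (e n))\<^esub>} \<longrightarrow> e n \<in> I"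
      using R[of n] unfolding R_def by blast
    then show ?thesis
      by (intro exI[of _ "(I, m)"]) simp
  qed
  then obtain u where Im: "\<And>n. splits (W n) (fst (u n)) (snd (u n)) (W (Suc n))"
    and hit: "\<And>n. W n (fst (e n)) (snd (e n)) \<noteq> {\<zero>\<^bsub>V (fst (e n)) (snd (e n))\<^esub>} \<longrightarrow> e n \<in> fst (u n)"
    by metis
  have "\<exists>n. W n a b = {\<zero>\<^bsub>V a b\<^esub>}" for a b
  proof -
    interpret vs: vectorspace K "V a b"
      by (rule vectorspace)
    have split: "vs.line_split (W n a b) (snd (u n) a b) (W (Suc n) a b)" for n
      using Im unfolding splits_def by blast
    have anti: "W k a b \<subseteq> W n a b" if "n \<le> k" for n k
      using that
    proof (induction rule: dec_induct)
      case (step k)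
      then show ?case
        using split[of k] unfolding vs.line_split_def by blast
    qed simp
    \<comment> \<open>At a later visit to \<open>(a, b)\<close> a remainder that is still nonzero
      loses a vector there, so its rank has dropped below \<open>r\<close>.\<close>
    have "\<exists>n. W n a b = {\<zero>\<^bsub>V a b\<^esub>}" if "vs.rank (W k a b) = r" for k r
      using that
    proof (induction r arbitrary: k rule: less_induct)
      case (less r)
      obtain n where n: "k \<le> n" "e n = (a, b)"
        using e by blast
      show ?case
      proof (rule ccontr)
        assume nz: "\<nexists>n. W n a b = {\<zero>\<^bsub>V a b\<^esub>}"
        then have "(a, b) \<in> fst (u n)"
          using hit[of n] n(2) by auto
        then have "snd (u n) a b \<notin> W (Suc n) a b" "snd (u n) a b \<in> W n a b" "W (Suc n) a b \<subseteq> W n a b"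
          using Im[of n] split[of n] unfolding splits_def vs.line_split_def by blast+
        then have "W (Suc n) a b \<subset> W k a b"
          using anti[OF n(1)] by blast
        then have "vs.rank (W (Suc n) a b) < r"
          using vs.rank_less[OF fin_dim W_subspace[OF sub]] vs.subspace_props(1)[OF W_subspace[OF sub]] less.prems by metis
        then show False
          using less.IH nz by blast
      qed
    qed
    then show ?thesis
      by blast
  qed
  then show ?thesis
    by (rule that[OF W0 sub Im])
qed

end

section \<open>Coordinates\<close>

context vectorspace
begin

text \<open>The partial sum of \<open>c k\<close> times \<open>m k\<close> over
  \<open>k < n\<close>. Stages whose string misses the point contribute zero vectors, so all points
  can share one sequence of indices.\<close>

primrec combo :: "(nat \<Rightarrow> 'a) \<Rightarrow> (nat \<Rightarrow> 'c) \<Rightarrow> nat \<Rightarrow> 'c" where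
  "combo c m 0 = \<zero>\<^bsub>V\<^esub>"
| "combo c m (Suc n) = combo c m n \<oplus>\<^bsub>V\<^esub> c n \<odot>\<^bsub>V\<^esub> m n"

lemma combo_closed:
  assumes "\<And>n. c n \<in> carrier K" "\<And>n. m n \<in> carrier V"
  shows "combo c m n \<in> carrier V"
  by (induction n) (use assms in auto)

lemma combo_cong:
  assumes "\<And>k. k < n \<Longrightarrow> c k \<odot>\<^bsub>V\<^esub> m k = c' k \<odot>\<^bsub>V\<^esub> m' k"
  shows "combo c m n = combo c' m' n"
  using assms by (induction n) auto

lemma combo_add:
  assumes "\<And>n. c n \<in> carrier K" "\<And>n. d n \<in> carrier K" "\<And>n. m n \<in> carrier V"
  shows "combo (\<lambda>n. c n \<oplus>\<^bsub>K\<^esub> d n) m n = combo c m n \<oplus>\<^bsub>V\<^esub> combo d m n"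
proof (induction n)
  case (Suc n)
  then show ?case
    using assms combo_closed[of c m n] combo_closed[of d m n]
    by (simp add: smult_l_distr M.add.m_ac)
qed simp

lemma combo_smult:
  assumes "\<And>n. c n \<in> carrier K" "r \<in> carrier K" "\<And>n. m n \<in> carrier V"
  shows "combo (\<lambda>n. r \<otimes>\<^bsub>K\<^esub> c n) m n = r \<odot>\<^bsub>V\<^esub> combo c m n"
proof (induction n)
  case (Suc n)
  then show ?case
    using assms combo_closed[of c m n] by (simp add: smult_r_distr smult_assoc1)
qed (simp add: assms)

section \<open>Coordinates along a flag that reaches zero\<close>

context
  fixes W :: "nat \<Rightarrow> 'c set" and m :: "nat \<Rightarrow> 'c" and S :: "nat set" and N :: nat
  assumes W0: "W 0 = carrier V" and split: "\<And>n. line_split (W n) (m n) (W (Suc n))"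
    and S: "\<And>n. n \<in> S \<Longrightarrow> m n \<notin> W (Suc n)" "\<And>n. n \<notin> S \<Longrightarrow> m n = \<zero>\<^bsub>V\<^esub>"
    and N: "W N = {\<zero>\<^bsub>V\<^esub>}"
begin

lemma W_sub: "subspace K (W n) V"
  using split carrier_subspace unfolding line_split_def by (cases n) (auto simp: W0)

lemma W_car: "v \<in> W n \<Longrightarrow> v \<in> carrier V"
  using subspace_props(1)[OF W_sub] by blast

lemma m_W: "m n \<in> W n"
  and W_Suc: "W (Suc n) \<subseteq> W n"
  using split unfolding line_split_def by blast+

lemma m_car: "m n \<in> carrier V"
  using m_W W_car by blast

lemma W_antimono: "n \<le> k \<Longrightarrow> W k \<subseteq> W n"
  by (induction rule: dec_induct) (use W_Suc in blast)+

lemma m_late: "N \<le> n \<Longrightarrow> m n = \<zero>\<^bsub>V\<^esub>"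
  using m_W[of n] W_antimono[of N n] N by blast

lemma S_less: "n \<in> S \<Longrightarrow> n < N"
  using S(1)[of n] m_late[of n] subspace_props(2)[OF W_sub, of "Suc n"] by (metis not_le)

lemma combo_late:
  assumes c: "\<And>n. c n \<in> carrier K" and n: "N \<le> n"
  shows "combo c m n = combo c m N"
  using n
proof (induction rule: dec_induct)
  case (step n)
  then show ?case
    using m_late[of n] c combo_closed[of c m N] m_car by simp
qed simp

lemma combo_surj:
  assumes v: "v \<in> carrier V"
  obtains c where "\<And>n. c n \<in> carrier K" "\<And>n. n \<notin> S \<Longrightarrow> c n = \<zero>\<^bsub>K\<^esub>" "combo c m N = v"
proof -
  have "\<exists>c. (\<forall>k. c k \<in> carrier K) \<and> (\<forall>k. k \<notin> S \<longrightarrow> c k = \<zero>\<^bsub>K\<^esub>) \<and>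
      (\<exists>w\<in>W n. v = combo c m n \<oplus>\<^bsub>V\<^esub> w)" for n
  proof (induction n)
    case 0
    show ?case
      using v W0 by (intro exI[of _ "\<lambda>_. \<zero>\<^bsub>K\<^esub>"]) simp
  next
    case (Suc n)
    then obtain c w where c: "\<And>k. c k \<in> carrier K" "\<And>k. k \<notin> S \<Longrightarrow> c k = \<zero>\<^bsub>K\<^esub>"
      and w: "w \<in> W n" "v = combo c m n \<oplus>\<^bsub>V\<^esub> w"
      by blast
    obtain a u where a: "a \<in> carrier K" and u: "u \<in> W (Suc n)" and eq: "w = a \<odot>\<^bsub>V\<^esub> m n \<oplus>\<^bsub>V\<^esub> u"
      using split[of n] w(1) unfolding line_split_def by blast
    \<comment> \<open>Outside \<open>S\<close> the vector \<open>m n\<close> is zero and its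
      coefficient arbitrary; resetting it to zero makes the coefficients an element of the direct
      sum.\<close>
    define b where "b = (if n \<in> S then a else \<zero>\<^bsub>K\<^esub>)"
    have b: "b \<in> carrier K" "w = b \<odot>\<^bsub>V\<^esub> m n \<oplus>\<^bsub>V\<^esub> u"
      using a eq S(2)[of n] W_car[OF u] by (auto simp: b_def)
    let ?c = "c(n := b)"
    have "combo ?c m (Suc n) = combo c m n \<oplus>\<^bsub>V\<^esub> b \<odot>\<^bsub>V\<^esub> m n"
      using combo_cong[of n ?c m c m] by simp
    moreover have "combo c m n \<in> carrier V"
      using combo_closed[OF c(1) m_car] .
    ultimately have "v = combo ?c m (Suc n) \<oplus>\<^bsub>V\<^esub> u"
      using w(2) b m_car W_car[OF u] by (simp add: M.add.m_assoc)
    moreover have "\<forall>k. ?c k \<in> carrier K" "\<forall>k. k \<notin> S \<longrightarrow> ?c k = \<zero>\<^bsub>K\<^esub>"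
      using c b by (auto simp: b_def)
    ultimately show ?case
      using u by blast
  qed
  from this[of N] obtain c where c: "\<And>k. c k \<in> carrier K" "\<And>k. k \<notin> S \<Longrightarrow> c k = \<zero>\<^bsub>K\<^esub>"
    "v = combo c m N \<oplus>\<^bsub>V\<^esub> \<zero>\<^bsub>V\<^esub>"
    unfolding N by blast
  then show ?thesis
    using that[of c] combo_closed[of c m N] m_car by simp
qed

text \<open>A triangular system: once the terms before \<open>n\<close> vanish, the
  \<open>n\<close>-th term is minus a tail in \<open>W (Suc n)\<close>, whereas \<open>m n\<close>
  lies outside that subspace if \<open>n \<in> S\<close>.\<close>

lemma combo_inj:
  assumes c: "\<And>n. c n \<in> carrier K" and z: "combo c m N = \<zero>\<^bsub>V\<^esub>" and k: "k \<in> S"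
  shows "c k = \<zero>\<^bsub>K\<^esub>"
proof -
  note cl = combo_closed[OF c m_car]
  have tail: "\<exists>w\<in>W k. combo c m n = combo c m k \<oplus>\<^bsub>V\<^esub> w" if "k \<le> n" for k n
    using that
  proof (induction rule: dec_induct)
    case base
    then show ?case
      using cl subspace_props(2)[OF W_sub] by (intro bexI[of _ "\<zero>\<^bsub>V\<^esub>"]) auto
  next
    case (step n)
    then obtain w where w: "w \<in> W k" "combo c m n = combo c m k \<oplus>\<^bsub>V\<^esub> w"
      by blast
    have "w \<oplus>\<^bsub>V\<^esub> c n \<odot>\<^bsub>V\<^esub> m n \<in> W k"
      using w(1) m_W[of n] W_antimono[OF step.hyps(1)] subspace_props(3,4)[OF W_sub] c by blast
    moreover have "combo c m (Suc n) = combo c m k \<oplus>\<^bsub>V\<^esub> (w \<oplus>\<^bsub>V\<^esub> c n \<odot>\<^bsub>V\<^esub> m n)"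
      using w W_car[OF w(1)] cl c m_car by (simp add: M.add.m_assoc)
    ultimately show ?case
      by blast
  qed
  have "c n \<odot>\<^bsub>V\<^esub> m n = \<zero>\<^bsub>V\<^esub> \<and> (n \<in> S \<longrightarrow> c n = \<zero>\<^bsub>K\<^esub>)" if "n < N" for n
    using that
  proof (induction n rule: less_induct)
    case (less n)
    have "combo c m n = combo (\<lambda>_. \<zero>\<^bsub>K\<^esub>) (\<lambda>_. \<zero>\<^bsub>V\<^esub>) n"
      using less.IH less.prems by (intro combo_cong) simp
    also have "\<dots> = \<zero>\<^bsub>V\<^esub>"
      by (induction n) auto
    finally have zero: "combo c m n = \<zero>\<^bsub>V\<^esub>" .
    obtain w where w: "w \<in> W (Suc n)" "\<zero>\<^bsub>V\<^esub> = combo c m (Suc n) \<oplus>\<^bsub>V\<^esub> w"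
      using tail[of "Suc n" N] less.prems z by auto
    have "w \<oplus>\<^bsub>V\<^esub> c n \<odot>\<^bsub>V\<^esub> m n = \<zero>\<^bsub>V\<^esub>"
      using w zero W_car[OF w(1)] c m_car by (simp add: M.add.m_comm)
    then have in_W: "c n \<odot>\<^bsub>V\<^esub> m n \<in> W (Suc n)"
      using subspace_add_cancel[OF W_sub w(1), of "c n \<odot>\<^bsub>V\<^esub> m n"] c m_car
        subspace_props(2)[OF W_sub] by simp
    have "c n = \<zero>\<^bsub>K\<^esub>" if "n \<in> S"
      using subspace_smult_cancel[OF W_sub c _ m_car in_W] S(1)[OF that] by blast
    then show ?case
      using S(2)[of n] c m_car by (cases "n \<in> S") auto
  qed
  then show ?thesis
    using k S_less by blast
qed

end

end

section \<open>Direct sums of spread curve representations\<close>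

lemma linear_mapI:
  assumes "vectorspace K V" "vectorspace K W"
    and "\<And>v. v \<in> carrier V \<Longrightarrow> f v \<in> carrier W"
    and "\<And>v w. v \<in> carrier V \<Longrightarrow> w \<in> carrier V \<Longrightarrow> f (v \<oplus>\<^bsub>V\<^esub> w) = f v \<oplus>\<^bsub>W\<^esub> f w"
    and "\<And>r v. r \<in> carrier K \<Longrightarrow> v \<in> carrier V \<Longrightarrow> f (r \<odot>\<^bsub>V\<^esub> v) = r \<odot>\<^bsub>W\<^esub> f v"
  shows "linear_map K V W f"
  using assms unfolding linear_map_def mod_hom_def mod_hom_axioms_def module_hom_def vectorspace_def
  by auto

lemma linear_mapD:
  assumes "linear_map K V W f"
  shows "vectorspace K V" "vectorspace K W"
    and "v \<in> carrier V \<Longrightarrow> f v \<in> carrier W"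
    and "v \<in> carrier V \<Longrightarrow> w \<in> carrier V \<Longrightarrow> f (v \<oplus>\<^bsub>V\<^esub> w) = f v \<oplus>\<^bsub>W\<^esub> f w"
    and "r \<in> carrier K \<Longrightarrow> v \<in> carrier V \<Longrightarrow> f (r \<odot>\<^bsub>V\<^esub> v) = r \<odot>\<^bsub>W\<^esub> f v"
    and "f \<zero>\<^bsub>V\<^esub> = \<zero>\<^bsub>W\<^esub>"
proof -
  interpret linear_map K V W f by fact
  show "vectorspace K V" "vectorspace K W" ..
qed (use assms mod_hom.f0_is_0[of K V W f] in
  \<open>auto simp: linear_map_def mod_hom_def mod_hom_axioms_def module_hom_def\<close>)

text \<open>Linear combination gives a map out of the direct sum, while a decomposition asks for a
  map into it. Closure under \<open>tr M\<close> is a separate assumption because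
  \<open>rep_iso\<close> does not include it.\<close>

lemma rep_iso_sym:
  assumes iso: "rep_iso K M N"
    and tr: "\<And>i j m. i \<le> j \<Longrightarrow> m \<in> carrier (ob M i) \<Longrightarrow> tr M i j m \<in> carrier (ob M j)"
  shows "rep_iso K N M"
proof -
  obtain f where lin: "\<And>i. linear_map K (ob M i) (ob N i) (f i)"
    and nat: "\<And>i j m. i \<le> j \<Longrightarrow> m \<in> carrier (ob M i) \<Longrightarrow> f j (tr M i j m) = tr N i j (f i m)"
    and bij: "\<And>i. bij_betw (f i) (carrier (ob M i)) (carrier (ob N i))"
    using iso unfolding rep_iso_def rep_morphism_def by blast
  define g where "g i = inv_into (carrier (ob M i)) (f i)" for i
  have g: "g i n \<in> carrier (ob M i)" "f i (g i n) = n" if "n \<in> carrier (ob N i)" for i n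
    using bij_betw_inv_into_right[OF bij that] bij_betw_inv_into[OF bij, of i] that
    unfolding g_def bij_betw_def by auto
  have gf: "g i (f i m) = m" if "m \<in> carrier (ob M i)" for i m
    using bij_betw_inv_into_left[OF bij that] by (simp add: g_def)
  have "linear_map K (ob N i) (ob M i) (g i)" for i
  proof (rule linear_mapI)
    note D = linear_mapD[OF lin]
    interpret M: vectorspace K "ob M i" by (rule D(1))
    show "vectorspace K (ob N i)" "vectorspace K (ob M i)" by (rule D)+
    show "g i v \<in> carrier (ob M i)" if "v \<in> carrier (ob N i)" for v
      using g that by blast
    show "g i (v \<oplus>\<^bsub>ob N i\<^esub> w) = g i v \<oplus>\<^bsub>ob M i\<^esub> g i w"
      if "v \<in> carrier (ob N i)" "w \<in> carrier (ob N i)" for v w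
      using D(4)[of "g i v" i "g i w"] g that gf[of "g i v \<oplus>\<^bsub>ob M i\<^esub> g i w" i] by simp
    show "g i (r \<odot>\<^bsub>ob N i\<^esub> v) = r \<odot>\<^bsub>ob M i\<^esub> g i v"
      if "r \<in> carrier K" "v \<in> carrier (ob N i)" for r v
      using D(5)[of r "g i v" i] g that gf[of "r \<odot>\<^bsub>ob M i\<^esub> g i v" i] by simp
  qed
  moreover have "g j (tr N i j n) = tr M i j (g i n)" if "i \<le> j" "n \<in> carrier (ob N i)" for i j n
    using nat[of i j "g i n"] gf[of "tr M i j (g i n)" j] tr g that by simp
  moreover have "bij_betw (g i) (carrier (ob N i)) (carrier (ob M i))" for i
    unfolding g_def by (rule bij_betw_inv_into[OF bij])
  ultimately show ?thesis
    unfolding rep_iso_def rep_morphism_def by blast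
qed

lemma sum_module_carrierI:
  assumes "\<And>a. a \<in> A \<Longrightarrow> f a \<in> carrier (V a)" "finite B"
    and "\<And>a. a \<in> A \<Longrightarrow> a \<notin> B \<Longrightarrow> f a = \<zero>\<^bsub>V a\<^esub>"
  shows "restrict f A \<in> carrier (sum_module A V)"
proof -
  have "{a \<in> A. restrict f A a \<noteq> \<zero>\<^bsub>V a\<^esub>} \<subseteq> B"
    using assms(3) by auto
  then have "finite {a \<in> A. restrict f A a \<noteq> \<zero>\<^bsub>V a\<^esub>}"
    using assms(2) by (rule finite_subset)
  then show ?thesis
    using assms(1) by (simp add: sum_module_def)
qed

lemma sum_module_vectorspace:
  assumes K: "field K" and V: "\<And>a. a \<in> A \<Longrightarrow> vectorspace K (V a)"
  shows "vectorspace K (sum_module A V)"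
proof (rule vs_criteria)
  interpret K: field K by fact
  have ab: "abelian_group (V a)" and md: "module K (V a)" if "a \<in> A" for a
    using V[OF that] unfolding vectorspace_def module_def by auto
  have minus_zero: "\<ominus>\<^bsub>V a\<^esub> \<zero>\<^bsub>V a\<^esub> = \<zero>\<^bsub>V a\<^esub>" if "a \<in> A" for a
    using abelian_group.minus_equality[OF ab[OF that], of "\<zero>\<^bsub>V a\<^esub>" "\<zero>\<^bsub>V a\<^esub>"]
      abelian_groupE(2)[OF ab[OF that]] abelian_monoid.r_zero[OF abelian_group.axioms(1)[OF ab[OF that]]]
    by simp
  note simps = abelian_groupE(1,2)[OF ab] abelian_group.a_inv_closed[OF ab] abelian_group.r_neg[OF ab]
    abelian_monoid.l_zero[OF abelian_group.axioms(1)[OF ab]]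
    abelian_monoid.r_zero[OF abelian_group.axioms(1)[OF ab]]
    module.smult_closed[OF md] module.rmult_0[OF md] minus_zero
  show "field K" by fact
  show "\<zero>\<^bsub>sum_module A V\<^esub> \<in> carrier (sum_module A V)"
    by (auto simp: sum_module_def simps)
  show "\<forall>v w. v \<in> carrier (sum_module A V) \<and> w \<in> carrier (sum_module A V) \<longrightarrow>
      v \<oplus>\<^bsub>sum_module A V\<^esub> w \<in> carrier (sum_module A V)"
  proof (intro allI impI)
    fix v w assume *: "v \<in> carrier (sum_module A V) \<and> w \<in> carrier (sum_module A V)"
    have "(\<lambda>a\<in>A. v a \<oplus>\<^bsub>V a\<^esub> w a) \<in> carrier (sum_module A V)"
      using * by (intro sum_module_carrierI[of _ _ _ "{a \<in> A. v a \<noteq> \<zero>\<^bsub>V a\<^esub>} \<union> {a \<in> A. w a \<noteq> \<zero>\<^bsub>V a\<^esub>}"])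
        (auto simp: sum_module_def PiE_iff simps)
    then show "v \<oplus>\<^bsub>sum_module A V\<^esub> w \<in> carrier (sum_module A V)"
      by (simp add: sum_module_def)
  qed
  show "\<forall>v\<in>carrier (sum_module A V). \<exists>w\<in>carrier (sum_module A V).
      v \<oplus>\<^bsub>sum_module A V\<^esub> w = \<zero>\<^bsub>sum_module A V\<^esub>"
  proof
    fix v assume v: "v \<in> carrier (sum_module A V)"
    let ?w = "\<lambda>a\<in>A. \<ominus>\<^bsub>V a\<^esub> v a"
    have "?w \<in> carrier (sum_module A V)"
      using v by (intro sum_module_carrierI[of _ _ _ "{a \<in> A. v a \<noteq> \<zero>\<^bsub>V a\<^esub>}"])
        (auto simp: sum_module_def PiE_iff simps)
    moreover have "v \<oplus>\<^bsub>sum_module A V\<^esub> ?w = \<zero>\<^bsub>sum_module A V\<^esub>"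
      using v by (auto simp: sum_module_def simps PiE_iff restrict_def)
    ultimately show "\<exists>w\<in>carrier (sum_module A V). v \<oplus>\<^bsub>sum_module A V\<^esub> w = \<zero>\<^bsub>sum_module A V\<^esub>"
      by blast
  qed
  show "\<forall>c v. c \<in> carrier K \<and> v \<in> carrier (sum_module A V) \<longrightarrow>
      c \<odot>\<^bsub>sum_module A V\<^esub> v \<in> carrier (sum_module A V)"
  proof (intro allI impI)
    fix c v assume *: "c \<in> carrier K \<and> v \<in> carrier (sum_module A V)"
    have "(\<lambda>a\<in>A. c \<odot>\<^bsub>V a\<^esub> v a) \<in> carrier (sum_module A V)"
      using * by (intro sum_module_carrierI[of _ _ _ "{a \<in> A. v a \<noteq> \<zero>\<^bsub>V a\<^esub>}"])
        (auto simp: sum_module_def PiE_iff simps)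
    then show "c \<odot>\<^bsub>sum_module A V\<^esub> v \<in> carrier (sum_module A V)"
      by (simp add: sum_module_def)
  qed
  show "\<forall>v w. v \<in> carrier (sum_module A V) \<and> w \<in> carrier (sum_module A V) \<longrightarrow>
      v \<oplus>\<^bsub>sum_module A V\<^esub> w = w \<oplus>\<^bsub>sum_module A V\<^esub> v"
    by (auto simp: sum_module_def PiE_iff restrict_def abelian_groupE(4)[OF ab])
  show "\<forall>u v w. u \<in> carrier (sum_module A V) \<and> v \<in> carrier (sum_module A V) \<and> w \<in> carrier (sum_module A V) \<longrightarrow>
      (u \<oplus>\<^bsub>sum_module A V\<^esub> v) \<oplus>\<^bsub>sum_module A V\<^esub> w = u \<oplus>\<^bsub>sum_module A V\<^esub> (v \<oplus>\<^bsub>sum_module A V\<^esub> w)"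
    by (auto simp: sum_module_def PiE_iff restrict_def abelian_groupE(3)[OF ab])
  show "\<forall>v\<in>carrier (sum_module A V). v \<oplus>\<^bsub>sum_module A V\<^esub> \<zero>\<^bsub>sum_module A V\<^esub> = v"
    by (auto simp: sum_module_def PiE_iff simps extensional_def)
  show "\<forall>c d v. c \<in> carrier K \<and> d \<in> carrier K \<and> v \<in> carrier (sum_module A V) \<longrightarrow>
      (c \<otimes>\<^bsub>K\<^esub> d) \<odot>\<^bsub>sum_module A V\<^esub> v = c \<odot>\<^bsub>sum_module A V\<^esub> (d \<odot>\<^bsub>sum_module A V\<^esub> v)"
    by (auto simp: sum_module_def PiE_iff restrict_def module.smult_assoc1[OF md])
  show "\<forall>v\<in>carrier (sum_module A V). \<one>\<^bsub>K\<^esub> \<odot>\<^bsub>sum_module A V\<^esub> v = v"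
    by (auto simp: sum_module_def PiE_iff extensional_def module.smult_one[OF md])
  show "\<forall>c d v. c \<in> carrier K \<and> d \<in> carrier K \<and> v \<in> carrier (sum_module A V) \<longrightarrow>
      (c \<oplus>\<^bsub>K\<^esub> d) \<odot>\<^bsub>sum_module A V\<^esub> v =
      (c \<odot>\<^bsub>sum_module A V\<^esub> v) \<oplus>\<^bsub>sum_module A V\<^esub> (d \<odot>\<^bsub>sum_module A V\<^esub> v)"
    by (auto simp: sum_module_def PiE_iff restrict_def module.smult_l_distr[OF md])
  show "\<forall>c v w. c \<in> carrier K \<and> v \<in> carrier (sum_module A V) \<and> w \<in> carrier (sum_module A V) \<longrightarrow>
      c \<odot>\<^bsub>sum_module A V\<^esub> (v \<oplus>\<^bsub>sum_module A V\<^esub> w) =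
      (c \<odot>\<^bsub>sum_module A V\<^esub> v) \<oplus>\<^bsub>sum_module A V\<^esub> (c \<odot>\<^bsub>sum_module A V\<^esub> w)"
    by (auto simp: sum_module_def PiE_iff restrict_def module.smult_r_distr[OF md])
qed

lemma spread_rep_vectorspace:
  assumes "field K"
  shows "vectorspace K (ob (spread_rep K I) i)"
proof -
  interpret field K by fact
  show ?thesis
    using add.r_inv_ex
    by (intro vs_criteria) (auto simp: spread_rep_def self_module_def m_assoc l_distr r_distr a_ac assms)
qed

context
  fixes K :: "('k, 'm) ring_scheme" and A :: "'i set" and I :: "'i \<Rightarrow> (int \<times> int) set"
  assumes K: "field K"
begin

interpretation K: field K by (rule K)

abbreviation "spread_sum \<equiv> rep_sum A (\<lambda>a. spread_rep K (I a))"

lemma spread_sum_vectorspace: "vectorspace K (ob spread_sum i)"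
  unfolding rep_sum_def using sum_module_vectorspace[OF K spread_rep_vectorspace[OF K]] by simp

lemma spread_sum_carrier:
  "v \<in> carrier (ob spread_sum i) \<longleftrightarrow> v \<in> extensional A \<and> (\<forall>a\<in>A. v a \<in> carrier K) \<and>
     (\<forall>a\<in>A. i \<notin> I a \<longrightarrow> v a = \<zero>\<^bsub>K\<^esub>) \<and> finite {a \<in> A. v a \<noteq> \<zero>\<^bsub>K\<^esub>}"
  by (auto simp: rep_sum_def sum_module_def spread_rep_def self_module_def PiE_iff split: if_splits)

lemma spread_sum_simps:
  "\<zero>\<^bsub>ob spread_sum i\<^esub> = (\<lambda>a\<in>A. \<zero>\<^bsub>K\<^esub>)"
  "v \<oplus>\<^bsub>ob spread_sum i\<^esub> w = (\<lambda>a\<in>A. v a \<oplus>\<^bsub>K\<^esub> w a)"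
  "r \<odot>\<^bsub>ob spread_sum i\<^esub> v = (\<lambda>a\<in>A. r \<otimes>\<^bsub>K\<^esub> v a)"
  "tr spread_sum i j v = (\<lambda>a\<in>A. if i \<in> I a \<and> j \<in> I a then v a else \<zero>\<^bsub>K\<^esub>)"
  by (auto simp: rep_sum_def sum_module_def spread_rep_def self_module_def)

lemma spread_sum_tr_closed:
  assumes "v \<in> carrier (ob spread_sum i)"
  shows "tr spread_sum i j v \<in> carrier (ob spread_sum j)"
proof -
  have "{a \<in> A. tr spread_sum i j v a \<noteq> \<zero>\<^bsub>K\<^esub>} \<subseteq> {a \<in> A. v a \<noteq> \<zero>\<^bsub>K\<^esub>}"
    by (auto simp: spread_sum_simps)
  then have "finite {a \<in> A. tr spread_sum i j v a \<noteq> \<zero>\<^bsub>K\<^esub>}"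
    using assms unfolding spread_sum_carrier by (auto intro: finite_subset)
  moreover have "tr spread_sum i j v \<in> extensional A"
    "\<forall>a\<in>A. tr spread_sum i j v a \<in> carrier K" "\<forall>a\<in>A. j \<notin> I a \<longrightarrow> tr spread_sum i j v a = \<zero>\<^bsub>K\<^esub>"
    using assms unfolding spread_sum_carrier by (auto simp: spread_sum_simps)
  ultimately show ?thesis
    unfolding spread_sum_carrier by blast
qed

end

section \<open>Existence of decompositions\<close>

context ZZ_rep
begin

lemma tr_closed: "i \<le> j \<Longrightarrow> m \<in> carrier (ob M i) \<Longrightarrow> tr M i j m \<in> carrier (ob M j)"
  using linear_mapD(3)[OF linear] .

lemma tr_zero: "i \<le> j \<Longrightarrow> tr M i j \<zero>\<^bsub>ob M i\<^esub> = \<zero>\<^bsub>ob M j\<^esub>"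
  using linear_mapD(6)[OF linear] .

text \<open>The hypotheses speak only of unit arrows starting in \<open>I\<close>. By convexity a
  monotone path that starts in \<open>I\<close> and leaves it never returns, and from then on both
  sides are zero.\<close>

lemma tr_family:
  assumes m: "\<And>i. m i \<in> carrier (ob M i)" and out: "\<And>i. i \<notin> I \<Longrightarrow> m i = \<zero>\<^bsub>ob M i\<^esub>"
    and X: "\<And>i. i \<in> I \<Longrightarrow> tr M i (i + (1, 0)) (m i) = m (i + (1, 0))"
    and Y: "\<And>i. i \<in> I \<Longrightarrow> tr M i (i + (0, 1)) (m i) = m (i + (0, 1))"
    and I: "poset_convex I" "i \<in> I" and le: "i \<le> j"
  shows "tr M i j (m i) = m j"
proof -
  have step: "tr M i (j + d) (m i) = m (j + d)"
    if d: "d = (1, 0) \<or> d = (0, 1)" and j: "i \<le> j" "tr M i j (m i) = m j" for j d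
  proof -
    have jd: "j \<le> j + d"
      using d by (cases j) auto
    have "tr M i (j + d) (m i) = tr M j (j + d) (m j)"
      using tr_comp[OF j(1) jd m] j(2) by simp
    also have "\<dots> = m (j + d)"
    proof (cases "j \<in> I")
      case True
      then show ?thesis
        using X Y d by blast
    next
      case False
      then have "j + d \<notin> I"
        using I j(1) jd unfolding poset_convex_def by blast
      then show ?thesis
        using False out tr_zero[OF jd] by simp
    qed
    finally show ?thesis .
  qed
  obtain a b where i: "i = (a, b)"
    by (cases i)
  have "tr M i (i + (int u, int v)) (m i) = m (i + (int u, int v))" for u v
  proof (induction v)
    case 0
    show ?case
    proof (induction u)
      case 0
      then show ?case
        using tr_id[OF m] by (simp add: i)
    next
      case (Suc u)
      then show ?case
        using step[of "(1, 0)" "i + (int u, int 0)"] by (simp add: i algebra_simps)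
    qed
  next
    case (Suc v)
    then show ?case
      using step[of "(0, 1)" "i + (int u, int v)"] by (simp add: i algebra_simps)
  qed
  from this[of "nat (fst j - a)" "nat (snd j - b)"] le show ?thesis
    by (cases j) (simp add: i)
qed

lemma decomposition_exists:
  assumes diag: "\<And>i m. m \<in> carrier (ob M i) \<Longrightarrow> tr M i (i + (1, 1)) m = \<zero>\<^bsub>ob M (i + (1, 1))\<^esub>"
  shows "\<exists>(A :: nat set) I. spread_curve_decomposition K M A I"
proof -
  note vs = vectorspace
  interpret crossing K "\<lambda>a b. ob M (a, b)" "\<lambda>a b. tr M (a, b) (a + 1, b)" "\<lambda>a b. tr M (a, b) (a, b + 1)"
  proof (rule crossing.intro)
    fix a b v
    show "vectorspace K (ob M (a, b))"
      by (rule vectorspace)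
    show "vectorspace.fin_dim K (ob M (a, b))"
      by (rule fin_dim)
    show "linear_map K (ob M (a, b)) (ob M (a + 1, b)) (tr M (a, b) (a + 1, b))"
      by (simp add: linear)
    show "linear_map K (ob M (a, b)) (ob M (a, b + 1)) (tr M (a, b) (a, b + 1))"
      by (simp add: linear)
    assume v: "v \<in> carrier (ob M (a, b))"
    show "tr M (a, b + 1) (a + 1, b + 1) (tr M (a, b) (a, b + 1) v) = \<zero>\<^bsub>ob M (a + 1, b + 1)\<^esub>"
      using tr_comp[OF _ _ v] diag[OF v] by simp
    show "tr M (a + 1, b) (a + 1, b + 1) (tr M (a, b) (a + 1, b) v) = \<zero>\<^bsub>ob M (a + 1, b + 1)\<^esub>"
      using tr_comp[OF _ _ v] diag[OF v] by simp
  qed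
  have K: "field K"
    using vs vectorspace_def by blast
  interpret K: field K
    by (rule K)
  obtain W I m where W0: "W 0 = (\<lambda>a b. carrier (ob M (a, b)))" and sub: "\<And>n. subrep (W n)"
    and splits: "\<And>n. splits (W n) (I n) (m n) (W (Suc n))"
    and vanish: "\<And>a b. \<exists>n. W n a b = {\<zero>\<^bsub>ob M (a, b)\<^esub>}"
    by (rule filtration_exists) (rule that)
  \<comment> \<open>A stage that splits off nothing has empty \<open>I n\<close>, which is not a
    spread curve, and so is not an index.\<close>
  define A where "A = {n. I n \<noteq> {}}"
  define S where "S i = {n. i \<in> I n}" for i
  define v where "v i n = m n (fst i) (snd i)" for i n
  define F where "F i n = W n (fst i) (snd i)" for i n
  have "\<exists>n. F i n = {\<zero>\<^bsub>ob M i\<^esub>}" for i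
    using vanish[of "fst i" "snd i"] by (simp add: F_def)
  then obtain N where N: "\<And>i. F i (N i) = {\<zero>\<^bsub>ob M i\<^esub>}"
    by metis
  have spread: "spread_curve (I n)" if "n \<in> A" for n
    using splits[of n] that staircase_spread_curve unfolding splits_def A_def by blast
  have F0: "F i 0 = carrier (ob M i)" for i
    by (simp add: F_def W0)
  have split: "vectorspace.line_split K (ob M i) (F i n) (v i n) (F i (Suc n))" for i n
    using splits[of n] unfolding splits_def F_def v_def by (cases i) auto
  have in_S: "v i n \<notin> F i (Suc n)" if "n \<in> S i" for i n
    using splits[of n] that unfolding splits_def F_def v_def S_def by (cases i) auto
  have out_S: "v i n = \<zero>\<^bsub>ob M i\<^esub>" if "n \<notin> S i" for i n
    using splits[of n] that unfolding splits_def v_def S_def by (cases i) auto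
  note flag = F0 split in_S out_S N
  have v_car: "v i n \<in> carrier (ob M i)" for i n
    by (rule vectorspace.m_car[where V = "ob M i" and W = "F i" and m = "v i" and S = "S i" and N = "N i", OF vs flag])
  have tr_v: "tr M i j (v i n) = v j n" if "i \<le> j" "n \<in> S i" for i j n
  proof (rule tr_family[where m = "\<lambda>i. v i n" and I = "I n"])
    fix k assume "k \<in> I n"
    then show "tr M k (k + (1, 0)) (v k n) = v (k + (1, 0)) n"
      and "tr M k (k + (0, 1)) (v k n) = v (k + (0, 1)) n"
      using splits[of n] unfolding splits_def v_def by (cases k; simp)+
  next
    show "poset_convex (I n)" "i \<in> I n"
      using spread[of n] that(2) unfolding spread_curve_def A_def S_def by blast+
  qed (use v_car out_S that in \<open>auto simp: S_def\<close>)
  \<comment> \<open>Elements of the direct sum are \<open>undefined\<close> off \<open>A\<close>,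
    whereas \<open>combo\<close> runs over all natural numbers.\<close>
  define ext where "ext w n = (if n \<in> A then w n else \<zero>\<^bsub>K\<^esub>)" for w and n :: nat
  define \<Psi> where "\<Psi> i w = vectorspace.combo (ob M i) (ext w) (v i) (N i)" for i w
  let ?P = "spread_sum K A I"
  have ext: "ext w n \<in> carrier K" "n \<notin> S i \<Longrightarrow> ext w n = \<zero>\<^bsub>K\<^esub>" if "w \<in> carrier (ob ?P i)" for w i n
    using that unfolding spread_sum_carrier[OF K] ext_def S_def by auto
  have \<Psi>_closed: "\<Psi> i w \<in> carrier (ob M i)" if "w \<in> carrier (ob ?P i)" for i w
    unfolding \<Psi>_def using vectorspace.combo_closed[OF vs] ext(1)[OF that] v_car by blast
  have lin: "linear_map K (ob ?P i) (ob M i) (\<Psi> i)" for i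
  proof (rule linear_mapI[OF spread_sum_vectorspace[OF K] vs \<Psi>_closed])
    fix w w' assume w: "w \<in> carrier (ob ?P i)" "w' \<in> carrier (ob ?P i)"
    have "ext (w \<oplus>\<^bsub>ob ?P i\<^esub> w') = (\<lambda>n. ext w n \<oplus>\<^bsub>K\<^esub> ext w' n)"
      by (auto simp: ext_def spread_sum_simps[OF K])
    then show "\<Psi> i (w \<oplus>\<^bsub>ob ?P i\<^esub> w') = \<Psi> i w \<oplus>\<^bsub>ob M i\<^esub> \<Psi> i w'"
      unfolding \<Psi>_def using vectorspace.combo_add[OF vs ext(1)[OF w(1)] ext(1)[OF w(2)] v_car] by simp
  next
    fix r w assume r: "r \<in> carrier K" and w: "w \<in> carrier (ob ?P i)"
    have "ext (r \<odot>\<^bsub>ob ?P i\<^esub> w) = (\<lambda>n. r \<otimes>\<^bsub>K\<^esub> ext w n)"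
      using r by (auto simp: ext_def spread_sum_simps[OF K])
    then show "\<Psi> i (r \<odot>\<^bsub>ob ?P i\<^esub> w) = r \<odot>\<^bsub>ob M i\<^esub> \<Psi> i w"
      unfolding \<Psi>_def using vectorspace.combo_smult[OF vs ext(1)[OF w] r v_car] by simp
  qed
  have bij: "bij_betw (\<Psi> i) (carrier (ob ?P i)) (carrier (ob M i))" for i
  proof -
    interpret l: linear_map K "ob ?P i" "ob M i" "\<Psi> i"
      by (rule lin)
    have "w = \<zero>\<^bsub>ob ?P i\<^esub>" if w: "w \<in> carrier (ob ?P i)" "\<Psi> i w = \<zero>\<^bsub>ob M i\<^esub>" for w
    proof -
      have "ext w n = \<zero>\<^bsub>K\<^esub>" for n
      proof (cases "n \<in> S i")
        case True
        have "vectorspace.combo (ob M i) (ext w) (v i) (N i) = \<zero>\<^bsub>ob M i\<^esub>"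
          using w(2) by (simp add: \<Psi>_def)
        from vectorspace.combo_inj[where V = "ob M i" and W = "F i" and m = "v i" and S = "S i" and N = "N i",
            OF vs flag ext(1)[OF w(1)] this True]
        show ?thesis .
      qed (rule ext(2)[OF w(1)])
      then show ?thesis
        using w(1) unfolding spread_sum_carrier[OF K] spread_sum_simps[OF K] ext_def
        by (metis (no_types, lifting) extensionalityI restrict_apply' restrict_extensional)
    qed
    then have "mod_hom.ker (ob ?P i) (ob M i) (\<Psi> i) = {\<zero>\<^bsub>ob ?P i\<^esub>}"
      using l.T0_is_0 unfolding l.ker_def by auto
    then have "inj_on (\<Psi> i) (carrier (ob ?P i))"
      by (intro l.Ke0_imp_inj) simp
    moreover have "\<exists>w\<in>carrier (ob ?P i). \<Psi> i w = u" if u: "u \<in> carrier (ob M i)" for u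
    proof -
      obtain c where c: "\<And>n. c n \<in> carrier K" "\<And>n. n \<notin> S i \<Longrightarrow> c n = \<zero>\<^bsub>K\<^esub>"
        "vectorspace.combo (ob M i) c (v i) (N i) = u"
        using vectorspace.combo_surj[where V = "ob M i" and W = "F i" and m = "v i" and S = "S i" and N = "N i", OF vs flag u] by blast
      have SA: "S i \<subseteq> A"
        by (auto simp: S_def A_def)
      have "ext (restrict c A) = c"
        using c(2)[symmetric] SA by (auto simp: ext_def fun_eq_iff)
      moreover have "S i \<subseteq> {..<N i}"
        using vectorspace.S_less[where V = "ob M i" and W = "F i" and m = "v i" and S = "S i" and N = "N i", OF vs flag] by blast
      then have "finite (S i)"
        using finite_subset by blast
      then have "finite {n \<in> A. restrict c A n \<noteq> \<zero>\<^bsub>K\<^esub>}"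
        using c(2) by (elim finite_subset[rotated]) auto
      then have "restrict c A \<in> carrier (ob ?P i)"
        using c unfolding spread_sum_carrier[OF K] by (auto simp: S_def)
      ultimately show ?thesis
        using c(3) unfolding \<Psi>_def by (intro bexI[of _ "restrict c A"]) simp
    qed
    ultimately show ?thesis
      unfolding bij_betw_def using \<Psi>_closed by blast
  qed
  have nat: "\<Psi> j (tr ?P i j w) = tr M i j (\<Psi> i w)" if ij: "i \<le> j" and w: "w \<in> carrier (ob ?P i)" for i j w
  proof -
    \<comment> \<open>The two points have different lengths of summation. Both sums may be prolonged
      to a common length without changing, and are then compared term by term.\<close>
    define L where "L = max (N i) (N j)"
    have w': "tr ?P i j w \<in> carrier (ob ?P j)"
      by (rule spread_sum_tr_closed[OF K w])
    note e = ext(1)[OF w] and e' = ext(1)[OF w']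
    have "\<Psi> j (tr ?P i j w) = vectorspace.combo (ob M j) (ext (tr ?P i j w)) (v j) L"
      unfolding \<Psi>_def L_def by (rule vectorspace.combo_late[where V = "ob M j" and W = "F j" and m = "v j" and S = "S j" and N = "N j", OF vs flag e', symmetric]) simp_all
    also have "\<dots> = vectorspace.combo (ob M j) (ext w) (\<lambda>n. tr M i j (v i n)) L"
    proof (rule vectorspace.combo_cong[OF vs])
      fix n
      interpret J: vectorspace K "ob M j"
        by (rule vs)
      have ext': "ext (tr ?P i j w) n = (if n \<in> S i \<and> n \<in> S j then ext w n else \<zero>\<^bsub>K\<^esub>)"
        by (auto simp: ext_def spread_sum_simps[OF K] S_def A_def)
      show "ext (tr ?P i j w) n \<odot>\<^bsub>ob M j\<^esub> v j n = ext w n \<odot>\<^bsub>ob M j\<^esub> tr M i j (v i n)"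
      proof (cases "n \<in> S i")
        case True
        then show ?thesis
          using tr_v[OF ij True] out_S[of n j] e[of n] by (simp add: ext')
      next
        case False
        then show ?thesis
          using ext(2)[OF w False] tr_closed[OF ij v_car] v_car by (simp add: ext')
      qed
    qed
    also have "\<dots> = tr M i j (vectorspace.combo (ob M i) (ext w) (v i) L)"
    proof (induction L)
      case 0
      then show ?case
        using tr_zero[OF ij] by (simp add: vectorspace.combo.simps[OF vs])
    next
      case (Suc n)
      interpret J: vectorspace K "ob M i"
        by (rule vs)
      note D = linear_mapD[OF linear[OF ij]]
      show ?case
        using Suc D(4)[OF J.combo_closed[OF e v_car], of "ext w n \<odot>\<^bsub>ob M i\<^esub> v i n"] D(5)[OF e v_car] e v_car
        by (simp add: vectorspace.combo.simps[OF vs])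
    qed
    also have "vectorspace.combo (ob M i) (ext w) (v i) L = \<Psi> i w"
      unfolding \<Psi>_def L_def by (rule vectorspace.combo_late[where V = "ob M i" and W = "F i" and m = "v i" and S = "S i" and N = "N i", OF vs flag e]) simp_all
    finally show ?thesis .
  qed
  have "rep_iso K ?P M"
    unfolding rep_iso_def rep_morphism_def using lin nat bij by blast
  then have "rep_iso K M ?P"
    using spread_sum_tr_closed[OF K] by (rule rep_iso_sym) 
  then show ?thesis
    unfolding spread_curve_decomposition_def using spread by blast
qed

end

section \<open>Uniqueness of decompositions\<close>

text \<open>A morphism between the spread representations of \<open>I\<close> and \<open>J\<close>,
  recorded by its scalars. The last clause is all of naturality, since squares starting outside
  \<open>I\<close> or ending outside \<open>J\<close> commute trivially.\<close>

definition spread_hom ::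
  "('k, 'm) ring_scheme \<Rightarrow> (int \<times> int) set \<Rightarrow> (int \<times> int) set \<Rightarrow> (int \<times> int \<Rightarrow> 'k) \<Rightarrow> bool" where
  "spread_hom K I J \<alpha> \<longleftrightarrow> (\<forall>q. \<alpha> q \<in> carrier K) \<and> (\<forall>q. q \<notin> I \<or> q \<notin> J \<longrightarrow> \<alpha> q = \<zero>\<^bsub>K\<^esub>) \<and>
     (\<forall>q q'. q \<le> q' \<longrightarrow> q \<in> I \<longrightarrow> q' \<in> J \<longrightarrow> \<alpha> q = \<alpha> q')"

lemma spread_homD:
  assumes "spread_hom K I J \<alpha>"
  shows "\<alpha> q \<in> carrier K" "q \<notin> I \<Longrightarrow> \<alpha> q = \<zero>\<^bsub>K\<^esub>" "q \<notin> J \<Longrightarrow> \<alpha> q = \<zero>\<^bsub>K\<^esub>"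
    and "q \<le> q' \<Longrightarrow> q \<in> I \<Longrightarrow> q' \<in> J \<Longrightarrow> \<alpha> q = \<alpha> q'"
proof -
  note h = assms[unfolded spread_hom_def]
  show "\<alpha> q \<in> carrier K"
    by (rule spec[OF conjunct1[OF h]])
  show "q \<notin> I \<Longrightarrow> \<alpha> q = \<zero>\<^bsub>K\<^esub>" "q \<notin> J \<Longrightarrow> \<alpha> q = \<zero>\<^bsub>K\<^esub>"
    by (rule spec[OF conjunct1[OF conjunct2[OF h]], THEN mp], simp)+
  show "q \<le> q' \<Longrightarrow> q \<in> I \<Longrightarrow> q' \<in> J \<Longrightarrow> \<alpha> q = \<alpha> q'"
    by (rule conjunct2[OF conjunct2[OF h], rule_format])
qed

text \<open>
  A composite \<open>I \<rightarrow> J \<rightarrow> I\<close> is a single scalar because \<open>I\<close> is connected, and this scalar is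
  zero as soon as \<open>I\<close> has a point outside \<open>J\<close>.
\<close>

lemma (in field) spread_hom_comp_aux:
  assumes \<alpha>: "spread_hom R I J \<alpha>" and \<beta>: "spread_hom R J I \<beta>"
    and I: "poset_connected I" and r: "r \<in> I" "r \<notin> J"
  shows "\<alpha> q \<otimes> \<beta> q = \<zero>"
proof (cases "q \<in> I")
  case True
  note car = spread_homD(1)[OF \<alpha>] spread_homD(1)[OF \<beta>]
    and out = spread_homD(3)[OF \<alpha>] spread_homD(2)[OF \<beta>]
    and \<alpha>_eq = spread_homD(4)[OF \<alpha>] and \<beta>_eq = spread_homD(4)[OF \<beta>]
  have eq: "\<alpha> u \<otimes> \<beta> u = \<alpha> v \<otimes> \<beta> v" if uv: "u \<in> I" "v \<in> I" "u \<le> v" for u v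
  proof (cases "v \<in> J")
    case True
    then have \<alpha>: "\<alpha> u = \<alpha> v"
      by (rule \<alpha>_eq[OF uv(3,1)])
    show ?thesis
    proof (cases "u \<in> J")
      case True
      then show ?thesis
        using \<alpha> \<beta>_eq[OF uv(3) True uv(2)] by simp
    next
      case False
      then have z: "\<alpha> u = \<zero>"
        by (rule out(1))
      have "\<alpha> v = \<zero>"
        using \<alpha> unfolding z by (rule sym)
      with z show ?thesis
        using car by simp
    qed
  next
    case False
    then show ?thesis
      using \<beta>_eq[OF uv(3) _ uv(2)] out[of v] out[of u] car by (cases "u \<in> J") simp_all
  qed
  have "(\<lambda>u v. u \<in> I \<and> v \<in> I \<and> (u \<le> v \<or> v \<le> u))\<^sup>*\<^sup>* r q"
    by (rule I[unfolded poset_connected_def, rule_format, OF r(1) True])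
  then have "\<alpha> q \<otimes> \<beta> q = \<alpha> r \<otimes> \<beta> r"
  proof (induction rule: rtranclp_induct)
    case (step u v)
    have uv: "u \<in> I" "v \<in> I" "u \<le> v \<or> v \<le> u"
      using step.hyps(2) by simp_all
    from uv(3) have "\<alpha> v \<otimes> \<beta> v = \<alpha> u \<otimes> \<beta> u"
    proof
      assume "u \<le> v"
      then show ?thesis
        by (rule eq[OF uv(1,2), symmetric])
    next
      assume "v \<le> u"
      then show ?thesis
        by (rule eq[OF uv(2,1)])
    qed
    then show ?case
      using step.IH by (rule trans)
  qed (rule refl)
  then show ?thesis
    using out[OF r(2)] by (simp only: l_null[OF zero_closed])
next
  case False
  then show ?thesis
    using spread_homD(2)[OF \<alpha>] spread_homD(1)[OF \<beta>] by simp
qed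

text \<open>If only \<open>J\<close> has a point outside the other set, the composite in the
  opposite order vanishes, and scalars commute.\<close>

lemma (in field) spread_hom_comp:
  assumes \<alpha>: "spread_hom R I J \<alpha>" and \<beta>: "spread_hom R J I \<beta>"
    and I: "poset_connected I" and J: "poset_connected J" and ne: "I \<noteq> J"
  shows "\<alpha> q \<otimes> \<beta> q = \<zero>"
proof -
  consider r where "r \<in> I" "r \<notin> J" | r where "r \<in> J" "r \<notin> I"
    using ne by blast
  then show ?thesis
  proof cases
    case 1
    then show ?thesis
      using spread_hom_comp_aux[OF \<alpha> \<beta> I] by blast
  next
    case 2
    then have "\<beta> q \<otimes> \<alpha> q = \<zero>"
      using spread_hom_comp_aux[OF \<beta> \<alpha> J] by blast
    then show ?thesis
      using m_comm[OF spread_homD(1)[OF \<alpha>, of q] spread_homD(1)[OF \<beta>, of q]] by simp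
  qed
qed

text \<open>The family \<open>w\<close> is independent, because the kernel of
  \<open>\<epsilon> a\<close> contains every other member but not \<open>w a\<close>. The exchange
  lemma then bounds its size by that of \<open>T\<close>.\<close>

lemma (in vectorspace) dual_family_card:
  assumes \<epsilon>: "\<And>a. a \<in> S \<Longrightarrow> subspace K {v \<in> carrier V. \<epsilon> a v = \<zero>\<^bsub>K\<^esub>} V"
    and w: "\<And>a. a \<in> S \<Longrightarrow> w a \<in> span T"
    and dual: "\<And>a b. a \<in> S \<Longrightarrow> b \<in> S \<Longrightarrow> \<epsilon> a (w b) = (if a = b then \<one>\<^bsub>K\<^esub> else \<zero>\<^bsub>K\<^esub>)"
    and S: "finite S" and T: "finite T" "T \<subseteq> carrier V"
  shows "card S \<le> card T"
proof -
  have inj: "inj_on w S"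
  proof (rule inj_onI, rule ccontr)
    fix a b assume ab: "a \<in> S" "b \<in> S" "w a = w b" "a \<noteq> b"
    then show False
      using dual[OF ab(1,1)] dual[OF ab(1,2)] by simp
  qed
  have car: "w ` S \<subseteq> carrier V"
    by (rule image_subsetI) (rule subsetD[OF span_is_subset2[OF T(2)] w])
  have "lin_indpt (w ` S)"
  proof
    assume "lin_dep (w ` S)"
    then obtain a where a: "a \<in> S" "w a \<in> span (w ` S - {w a})"
      using lindep_span[OF car] S by auto
    have "w ` S - {w a} \<subseteq> {v \<in> carrier V. \<epsilon> a v = \<zero>\<^bsub>K\<^esub>}"
      using dual[OF a(1)] car by auto
    then have "span (w ` S - {w a}) \<subseteq> {v \<in> carrier V. \<epsilon> a v = \<zero>\<^bsub>K\<^esub>}"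
      using \<epsilon>[OF a(1)] by (intro span_is_subset) (simp_all add: subspace_def)
    then show False
      using a dual[of a a] by auto
  qed
  then have "\<exists>C. finite C \<and> C \<subseteq> carrier V \<and> C \<subseteq> span T \<and> C \<inter> w ` S = {} \<and>
      int (card C) \<le> int (card T) - int (card (w ` S)) \<and> span (w ` S \<union> C) = span T"
    using w by (intro replacement finite_imageI S T image_subsetI)
  then obtain C where "finite C \<and> C \<subseteq> carrier V \<and> C \<subseteq> span T \<and> C \<inter> w ` S = {} \<and>
      int (card C) \<le> int (card T) - int (card (w ` S)) \<and> span (w ` S \<union> C) = span T" ..
  then have "int (card C) \<le> int (card T) - int (card (w ` S))"
    by (elim conjE)
  then show ?thesis
    using card_image[OF inj] by linarith
qed

text \<open>An isomorphism onto a direct sum, read as coordinate functions on \<open>M\<close>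
  itself. Two decompositions become two interpretations over the same spaces, with unrelated index
  types.\<close>

locale spread_basis = ZZ_rep K M for K :: "('k, 'm) ring_scheme" and M :: "('k, 'v) zz_rep" +
  fixes A :: "'i set" and I :: "'i \<Rightarrow> (int \<times> int) set" and coord :: "int \<times> int \<Rightarrow> 'v \<Rightarrow> 'i \<Rightarrow> 'k"
  assumes curve: "a \<in> A \<Longrightarrow> spread_curve (I a)"
    and coord_closed: "v \<in> carrier (ob M i) \<Longrightarrow> a \<in> A \<Longrightarrow> coord i v a \<in> carrier K"
    and coord_add: "v \<in> carrier (ob M i) \<Longrightarrow> w \<in> carrier (ob M i) \<Longrightarrow> a \<in> A \<Longrightarrow>
          coord i (v \<oplus>\<^bsub>ob M i\<^esub> w) a = coord i v a \<oplus>\<^bsub>K\<^esub> coord i w a"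
    and coord_smult: "r \<in> carrier K \<Longrightarrow> v \<in> carrier (ob M i) \<Longrightarrow> a \<in> A \<Longrightarrow>
          coord i (r \<odot>\<^bsub>ob M i\<^esub> v) a = r \<otimes>\<^bsub>K\<^esub> coord i v a"
    and coord_outside: "v \<in> carrier (ob M i) \<Longrightarrow> a \<in> A \<Longrightarrow> i \<notin> I a \<Longrightarrow> coord i v a = \<zero>\<^bsub>K\<^esub>"
    and coord_finite: "v \<in> carrier (ob M i) \<Longrightarrow> finite {a \<in> A. coord i v a \<noteq> \<zero>\<^bsub>K\<^esub>}"
    and coord_inj: "v \<in> carrier (ob M i) \<Longrightarrow> w \<in> carrier (ob M i) \<Longrightarrow>
          (\<And>a. a \<in> A \<Longrightarrow> coord i v a = coord i w a) \<Longrightarrow> v = w"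
    and coord_surj: "(\<And>a. a \<in> A \<Longrightarrow> c a \<in> carrier K) \<Longrightarrow> (\<And>a. a \<in> A \<Longrightarrow> i \<notin> I a \<Longrightarrow> c a = \<zero>\<^bsub>K\<^esub>) \<Longrightarrow>
          finite {a \<in> A. c a \<noteq> \<zero>\<^bsub>K\<^esub>} \<Longrightarrow> \<exists>v\<in>carrier (ob M i). \<forall>a\<in>A. coord i v a = c a"
    and coord_tr: "i \<le> j \<Longrightarrow> v \<in> carrier (ob M i) \<Longrightarrow> a \<in> A \<Longrightarrow>
          coord j (tr M i j v) a = (if i \<in> I a \<and> j \<in> I a then coord i v a else \<zero>\<^bsub>K\<^esub>)"
begin

lemma is_field: "field K"
  using vectorspace vectorspace_def by blast

interpretation K: field K
  by (rule is_field)

lemma curve_nonempty: "a \<in> A \<Longrightarrow> I a \<noteq> {}"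
  using curve[of a] by (simp add: spread_curve_def)

definition unit :: "'i \<Rightarrow> int \<times> int \<Rightarrow> 'v" where
  "unit a i = (SOME v. v \<in> carrier (ob M i) \<and>
     (\<forall>b\<in>A. coord i v b = (if b = a \<and> i \<in> I a then \<one>\<^bsub>K\<^esub> else \<zero>\<^bsub>K\<^esub>)))"

lemma unit_closed: "unit a i \<in> carrier (ob M i)"
  and coord_unit: "b \<in> A \<Longrightarrow> coord i (unit a i) b = (if b = a \<and> i \<in> I a then \<one>\<^bsub>K\<^esub> else \<zero>\<^bsub>K\<^esub>)"
proof -
  let ?c = "\<lambda>b. if b = a \<and> i \<in> I a then \<one>\<^bsub>K\<^esub> else \<zero>\<^bsub>K\<^esub>"
  have "finite {b \<in> A. ?c b \<noteq> \<zero>\<^bsub>K\<^esub>}"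
    by (rule finite_subset[of _ "{a}"]) auto
  then have "\<exists>v\<in>carrier (ob M i). \<forall>b\<in>A. coord i v b = ?c b"
    by (intro coord_surj) auto
  from someI_ex[OF this[unfolded Bex_def], folded unit_def]
  have u: "unit a i \<in> carrier (ob M i) \<and> (\<forall>b\<in>A. coord i (unit a i) b = ?c b)" .
  show "unit a i \<in> carrier (ob M i)"
    by (rule conjunct1[OF u])
  show "b \<in> A \<Longrightarrow> coord i (unit a i) b = ?c b"
    by (rule bspec[OF conjunct2[OF u]])
qed

lemma coord_zero:
  assumes a: "a \<in> A"
  shows "coord i \<zero>\<^bsub>ob M i\<^esub> a = \<zero>\<^bsub>K\<^esub>"
proof -
  interpret V: vectorspace K "ob M i"
    by (rule vectorspace)
  show ?thesis
    using coord_smult[OF K.zero_closed V.M.zero_closed a] coord_closed[OF V.M.zero_closed a] by simp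
qed

lemma coord_kernel_subspace:
  assumes "a \<in> A"
  shows "subspace K {v \<in> carrier (ob M i). coord i v a = \<zero>\<^bsub>K\<^esub>} (ob M i)"
proof -
  interpret V: vectorspace K "ob M i"
    by (rule vectorspace)
  show ?thesis
    using assms by (intro V.subspaceI) (auto simp: coord_zero coord_add coord_smult)
qed

lemma unit_tr:
  assumes "i \<le> j" "i \<in> I a"
  shows "tr M i j (unit a i) = unit a j"
  using assms by (intro coord_inj[of _ j] tr_closed unit_closed) (auto simp: coord_tr coord_unit unit_closed)

lemma unit_zero:
  assumes "i \<notin> I a"
  shows "unit a i = \<zero>\<^bsub>ob M i\<^esub>"
proof -
  interpret V: vectorspace K "ob M i"
    by (rule vectorspace)
  show ?thesis
    using assms by (intro coord_inj[of _ i] unit_closed V.M.zero_closed) (auto simp: coord_unit coord_zero)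
qed

text \<open>Stands in for writing \<open>v\<close> as the sum of its components. The induction
  removes one component at a time from a finite set that covers the support of
  \<open>v\<close>.\<close>

lemma mem_subspace:
  assumes U: "subspace K U (ob M i)" and v: "v \<in> carrier (ob M i)"
    and mem: "\<And>a. a \<in> A \<Longrightarrow> coord i v a \<odot>\<^bsub>ob M i\<^esub> unit a i \<in> U"
  shows "v \<in> U"
proof -
  interpret V: vectorspace K "ob M i"
    by (rule vectorspace)
  have in_U: "v \<in> U" if "finite S" "{a \<in> A. coord i v a \<noteq> \<zero>\<^bsub>K\<^esub>} \<subseteq> S" "v \<in> carrier (ob M i)"
    "\<And>a. a \<in> A \<Longrightarrow> coord i v a \<odot>\<^bsub>ob M i\<^esub> unit a i \<in> U" for S v
    using that
  proof (induction S arbitrary: v rule: finite_induct)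
    case empty
    then have "v = \<zero>\<^bsub>ob M i\<^esub>"
      by (intro coord_inj[of _ i]) (auto simp: coord_zero)
    then show ?case
      using V.subspace_props(2)[OF U] by simp
  next
    case (insert s S)
    show ?case
    proof (cases "s \<in> A")
      case True
      let ?c = "coord i v s"
      have c: "?c \<in> carrier K" "\<ominus>\<^bsub>K\<^esub> ?c \<in> carrier K"
        using coord_closed insert.prems(2) True by auto
      let ?u = "?c \<odot>\<^bsub>ob M i\<^esub> unit s i"
      define w where "w = v \<oplus>\<^bsub>ob M i\<^esub> (\<ominus>\<^bsub>K\<^esub> ?c) \<odot>\<^bsub>ob M i\<^esub> unit s i"
      have w: "w \<in> carrier (ob M i)"
        using insert.prems(2) c unit_closed by (simp add: w_def)
      have coord_w: "coord i w a = (if a = s then \<zero>\<^bsub>K\<^esub> else coord i v a)" if "a \<in> A" for a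
        using that True c insert.prems(2) coord_outside[of v i s] coord_closed[of v i a]
        by (simp add: w_def coord_add coord_smult coord_unit unit_closed K.r_neg)
      have "w \<in> U"
      proof (rule insert.IH)
        show "{a \<in> A. coord i w a \<noteq> \<zero>\<^bsub>K\<^esub>} \<subseteq> S"
        proof
          fix a assume "a \<in> {a \<in> A. coord i w a \<noteq> \<zero>\<^bsub>K\<^esub>}"
          then have a: "a \<in> A" "coord i w a \<noteq> \<zero>\<^bsub>K\<^esub>"
            by simp_all
          then have "a \<noteq> s \<and> coord i v a \<noteq> \<zero>\<^bsub>K\<^esub>"
            using coord_w[OF a(1)] by metis
          then show "a \<in> S"
            using insert.prems(1) a(1) by blast
        qed
        show "coord i w a \<odot>\<^bsub>ob M i\<^esub> unit a i \<in> U" if "a \<in> A" for a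
          using insert.prems(3)[OF that] V.subspace_props(2)[OF U] that unit_closed by (simp add: coord_w)
      qed (rule w)
      moreover have "v = w \<oplus>\<^bsub>ob M i\<^esub> ?u"
      proof (rule coord_inj[of _ i])
        show "coord i v a = coord i (w \<oplus>\<^bsub>ob M i\<^esub> ?u) a" if "a \<in> A" for a
          using that True c w insert.prems(2) coord_closed[of v i a] coord_outside[of v i s] unit_closed
          by (simp add: coord_add coord_smult coord_unit coord_w)
      qed (use insert.prems(2) w c unit_closed in auto)
      ultimately show ?thesis
        using insert.prems(3)[OF True] V.subspace_props(3)[OF U] by metis
    next
      case False
      then have "{a \<in> A. coord i v a \<noteq> \<zero>\<^bsub>K\<^esub>} \<subseteq> S"
        using insert.prems(1) by auto
      from insert.IH[OF this insert.prems(2,3)] show ?thesis .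
    qed
  qed
  from in_U[OF coord_finite[OF v] subset_refl v mem] show ?thesis .
qed

text \<open>At a point of \<open>c\<close> all these summands are alive at once and their unit
  vectors have the coordinates as dual functionals, so a generating set at this single point bounds
  their number.\<close>

lemma finite_multiplicity: "finite {a \<in> A. I a = c}"
proof (cases "c = {}")
  case True
  then have "{a \<in> A. I a = c} = {}"
    using curve_nonempty by blast
  then show ?thesis
    by (simp only: finite.emptyI)
next
  case False
  then obtain p where p: "p \<in> c"
    by blast
  interpret V: vectorspace K "ob M p"
    by (rule vectorspace)
  obtain T where T: "finite T" "T \<subseteq> carrier (ob M p)" "V.span T = carrier (ob M p)"
    using fin_dim[of p] unfolding V.fin_dim_def by auto
  show ?thesis
  proof (rule ccontr)
    assume "infinite {a \<in> A. I a = c}"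
    then obtain S where S: "finite S" "card S = Suc (card T)" "S \<subseteq> {a \<in> A. I a = c}"
      using infinite_arbitrarily_large[of "{a \<in> A. I a = c}" "Suc (card T)"] by blast
    have "card S \<le> card T"
    proof (rule V.dual_family_card)
      show "subspace K {v \<in> carrier (ob M p). coord p v a = \<zero>\<^bsub>K\<^esub>} (ob M p)" if "a \<in> S" for a
        by (rule coord_kernel_subspace) (use that S(3) in blast)
      show "unit a p \<in> V.span T" if "a \<in> S" for a
        using T(3) unit_closed by simp
      show "coord p (unit a' p) a = (if a = a' then \<one>\<^bsub>K\<^esub> else \<zero>\<^bsub>K\<^esub>)" if "a \<in> S" "a' \<in> S" for a a'
      proof -
        have "a \<in> A" "p \<in> I a'"
          using that S(3) p by blast+
        then show ?thesis
          using coord_unit[of a p a'] by simp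
      qed
    qed (fact S T)+
    then show False
      using S(2) by simp
  qed
qed

end

lemma spread_basis_exists:
  assumes M: "ZZ_rep K M" and dec: "spread_curve_decomposition K M A I"
  obtains coord where "spread_basis K M A I coord"
proof -
  interpret ZZ_rep K M
    by (rule M)
  have K: "field K"
    using vectorspace vectorspace_def by blast
  obtain f where lin: "\<And>i. linear_map K (ob M i) (ob (spread_sum K A I) i) (f i)"
    and nat: "\<And>i j m. i \<le> j \<Longrightarrow> m \<in> carrier (ob M i) \<Longrightarrow> f j (tr M i j m) = tr (spread_sum K A I) i j (f i m)"
    and bij: "\<And>i. bij_betw (f i) (carrier (ob M i)) (carrier (ob (spread_sum K A I) i))"
    using conjunct2[OF dec[unfolded spread_curve_decomposition_def]] unfolding rep_iso_def rep_morphism_def by blast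
  note D = linear_mapD[OF lin]
  note car = D(3)[unfolded spread_sum_carrier[OF K]]
  have "spread_basis K M A I f"
  proof (unfold_locales)
    fix i v a assume v: "v \<in> carrier (ob M i)" and a: "a \<in> A"
    show "f i v a \<in> carrier K"
      using car[OF v] a by blast
    show "f i (v \<oplus>\<^bsub>ob M i\<^esub> w) a = f i v a \<oplus>\<^bsub>K\<^esub> f i w a" if "w \<in> carrier (ob M i)" for w
      using D(4)[OF v that] a by (simp add: spread_sum_simps[OF K])
    show "f i (r \<odot>\<^bsub>ob M i\<^esub> v) a = r \<otimes>\<^bsub>K\<^esub> f i v a" if "r \<in> carrier K" for r
      using D(5)[OF that v] a by (simp add: spread_sum_simps[OF K])
    show "f i v a = \<zero>\<^bsub>K\<^esub>" if "i \<notin> I a"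
      using car[OF v] a that by blast
    show "f j (tr M i j v) a = (if i \<in> I a \<and> j \<in> I a then f i v a else \<zero>\<^bsub>K\<^esub>)" if "i \<le> j" for j
      using nat[OF that v] a by (simp add: spread_sum_simps[OF K])
  next
    show "spread_curve (I a)" if "a \<in> A" for a
      using dec that unfolding spread_curve_decomposition_def by blast
  next
    fix i v assume v: "v \<in> carrier (ob M i)"
    show "finite {a \<in> A. f i v a \<noteq> \<zero>\<^bsub>K\<^esub>}"
      using car[OF v] by blast
    fix w assume w: "w \<in> carrier (ob M i)" and eq: "\<And>a. a \<in> A \<Longrightarrow> f i v a = f i w a"
    have "f i v = f i w"
      using car[OF v] car[OF w] eq extensionalityI by blast
    then show "v = w"
      using bij[of i] v w unfolding bij_betw_def inj_on_def by blast
  next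
    fix c i assume c: "\<And>a. a \<in> A \<Longrightarrow> c a \<in> carrier K" "\<And>a. a \<in> A \<Longrightarrow> i \<notin> I a \<Longrightarrow> c a = \<zero>\<^bsub>K\<^esub>"
      "finite {a \<in> A. c a \<noteq> \<zero>\<^bsub>K\<^esub>}"
    have "{a \<in> A. restrict c A a \<noteq> \<zero>\<^bsub>K\<^esub>} = {a \<in> A. c a \<noteq> \<zero>\<^bsub>K\<^esub>}"
      by auto
    then have "restrict c A \<in> carrier (ob (spread_sum K A I) i)"
      using c unfolding spread_sum_carrier[OF K] by auto
    then obtain v where "v \<in> carrier (ob M i)" "f i v = restrict c A"
      using bij[of i] unfolding bij_betw_def by (metis imageE)
    then show "\<exists>v\<in>carrier (ob M i). \<forall>a\<in>A. f i v a = c a"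
      by (intro bexI[of _ v]) auto
  qed
  then show ?thesis
    by (rule that)
qed

section \<open>Comparison of two decompositions\<close>

context
  fixes K :: "('k, 'm) ring_scheme" and M :: "('k, 'v) zz_rep"
    and A :: "'i set" and I :: "'i \<Rightarrow> (int \<times> int) set" and \<epsilon>
    and B :: "'j set" and J :: "'j \<Rightarrow> (int \<times> int) set" and \<phi>
  assumes A: "spread_basis K M A I \<epsilon>" and B: "spread_basis K M B J \<phi>"
begin

interpretation a: spread_basis K M A I \<epsilon>
  by (rule A)

interpretation b: spread_basis K M B J \<phi>
  by (rule B)

interpretation K: field K
  by (rule a.is_field)

text \<open>The entries of the change of basis form the inclusion of summand \<open>a\<close>
  followed by the projection to summand \<open>b\<close>. Outside its context the lemma is available
  for both orders of the two bases, as \<open>multiplicity_le\<close> requires.\<close>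

lemma spread_hom_coord:
  assumes a: "a \<in> A" and b: "b \<in> B"
  shows "spread_hom K (I a) (J b) (\<lambda>q. \<phi> q (a.unit a q) b)"
  unfolding spread_hom_def
proof (intro conjI allI impI)
  show "\<phi> q (a.unit a q) b \<in> carrier K" for q
    using b.coord_closed[OF a.unit_closed b] .
  show "\<phi> q (a.unit a q) b = \<zero>\<^bsub>K\<^esub>" if "q \<notin> I a \<or> q \<notin> J b" for q
    using that b.coord_outside[OF a.unit_closed b] a.unit_zero b.coord_zero[OF b] by metis
  fix q q' assume q: "q \<le> q'" "q \<in> I a" "q' \<in> J b"
  have "\<phi> q' (a.unit a q') b = (if q \<in> J b then \<phi> q (a.unit a q) b else \<zero>\<^bsub>K\<^esub>)"
    using b.coord_tr[OF q(1) a.unit_closed[of a q] b] a.unit_tr[OF q(1,2)] q(3) by simp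
  then show "\<phi> q (a.unit a q) b = \<phi> q' (a.unit a q') b"
    using b.coord_outside[OF a.unit_closed b] by auto
qed

end

context
  fixes K :: "('k, 'm) ring_scheme" and M :: "('k, 'v) zz_rep"
    and A :: "'i set" and I :: "'i \<Rightarrow> (int \<times> int) set" and \<epsilon>
    and B :: "'j set" and J :: "'j \<Rightarrow> (int \<times> int) set" and \<phi>
  assumes A: "spread_basis K M A I \<epsilon>" and B: "spread_basis K M B J \<phi>"
begin

interpretation a: spread_basis K M A I \<epsilon>
  by (rule A)

interpretation b: spread_basis K M B J \<phi>
  by (rule B)

interpretation K: field K
  by (rule a.is_field)

text \<open>Project the unit vectors with support \<open>c\<close> to the \<open>B\<close>-summands
  with support \<open>c\<close>. The \<open>A\<close>-coordinates are still dual to the projections,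
  and these lie in the span of the corresponding units of \<open>B\<close>.\<close>

lemma multiplicity_le:
  assumes fin: "finite {b \<in> B. J b = c}"
  shows "card {a \<in> A. I a = c} \<le> card {b \<in> B. J b = c}"
proof (cases "{a \<in> A. I a = c} = {}")
  case False
  let ?A = "{a \<in> A. I a = c}" and ?B = "{b \<in> B. J b = c}"
  have c: "spread_curve c"
    using False a.curve by blast
  then obtain p where p: "p \<in> c"
    unfolding spread_curve_def by blast
  interpret V: vectorspace K "ob M p"
    by (rule a.vectorspace)
  let ?T = "(\<lambda>b. b.unit b p) ` ?B"
  have T: "?T \<subseteq> carrier (ob M p)"
    using b.unit_closed by blast
  have "\<exists>w\<in>carrier (ob M p). \<forall>b\<in>B. \<phi> p w b = (if J b = c then \<phi> p (a.unit a p) b else \<zero>\<^bsub>K\<^esub>)" for a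
  proof (rule b.coord_surj)
    show "finite {b \<in> B. (if J b = c then \<phi> p (a.unit a p) b else \<zero>\<^bsub>K\<^esub>) \<noteq> \<zero>\<^bsub>K\<^esub>}"
      by (rule finite_subset[OF _ fin]) auto
    fix b assume b: "b \<in> B"
    show "(if J b = c then \<phi> p (a.unit a p) b else \<zero>\<^bsub>K\<^esub>) \<in> carrier K"
      using b.coord_closed[OF a.unit_closed b] by simp
    show "(if J b = c then \<phi> p (a.unit a p) b else \<zero>\<^bsub>K\<^esub>) = \<zero>\<^bsub>K\<^esub>" if "p \<notin> J b"
      using b.coord_outside[OF a.unit_closed b that] by simp
  qed
  then obtain w where w: "\<And>a. w a \<in> carrier (ob M p)"
    and coord_w: "\<And>a b. b \<in> B \<Longrightarrow> \<phi> p (w a) b = (if J b = c then \<phi> p (a.unit a p) b else \<zero>\<^bsub>K\<^esub>)"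
    by metis
  have "card ?A \<le> card ?T"
  proof (rule V.dual_family_card)
    show "subspace K {v \<in> carrier (ob M p). \<epsilon> p v a = \<zero>\<^bsub>K\<^esub>} (ob M p)" if "a \<in> ?A" for a
      using a.coord_kernel_subspace that by blast
    show "w a \<in> V.span ?T" if "a \<in> ?A" for a
    proof (rule b.mem_subspace[OF V.span_is_subspace[OF T] w])
      note sp = V.subspace_props[OF V.span_is_subspace[OF T]]
      show "\<phi> p (w a) b \<odot>\<^bsub>ob M p\<^esub> b.unit b p \<in> V.span ?T" if b: "b \<in> B" for b
      proof (cases "J b = c")
        case True
        then have "b.unit b p \<in> V.span ?T"
          using V.in_own_span[OF T] b by blast
        then show ?thesis
          using sp(4) b.coord_closed[OF w b] by blast
      next
        case False
        then show ?thesis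
          using coord_w[OF b] sp(2) b.unit_closed by simp
      qed
    qed
    fix a a' assume a: "a \<in> ?A" and a': "a' \<in> ?A"
    text \<open>The part of a unit vector that is supported on summands other than \<open>c\<close> has no
      \<open>c\<close>-coordinates.\<close>
    define r where "r = a.unit a' p \<ominus>\<^bsub>ob M p\<^esub> w a'"
    have r: "r \<in> carrier (ob M p)" "w a' \<oplus>\<^bsub>ob M p\<^esub> r = a.unit a' p"
      unfolding r_def using w a.unit_closed V.M.minus_cancels(1) by simp_all
    have coord_r: "\<phi> p r b = (if J b = c then \<zero>\<^bsub>K\<^esub> else \<phi> p (a.unit a' p) b)" if b: "b \<in> B" for b
    proof -
      have "\<phi> p (a.unit a' p) b = \<phi> p (w a') b \<oplus>\<^bsub>K\<^esub> \<phi> p r b"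
        using b.coord_add[OF w r(1) b, of a'] r(2) by simp
      then show ?thesis
        using coord_w[OF b, of a'] b.coord_closed[OF a.unit_closed b] b.coord_closed[OF r(1) b]
        by (auto simp: K.add.l_cancel_one' split: if_splits)
    qed
    have "r \<in> {v \<in> carrier (ob M p). \<epsilon> p v a = \<zero>\<^bsub>K\<^esub>}"
    proof (rule b.mem_subspace[OF a.coord_kernel_subspace r(1)])
      show "\<phi> p r b \<odot>\<^bsub>ob M p\<^esub> b.unit b p \<in> {v \<in> carrier (ob M p). \<epsilon> p v a = \<zero>\<^bsub>K\<^esub>}" if b: "b \<in> B" for b
      proof -
        have "\<phi> p r b \<otimes>\<^bsub>K\<^esub> \<epsilon> p (b.unit b p) a = \<zero>\<^bsub>K\<^esub>"
        proof (cases "J b = c")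
          case True
          then show ?thesis
            using coord_r[OF b] a.coord_closed[OF b.unit_closed] a by simp
        next
          case False
          \<comment> \<open>The product of the two coefficients is the scalar at \<open>p\<close> of
            a composite that starts and ends at \<open>c\<close> and passes through
            \<open>J b\<close>, which differs from \<open>c\<close>.\<close>
          have "spread_hom K c (J b) (\<lambda>q. \<phi> q (a.unit a' q) b)"
            using spread_hom_coord[OF A B, of a' b] a' b by auto
          moreover have "spread_hom K (J b) c (\<lambda>q. \<epsilon> q (b.unit b q) a)"
            using spread_hom_coord[OF B A, of b a] a b by auto
          ultimately have "\<phi> p (a.unit a' p) b \<otimes>\<^bsub>K\<^esub> \<epsilon> p (b.unit b p) a = \<zero>\<^bsub>K\<^esub>"
            using K.spread_hom_comp[of c "J b"] c b.curve[OF b] False unfolding spread_curve_def by blast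
          then show ?thesis
            using coord_r[OF b] False by simp
        qed
        then show ?thesis
          using a.coord_smult[OF b.coord_closed[OF r(1) b] b.unit_closed] b.unit_closed
            b.coord_closed[OF r(1) b] a by simp
      qed
    qed (use a in blast)
    then have "\<epsilon> p r a = \<zero>\<^bsub>K\<^esub>"
      by blast
    then have "\<epsilon> p (w a') a = \<epsilon> p (a.unit a' p) a"
      using a.coord_add[OF w r(1), of a a'] r(2) a.coord_closed[OF w] a by simp
    then show "\<epsilon> p (w a') a = (if a = a' then \<one>\<^bsub>K\<^esub> else \<zero>\<^bsub>K\<^esub>)"
      using a.coord_unit[of a p a'] a a' p by simp
  qed (use a.finite_multiplicity fin T in auto)
  also have "\<dots> \<le> card ?B"
    using fin by (rule card_image_le)
  finally show ?thesis .
next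
  case True
  then show ?thesis
    by (simp only: card.empty le0)
qed

end

lemma spread_rep_iso_refl:
  assumes K: "field K"
  shows "rep_iso K (spread_rep K I) (spread_rep K I)"
proof -
  have "linear_map K (ob (spread_rep K I) i) (ob (spread_rep K I) i) id" for i
    using spread_rep_vectorspace[OF K] by (intro linear_mapI) auto
  then show ?thesis
    unfolding rep_iso_def rep_morphism_def by (intro exI[of _ "\<lambda>_. id"]) simp
qed

theorem decomposition_unique:
  assumes M: "ZZ_rep K M"
    and A: "spread_curve_decomposition K M A I" and B: "spread_curve_decomposition K M B J"
  shows "same_summands K A I B J"
proof -
  obtain \<epsilon> \<phi> where \<epsilon>: "spread_basis K M A I \<epsilon>" and \<phi>: "spread_basis K M B J \<phi>"
    using spread_basis_exists[OF M A] spread_basis_exists[OF M B] by metis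
  note fin = spread_basis.finite_multiplicity[OF \<epsilon>] spread_basis.finite_multiplicity[OF \<phi>]
  have "card {a \<in> A. I a = c} = card {b \<in> B. J b = c}" for c
    using multiplicity_le[OF \<epsilon> \<phi> fin(2)] multiplicity_le[OF \<phi> \<epsilon> fin(1)] by (rule le_antisym)
  then have "\<exists>h. bij_betw h {a \<in> A. I a = c} {b \<in> B. J b = c}" for c
    by (rule finite_same_card_bij[OF fin])
  then obtain h where h: "\<And>c. bij_betw (h c) {a \<in> A. I a = c} {b \<in> B. J b = c}"
    by metis
  \<comment> \<open>The bijections for the single supports glue, because the support of
    \<open>s a\<close> tells from which of them it comes.\<close>
  define s where "s a = h (I a) a" for a
  have s: "s a \<in> B \<and> J (s a) = I a" if "a \<in> A" for a
    using bij_betwE[OF h[of "I a"]] that unfolding s_def by simp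
  have "bij_betw s A B"
    unfolding bij_betw_def
  proof (intro conjI inj_onI equalityI subsetI)
    fix a a' assume *: "a \<in> A" "a' \<in> A" "s a = s a'"
    then have "I a = I a'"
      using s[of a] s[of a'] by simp
    then show "a = a'"
      using bij_betw_imp_inj_on[OF h[of "I a"]] * unfolding s_def inj_on_def by simp
  next
    show "b \<in> B" if "b \<in> s ` A" for b
      using that s by (elim imageE) simp
    fix b assume "b \<in> B"
    then have "b \<in> h (J b) ` {a \<in> A. I a = J b}"
      using bij_betw_imp_surj_on[OF h[of "J b"]] by simp
    then obtain a where "a \<in> A" "I a = J b" "b = h (J b) a"
      by blast
    then show "b \<in> s ` A"
      by (intro image_eqI[of _ _ a]) (simp_all add: s_def)
  qed
  moreover have "rep_iso K (spread_rep K (I a)) (spread_rep K (J (s a)))" if "a \<in> A" for a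
    using spread_rep_iso_refl[OF spread_basis.is_field[OF \<epsilon>]] s[OF that] by simp
  ultimately show ?thesis
    unfolding same_summands_def by blast
qed

section \<open>Kernels and cokernels\<close>

lemma rep_kernel_ZZ_rep:
  assumes M: "ZZ_rep K M" and f: "rep_morphism K M N f"
  shows "ZZ_rep K (rep_kernel M N f)"
proof -
  interpret M: ZZ_rep K M
    by (rule M)
  let ?k = "\<lambda>i. mod_hom.ker (ob M i) (ob N i) (f i)"
  have lin: "linear_map K (ob M i) (ob N i) (f i)"
    and nat: "i \<le> j \<Longrightarrow> m \<in> carrier (ob M i) \<Longrightarrow> f j (tr M i j m) = tr N i j (f i m)" for i j m
    using f unfolding rep_morphism_def by blast+
  have mh: "mod_hom K (ob M i) (ob N i) (f i)" for i
    using lin unfolding linear_map_def by blast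
  have ker: "m \<in> ?k i \<longleftrightarrow> m \<in> carrier (ob M i) \<and> f i m = \<zero>\<^bsub>ob N i\<^esub>" for m i
    unfolding mod_hom.ker_def[OF mh] by simp
  have sub: "subspace K (?k i) (ob M i)" for i
    by (rule linear_map.kerT_is_subspace[OF lin])
  have vs: "vectorspace K ((ob M i)\<lparr>carrier := ?k i\<rparr>)" for i
    by (rule vectorspace.subspace_is_vs[OF M.vectorspace sub])
  show ?thesis
  proof (rule ZZ_rep.intro)
    fix i j k :: "int \<times> int" and m
    show "vectorspace K (ob (rep_kernel M N f) i)"
      using vs by (simp add: rep_kernel_def)
    show "vectorspace.fin_dim K (ob (rep_kernel M N f) i)"
      using vectorspace.subspace_fin_dim[OF M.vectorspace M.fin_dim sub] by (simp add: rep_kernel_def)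
    show "m \<in> carrier (ob (rep_kernel M N f) i) \<Longrightarrow> tr (rep_kernel M N f) i i m = m"
      using M.tr_id by (simp add: rep_kernel_def ker)
    assume ij: "i \<le> j"
    \<comment> \<open>Only \<open>M\<close> is given as a representation, so this is obtained from
      naturality of \<open>f\<close> at zero.\<close>
    have "tr N i j \<zero>\<^bsub>ob N i\<^esub> = \<zero>\<^bsub>ob N j\<^esub>"
      using nat[OF ij, of "\<zero>\<^bsub>ob M i\<^esub>"] linear_mapD(6)[OF lin] M.tr_zero[OF ij]
        vectorspace.subspace_props(2)[OF M.vectorspace vectorspace.carrier_subspace[OF M.vectorspace]]
      by metis
    then show "linear_map K (ob (rep_kernel M N f) i) (ob (rep_kernel M N f) j) (tr (rep_kernel M N f) i j)"
      using vs nat[OF ij] M.tr_closed[OF ij] linear_mapD(4,5)[OF M.linear[OF ij]]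
      by (intro linear_mapI) (simp_all add: rep_kernel_def ker)
    assume "j \<le> k" and "m \<in> carrier (ob (rep_kernel M N f) i)"
    then show "tr (rep_kernel M N f) j k (tr (rep_kernel M N f) i j m) = tr (rep_kernel M N f) i k m"
      using M.tr_comp[OF ij] by (simp add: rep_kernel_def ker)
  qed
qed

text \<open>The axioms are identities together with the existence of negatives, and both pass
  through a surjection that respects the operations.\<close>

lemma vectorspace_image:
  assumes V: "vectorspace K V" and Q: "carrier Q = p ` carrier V"
    and add: "\<And>v w. v \<in> carrier V \<Longrightarrow> w \<in> carrier V \<Longrightarrow> p v \<oplus>\<^bsub>Q\<^esub> p w = p (v \<oplus>\<^bsub>V\<^esub> w)"
    and smult: "\<And>r v. r \<in> carrier K \<Longrightarrow> v \<in> carrier V \<Longrightarrow> r \<odot>\<^bsub>Q\<^esub> p v = p (r \<odot>\<^bsub>V\<^esub> v)"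
    and zero: "\<zero>\<^bsub>Q\<^esub> = p \<zero>\<^bsub>V\<^esub>"
  shows "vectorspace K Q" "linear_map K V Q p"
proof -
  interpret vectorspace K V
    by (rule V)
  show vs: "vectorspace K Q"
  proof (rule vs_criteria)
    show "field K" ..
    show "\<forall>v\<in>carrier Q. \<exists>w\<in>carrier Q. v \<oplus>\<^bsub>Q\<^esub> w = \<zero>\<^bsub>Q\<^esub>"
    proof
      fix v assume "v \<in> carrier Q"
      then obtain u where "u \<in> carrier V" "v = p u"
        unfolding Q by blast
      then show "\<exists>w\<in>carrier Q. v \<oplus>\<^bsub>Q\<^esub> w = \<zero>\<^bsub>Q\<^esub>"
        unfolding Q by (intro bexI[of _ "p (\<ominus>\<^bsub>V\<^esub> u)"]) (simp_all add: add zero M.r_neg)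
    qed
  qed (auto simp: Q add smult zero M.a_ac smult_assoc1 smult_l_distr smult_r_distr)
  show "linear_map K V Q p"
    using V vs by (rule linear_mapI) (simp_all add: Q add smult)
qed

section \<open>Cosets and quotient spaces\<close>

context vectorspace
begin

lemma subspace_subgroup: "subspace K H V \<Longrightarrow> subgroup H (add_monoid V)"
  by (rule subgroup.intro) (auto simp: subspace_props a_inv_def[symmetric] subsetD[OF subspace_props(1)])

lemma coset_eq:
  assumes "subspace K H V" "x \<in> carrier V" "y \<in> H +>\<^bsub>V\<^esub> x"
  shows "H +>\<^bsub>V\<^esub> y = H +>\<^bsub>V\<^esub> x"
  using M.a_repr_independence[OF assms(3,2) subspace_subgroup[OF assms(1)]] by simp

lemma coset_self:
  assumes "subspace K H V" "x \<in> carrier V"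
  shows "x \<in> H +>\<^bsub>V\<^esub> x"
  using M.a_rcosI[of "\<zero>\<^bsub>V\<^esub>" H x] subspace_props(1,2)[OF assms(1)] assms(2) by simp

text \<open>Scalar multiplication on a quotient and the transition maps of a cokernel are both
  unions over a coset. All the cosets joined are equal, so the union is the value at any
  representative.\<close>

lemma Union_cosets:
  assumes g: "linear_map K V V' g" and H: "subspace K H V" and H': "subspace K H' V'"
    and gH: "g ` H \<subseteq> H'" and x: "x \<in> carrier V"
  shows "(\<Union>y\<in>H +>\<^bsub>V\<^esub> x. H' +>\<^bsub>V'\<^esub> g y) = H' +>\<^bsub>V'\<^esub> g x"
proof -
  interpret W: vectorspace K V'
    by (rule linear_mapD(2)[OF g])
  note D = linear_mapD[OF g]
  have "H' +>\<^bsub>V'\<^esub> g y = H' +>\<^bsub>V'\<^esub> g x" if y: "y \<in> H +>\<^bsub>V\<^esub> x" for y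
  proof (rule W.coset_eq[OF H'])
    obtain h where h: "h \<in> H" "y = h \<oplus>\<^bsub>V\<^esub> x"
      using y unfolding a_r_coset_def' by blast
    have eq: "g y = g h \<oplus>\<^bsub>V'\<^esub> g x"
      using D(4)[OF subsetD[OF subspace_props(1)[OF H] h(1)] x] h(2) by simp
    have gh: "g h \<in> H'"
      using gH h(1) by blast
    show "g y \<in> H' +>\<^bsub>V'\<^esub> g x"
      unfolding a_r_coset_def' eq by (rule UN_I[OF gh]) simp
  qed (rule D(3)[OF x])
  then have "\<forall>y\<in>H +>\<^bsub>V\<^esub> x. H' +>\<^bsub>V'\<^esub> g y = H' +>\<^bsub>V'\<^esub> g x" ..
  then show ?thesis
    by (rule UN_constant_eq[OF coset_self[OF H x]])
qed

lemma quot_module_linear: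
  assumes H: "subspace K H V"
  shows "linear_map K V (quot_module V H) (\<lambda>x. H +>\<^bsub>V\<^esub> x)"
    and "vectorspace K (quot_module V H)"
    and "carrier (quot_module V H) = (\<lambda>x. H +>\<^bsub>V\<^esub> x) ` carrier V"
    and "fin_dim \<Longrightarrow> vectorspace.fin_dim K (quot_module V H)"
proof -
  interpret H: abelian_subgroup H V
    by (intro abelian_subgroupI3 additive_subgroupI subspace_subgroup[OF H]) unfold_locales
  show car: "carrier (quot_module V H) = (\<lambda>x. H +>\<^bsub>V\<^esub> x) ` carrier V"
    by (auto simp: quot_module_def A_RCOSETS_def')
  have V: "vectorspace K V" ..
  have smult: "r \<odot>\<^bsub>quot_module V H\<^esub> (H +>\<^bsub>V\<^esub> x) = H +>\<^bsub>V\<^esub> (r \<odot>\<^bsub>V\<^esub> x)"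
    if r: "r \<in> carrier K" and x: "x \<in> carrier V" for r x
  proof -
    have "linear_map K V V (\<lambda>x. r \<odot>\<^bsub>V\<^esub> x)"
      using V r by (intro linear_mapI) (simp_all add: smult_r_distr smult_assoc1[symmetric] R.m_comm)
    moreover have "(\<lambda>x. r \<odot>\<^bsub>V\<^esub> x) ` H \<subseteq> H"
      using subspace_props(4)[OF H r] by blast
    ultimately show ?thesis
      using Union_cosets[OF _ H H _ x] by (simp add: quot_module_def)
  qed
  have zero: "\<zero>\<^bsub>quot_module V H\<^esub> = H +>\<^bsub>V\<^esub> \<zero>\<^bsub>V\<^esub>"
    using subspace_props(1)[OF H] by (simp add: quot_module_def)
  have add: "(H +>\<^bsub>V\<^esub> x) \<oplus>\<^bsub>quot_module V H\<^esub> (H +>\<^bsub>V\<^esub> y) = H +>\<^bsub>V\<^esub> (x \<oplus>\<^bsub>V\<^esub> y)"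
    if "x \<in> carrier V" "y \<in> carrier V" for x y
    using H.a_rcos_sum[OF that] by (simp add: quot_module_def)
  show lin: "linear_map K V (quot_module V H) (\<lambda>x. H +>\<^bsub>V\<^esub> x)"
    by (rule vectorspace_image(2)[OF V car add smult zero])
  show "vectorspace K (quot_module V H)"
    by (rule vectorspace_image(1)[OF V car add smult zero])
  show "fin_dim \<Longrightarrow> vectorspace.fin_dim K (quot_module V H)"
    using linear_map.rank_nullity_main(2)[OF lin] car by simp
qed

end

lemma rep_cokernel_ZZ_rep:
  assumes M: "ZZ_rep K M" and N: "ZZ_rep K N" and f: "rep_morphism K M N f"
  shows "ZZ_rep K (rep_cokernel M N f)"
    and "carrier (ob (rep_cokernel M N f) i) = (\<lambda>x. f i ` carrier (ob M i) +>\<^bsub>ob N i\<^esub> x) ` carrier (ob N i)"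
    and "\<zero>\<^bsub>ob (rep_cokernel M N f) i\<^esub> = f i ` carrier (ob M i)"
    and "i \<le> j \<Longrightarrow> x \<in> carrier (ob N i) \<Longrightarrow>
      tr (rep_cokernel M N f) i j (f i ` carrier (ob M i) +>\<^bsub>ob N i\<^esub> x) = f j ` carrier (ob M j) +>\<^bsub>ob N j\<^esub> tr N i j x"
proof -
  interpret M: ZZ_rep K M
    by (rule M)
  interpret N: ZZ_rep K N
    by (rule N)
  let ?C = "rep_cokernel M N f"
  let ?H = "\<lambda>i. f i ` carrier (ob M i)"
  let ?p = "\<lambda>i x. ?H i +>\<^bsub>ob N i\<^esub> x"
  have lin: "linear_map K (ob M i) (ob N i) (f i)"
    and nat: "i \<le> j \<Longrightarrow> m \<in> carrier (ob M i) \<Longrightarrow> f j (tr M i j m) = tr N i j (f i m)" for i j m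
    using f unfolding rep_morphism_def by blast+
  have mh: "mod_hom K (ob M i) (ob N i) (f i)" for i
    using lin unfolding linear_map_def by blast
  have im: "mod_hom.im (ob M i) (f i) = ?H i" for i
    by (rule mod_hom.im_def[OF mh])
  have ob: "ob ?C i = quot_module (ob N i) (?H i)" for i
    by (simp add: rep_cokernel_def im)
  have H: "subspace K (?H i) (ob N i)" for i
    using vectorspace.linear_image_subspace[OF M.vectorspace lin vectorspace.carrier_subspace[OF M.vectorspace]] .
  note q = vectorspace.quot_module_linear[OF N.vectorspace H]
  have trH: "tr N i j ` ?H i \<subseteq> ?H j" if "i \<le> j" for i j
    using nat[OF that, symmetric] M.tr_closed[OF that] by (auto simp: image_iff)
  have tr: "tr ?C i j (?p i x) = ?p j (tr N i j x)" if "i \<le> j" "x \<in> carrier (ob N i)" for i j x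
    using vectorspace.Union_cosets[OF N.vectorspace N.linear[OF that(1)] H H trH[OF that(1)] that(2)]
    by (simp add: rep_cokernel_def im)
  have car: "carrier (ob ?C i) = ?p i ` carrier (ob N i)" for i
    unfolding ob by (rule q(3))
  have add: "?p i x \<oplus>\<^bsub>ob ?C i\<^esub> ?p i y = ?p i (x \<oplus>\<^bsub>ob N i\<^esub> y)"
    if "x \<in> carrier (ob N i)" "y \<in> carrier (ob N i)" for i x y
    unfolding ob using linear_mapD(4)[OF q(1) that] by simp
  have smult: "r \<odot>\<^bsub>ob ?C i\<^esub> ?p i x = ?p i (r \<odot>\<^bsub>ob N i\<^esub> x)"
    if "r \<in> carrier K" "x \<in> carrier (ob N i)" for i r x
    unfolding ob using linear_mapD(5)[OF q(1) that] by simp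
  show "ZZ_rep K ?C"
  proof (rule ZZ_rep.intro)
    fix i j k :: "int \<times> int" and m
    show "vectorspace K (ob ?C i)"
      unfolding ob by (rule q(2))
    show "vectorspace.fin_dim K (ob ?C i)"
      unfolding ob by (rule q(4)[OF N.fin_dim])
    show "tr ?C i i m = m" if "m \<in> carrier (ob ?C i)"
    proof -
      obtain x where "x \<in> carrier (ob N i)" "m = ?p i x"
        using \<open>m \<in> _\<close> unfolding car by (rule imageE)
      then show ?thesis
        using tr[OF order_refl] N.tr_id by simp
    qed
    assume ij: "i \<le> j"
    show "linear_map K (ob ?C i) (ob ?C j) (tr ?C i j)"
    proof (rule linear_mapI)
      show "vectorspace K (ob ?C i)" "vectorspace K (ob ?C j)"
        unfolding ob by (rule q(2))+
      fix v assume "v \<in> carrier (ob ?C i)"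
      then obtain x where x: "x \<in> carrier (ob N i)" "v = ?p i x"
        unfolding car by (elim imageE)
      show "tr ?C i j v \<in> carrier (ob ?C j)"
        unfolding x(2) tr[OF ij x(1)] car by (intro imageI N.tr_closed ij x)
      show "tr ?C i j (r \<odot>\<^bsub>ob ?C i\<^esub> v) = r \<odot>\<^bsub>ob ?C j\<^esub> tr ?C i j v" if r: "r \<in> carrier K" for r
      proof -
        have "r \<odot>\<^bsub>ob N i\<^esub> x \<in> carrier (ob N i)"
          using vectorspace.subspace_props(4)[OF N.vectorspace vectorspace.carrier_subspace[OF N.vectorspace] r x(1)] .
        then show ?thesis
          unfolding x(2) by (simp add: smult r x(1) tr ij N.tr_closed linear_mapD(5)[OF N.linear[OF ij]])
      qed
      fix w assume "w \<in> carrier (ob ?C i)"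
      then obtain y where y: "y \<in> carrier (ob N i)" "w = ?p i y"
        unfolding car by (elim imageE)
      have "x \<oplus>\<^bsub>ob N i\<^esub> y \<in> carrier (ob N i)"
        using vectorspace.subspace_props(3)[OF N.vectorspace vectorspace.carrier_subspace[OF N.vectorspace] x(1) y(1)] .
      then show "tr ?C i j (v \<oplus>\<^bsub>ob ?C i\<^esub> w) = tr ?C i j v \<oplus>\<^bsub>ob ?C j\<^esub> tr ?C i j w"
        unfolding x(2) y(2) by (simp add: add x(1) y(1) tr ij N.tr_closed linear_mapD(4)[OF N.linear[OF ij]])
    qed
    assume jk: "j \<le> k" and "m \<in> carrier (ob ?C i)"
    from this(2) obtain x where x: "x \<in> carrier (ob N i)" "m = ?p i x"
      unfolding car by (rule imageE)
    then show "tr ?C j k (tr ?C i j m) = tr ?C i k m"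
      using tr[OF ij x(1)] tr[OF jk N.tr_closed[OF ij x(1)]] tr[OF order_trans[OF ij jk] x(1)]
        N.tr_comp[OF ij jk x(1)] by simp
  qed
  show "carrier (ob ?C i) = ?p i ` carrier (ob N i)"
    by (rule car)
  show "\<zero>\<^bsub>ob ?C i\<^esub> = ?H i"
    unfolding ob by (simp add: quot_module_def)
  show "i \<le> j \<Longrightarrow> x \<in> carrier (ob N i) \<Longrightarrow> tr ?C i j (?p i x) = ?p j (tr N i j x)"
    by (rule tr)
qed

lemma rep_shift_ZZ_rep:
  assumes "ZZ_rep K M"
  shows "ZZ_rep K (rep_shift M a)"
proof -
  interpret ZZ_rep K M
    by fact
  have le: "i + a \<le> j + a" if "i \<le> j" for i j :: "int \<times> int"
    using that by (cases i; cases j; cases a) simp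
  show ?thesis
    by (rule ZZ_rep.intro) (simp_all add: rep_shift_def vectorspace fin_dim linear tr_id tr_comp le)
qed

section \<open>Multiplication by \<open>xy\<close> and the diagonal maps\<close>

context ZZ_rep
begin

lemma mult_xy_eq:
  assumes "m \<in> carrier (ob M (i + (-1, -1)))"
  shows "mult_xy M i m = tr M (i + (-1, -1)) i m"
proof -
  obtain a b where i: "i = (a, b)"
    by (cases i)
  show ?thesis
    using tr_comp[of "(a - 1, b - 1)" "(a - 1, b)" "(a, b)" m] assms
    by (simp add: i mult_xy_def x_act_def y_act_def)
qed

lemma shift_le: "i + (-1, -1) \<le> (i :: int \<times> int)"
  by (cases i) simp

lemma mult_xy_morphism: "rep_morphism K (rep_shift M (-1, -1)) M (mult_xy M)"
  unfolding rep_morphism_def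
proof (intro conjI allI impI ballI)
  fix i
  note D = linear_mapD[OF linear[OF shift_le[of i]]]
  interpret V: vectorspace K "ob M (i + (-1, -1))"
    by (rule D(1))
  have "linear_map K (ob M (i + (-1, -1))) (ob M i) (mult_xy M i)"
  proof (rule linear_mapI[OF D(1,2)])
    fix v w r
    assume v: "v \<in> carrier (ob M (i + (-1, -1)))"
    show "mult_xy M i v \<in> carrier (ob M i)"
      unfolding mult_xy_eq[OF v] by (rule D(3)[OF v])
    show "mult_xy M i (v \<oplus>\<^bsub>ob M (i + (-1, -1))\<^esub> w) = mult_xy M i v \<oplus>\<^bsub>ob M i\<^esub> mult_xy M i w"
      if w: "w \<in> carrier (ob M (i + (-1, -1)))"
      unfolding mult_xy_eq[OF v] mult_xy_eq[OF w] mult_xy_eq[OF V.M.a_closed[OF v w]] by (rule D(4)[OF v w])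
    show "mult_xy M i (r \<odot>\<^bsub>ob M (i + (-1, -1))\<^esub> v) = r \<odot>\<^bsub>ob M i\<^esub> mult_xy M i v"
      if r: "r \<in> carrier K"
      unfolding mult_xy_eq[OF v] mult_xy_eq[OF V.smult_closed[OF r v]] by (rule D(5)[OF r v])
  qed
  then show "linear_map K (ob (rep_shift M (-1, -1)) i) (ob M i) (mult_xy M i)"
    unfolding rep_shift_def zz_rep.simps .
next
  fix i j :: "int \<times> int" and m
  assume ij: "i \<le> j" and "m \<in> carrier (ob (rep_shift M (-1, -1)) i)"
  then have m: "m \<in> carrier (ob M (i + (-1, -1)))"
    by (simp add: rep_shift_def)
  have le: "i + (-1, -1) \<le> j + (-1, -1)"
    using ij by (cases i; cases j) simp
  have "mult_xy M j (tr M (i + (-1, -1)) (j + (-1, -1)) m) = tr M (i + (-1, -1)) j m"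
    unfolding mult_xy_eq[OF tr_closed[OF le m]] by (rule tr_comp[OF le shift_le m])
  also have "\<dots> = tr M i j (mult_xy M i m)"
    unfolding mult_xy_eq[OF m] by (rule tr_comp[OF shift_le ij m, symmetric])
  finally show "mult_xy M j (tr (rep_shift M (-1, -1)) i j m) = tr M i j (mult_xy M i m)"
    unfolding rep_shift_def zz_rep.simps .
qed

text \<open>The component of \<open>mult_xy M\<close> at \<open>i + (1, 1)\<close> starts at
  \<open>i\<close> and is the diagonal map there; hence diagonal maps become zero in the
  cokernel.\<close>

lemma diagonal_image:
  assumes "m \<in> carrier (ob M i)"
  shows "tr M i (i + (1, 1)) m \<in> mult_xy M (i + (1, 1)) ` carrier (ob (rep_shift M (-1, -1)) (i + (1, 1)))"
proof -
  have eq: "i + (1, 1) + (-1, -1) = i"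
    by (cases i) simp
  have "tr M i (i + (1, 1)) m = mult_xy M (i + (1, 1)) m"
    using mult_xy_eq[of m "i + (1, 1)", unfolded eq, OF assms] by (rule sym)
  moreover have "m \<in> carrier (ob (rep_shift M (-1, -1)) (i + (1, 1)))"
    unfolding rep_shift_def zz_rep.simps eq by (rule assms)
  ultimately show ?thesis
    by (rule image_eqI)
qed

end

theorem corollary3p5:
  fixes K :: "('k, 'm) ring_scheme" and M :: "('k, 'v) zz_rep"
  assumes "field K" and "ZZ_rep K M"
  shows
    "((\<exists>(A :: nat set) I.
         spread_curve_decomposition K (rep_cokernel (rep_shift M (-1, -1)) M (mult_xy M)) A I) \<and>
      (\<forall>(A :: 'i set) I (B :: 'j set) J.
         spread_curve_decomposition K (rep_cokernel (rep_shift M (-1, -1)) M (mult_xy M)) A I \<and>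
         spread_curve_decomposition K (rep_cokernel (rep_shift M (-1, -1)) M (mult_xy M)) B J \<longrightarrow>
         same_summands K A I B J)) \<and>
     ((\<exists>(A :: nat set) I.
         spread_curve_decomposition K (rep_kernel (rep_shift M (-1, -1)) M (mult_xy M)) A I) \<and>
      (\<forall>(A :: 'i set) I (B :: 'j set) J.
         spread_curve_decomposition K (rep_kernel (rep_shift M (-1, -1)) M (mult_xy M)) A I \<and>
         spread_curve_decomposition K (rep_kernel (rep_shift M (-1, -1)) M (mult_xy M)) B J \<longrightarrow>
         same_summands K A I B J))"
proof -
  interpret ZZ_rep K M
    by fact
  let ?S = "rep_shift M (-1, -1)"
  let ?C = "rep_cokernel ?S M (mult_xy M)" and ?N = "rep_kernel ?S M (mult_xy M)"
  have S: "ZZ_rep K ?S"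
    by (rule rep_shift_ZZ_rep) fact
  note C = rep_cokernel_ZZ_rep[OF S assms(2) mult_xy_morphism]
  have N: "ZZ_rep K ?N"
    by (rule rep_kernel_ZZ_rep[OF S mult_xy_morphism])
  have "tr ?C i (i + (1, 1)) m = \<zero>\<^bsub>ob ?C (i + (1, 1))\<^esub>" if m: "m \<in> carrier (ob ?C i)" for i m
  proof -
    let ?j = "i + (1, 1)"
    have le: "i \<le> ?j"
      by (cases i) simp
    obtain x where x: "x \<in> carrier (ob M i)" "m = mult_xy M i ` carrier (ob ?S i) +>\<^bsub>ob M i\<^esub> x"
      using m unfolding C(2) by (rule imageE)
    interpret V: vectorspace K "ob M ?j"
      by (rule vectorspace)
    have "linear_map K (ob ?S ?j) (ob M ?j) (mult_xy M ?j)"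
      using mult_xy_morphism unfolding rep_morphism_def by blast
    then have "subspace K (mult_xy M ?j ` carrier (ob ?S ?j)) (ob M ?j)"
      by (rule vectorspace.linear_image_subspace[OF ZZ_rep.vectorspace[OF S] _
          vectorspace.carrier_subspace[OF ZZ_rep.vectorspace[OF S]]])
    then have "mult_xy M ?j ` carrier (ob ?S ?j) +>\<^bsub>ob M ?j\<^esub> tr M i ?j x = mult_xy M ?j ` carrier (ob ?S ?j)"
      by (intro V.M.a_coset_join2 tr_closed[OF le x(1)] V.subspace_subgroup diagonal_image x(1))
    then show ?thesis
      unfolding x(2) C(3) C(4)[OF le x(1)] .
  qed
  then have exC: "\<exists>(A :: nat set) I. spread_curve_decomposition K ?C A I"
    by (rule ZZ_rep.decomposition_exists[OF C(1)])
  \<comment> \<open>The kernel lives in the shifted representation, whose diagonal map at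
    \<open>i\<close> is the component of \<open>mult_xy M\<close> at the same \<open>i\<close>; this
    is the map that kills it.\<close>
  have "tr ?N i (i + (1, 1)) m = \<zero>\<^bsub>ob ?N (i + (1, 1))\<^esub>" if m: "m \<in> carrier (ob ?N i)" for i m
  proof -
    have mh: "mod_hom K (ob ?S i) (ob M i) (mult_xy M i)"
      using mult_xy_morphism unfolding rep_morphism_def linear_map_def by blast
    have "m \<in> carrier (ob ?S i)" "mult_xy M i m = \<zero>\<^bsub>ob M i\<^esub>"
      using m by (simp_all add: rep_kernel_def mod_hom.ker_def[OF mh])
    then have "tr M (i + (-1, -1)) i m = \<zero>\<^bsub>ob M i\<^esub>"
      using mult_xy_eq[of m i] by (simp add: rep_shift_def)
    moreover have eq: "i + (1, 1) + (-1, -1) = i"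
      by (cases i) simp
    ultimately show ?thesis
      unfolding rep_kernel_def rep_shift_def zz_rep.simps module.simps monoid.simps ring.simps eq by simp
  qed
  then have "\<exists>(A :: nat set) I. spread_curve_decomposition K ?N A I"
    by (rule ZZ_rep.decomposition_exists[OF N])
  with exC show ?thesis
    using decomposition_unique[OF C(1)] decomposition_unique[OF N] by blast
qed

end
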